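(* Suppose that $\mathbb{M}(U,\tau)$ is a special Moufang set with $U$ abelian and torsion-free. If $U$ is finite-dimensional over a subfield $\Bbbk$ of the centroid of $\mathbb{M}(U,\tau)$, then $\mathbb{M}(U,\tau)$ arises from a quadratic Jordan division algebra, i.e. $\mathbb{M}(U,\tau)$ is isomorphic to $\mathbb{M}(J)$ for some quadratic Jordan division algebra $J$.
   Context: Maps act on the right and are composed from left to right; $g^h=h^{-1}gh$. A Moufang set consists of a set $X$ with $|X|\ge 3$ and a family $(U_x)_{x\in X}$ of subgroups of $\mathrm{Sym}(X)$ such that each $U_x$ fixes $x$ and acts regularly on $X\setminus\{x\}$, and $U_x^g=U_{xg}$ for all $x,y\in X$ and $g\in U_y$. An isomorphism $(X,(U_x))\to(X',(U'_{x'}))$ is a bijection $\beta:X\to X'$ with $\beta^{-1}U_x\beta=U'_{x\beta}$ for all $x\in X$. Construction $\mathbb{M}(U,\tau)$: let $(U,+)$ be a group with $|U|>1$, $U^\#=U\setminus\{0\}$, $X=U\,\dot\cup\,\{\infty\}$, and $\tau\in\mathrm{Sym}(X)$ interchanging $0$ and $\infty$. For $a\in U$ let $\alpha_a:X\to X$, $x\mapsto x+a$ for $x\in U$, $\infty\mapsto\infty$. Set $U_\infty=\{\alpha_a\mid a\in U\}$, $U_0=U_\infty^\tau$, $U_a=U_0^{\alpha_a}$ for $a\in U$, and $\mathbb{M}(U,\tau)=(X,(U_x)_{x\in X})$; saying that $\mathbb{M}(U,\tau)$ is a Moufang set is a condition on $(U,\tau)$. For $a\in U^\#$ the $\mu$-map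 is $\mu_a=\alpha_a\,\alpha_{-(a\tau^{-1})}^{\tau}\,\alpha_{-((-(a\tau^{-1}))\tau)}$ and the Hua map is $h_a=\tau\mu_a$ (for a Moufang set $h_a$ restricts to an automorphism of $U$). The Hua subgroup is $H=\langle\mu_a\mu_b\mid a,b\in U^\#\rangle$, acting on $U$ by automorphisms. The Moufang set is special if $(-a)\tau=-(a\tau)$ for all $a\in U^\#$. It is assumed (as one may, since $\mathbb{M}(U,\tau)=\mathbb{M}(U,\mu_a)$ for all $a\in U^\#$) that $\tau=\mu_e$ for some fixed $e\in U^\#$; $h_0$ is the zero map. For $U$ abelian and $\mathbb{M}(U,\tau)$ special, $\mathrm{End}_H(U)$ is the ring of endomorphisms of $U$ commuting with $H$, and the centroid is $\mathscr{C}=\{T\in\mathrm{End}_H(U)\mid h_{aT}=T^2h_a\text{ for all }a\in U\}$. A subfield of the centroid is a subfield of the ring $\mathrm{End}_H(U)$ contained in $\mathscr{C}$. Quadratic Jordan division algebra: for a field $K$, a $K$-vector space $J$, a map $Q:J\to\mathrm{End}_K(J)$, $a\mapsto Q_a$, and $1\in J\setminus\{0\}$, the triple $(J,Q,1)$ is a quadratic Jordan division algebra over $K$ if: (1) $Q_{r\cdot a}=r^2\cdot Q_a$ for all $r\in K$, $a\in J$, and $(a,b)\mapsto Q_{a,b}:=Q_{a+b}-Q_a-Q_b$ is $K$-bilinear; (2) $Q_a$ is invertible for all $a\neq 0$, and then $a^{-1}:=aQ_a^{-1}$; (3) for all $a,b\in J$: $Q_1=\mathrm{id}$; $Q_aV_{a,b}=V_{b,a}Q_a$,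 where $cV_{a,b}:=bQ_{a,c}$ for $c\in J$; and $Q_{aQ_b}=Q_bQ_aQ_b$. Its Moufang set is $\mathbb{M}(J)=\mathbb{M}(J,\tau_J)$ with $\tau_J$ interchanging $0,\infty$ and $a\tau_J=-a^{-1}$ for $a\ne 0$. *)

theory Defs
  imports
    "HOL-Algebra.Bij"
    "HOL-Algebra.Generated_Groups"
    "HOL-Algebra.Subrings"
    "Jordan_Normal_Form.Missing_VectorSpace"
begin

text \<open>
  All maps act on the right in the mathematics and are composed from left to right; here
  \<open>x f\<close> is written \<open>f x\<close>, and the product \<open>f g\<close> (first \<open>f\<close>, then \<open>g\<close>) is \<open>rcomp X f g\<close>.
  Maps on a carrier are extensional, as in \<open>Bij\<close> and \<open>BijGroup\<close>. The group \<open>BijGroup X\<close>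
  multiplies in the opposite order; this changes neither its subgroups nor the subgroup
  generated by a given set.
\<close>

definition rcomp :: "'x set \<Rightarrow> ('x \<Rightarrow> 'x) \<Rightarrow> ('x \<Rightarrow> 'x) \<Rightarrow> 'x \<Rightarrow> 'x" where
  "rcomp X f g = compose X g f"

text \<open>
  \<open>conj_map X X' b u\<close> is the transported map \<open>b\<^sup>-\<^sup>1 u b\<close> on \<open>X'\<close>, for a bijection \<open>b\<close> from \<open>X\<close>
  to \<open>X'\<close>; for \<open>X' = X\<close> it is the conjugate of \<open>u\<close> by \<open>b\<close>.
\<close>

definition conj_map :: "'x set \<Rightarrow> 'y set \<Rightarrow> ('x \<Rightarrow> 'y) \<Rightarrow> ('x \<Rightarrow> 'x) \<Rightarrow> 'y \<Rightarrow> 'y" where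
  "conj_map X X' b u = (\<lambda>y\<in>X'. b (u (inv_into X b y)))"


section \<open>Moufang sets\<close>

definition moufang_set :: "'x set \<Rightarrow> ('x \<Rightarrow> ('x \<Rightarrow> 'x) set) \<Rightarrow> bool" where
  "moufang_set X U \<longleftrightarrow>
     (infinite X \<or> card X \<ge> 3) \<and>
     (\<forall>x\<in>X. subgroup (U x) (BijGroup X) \<and>
            (\<forall>g\<in>U x. g x = x) \<and>
            (\<forall>y\<in>X - {x}. \<forall>z\<in>X - {x}. \<exists>!g. g \<in> U x \<and> g y = z)) \<and>
     (\<forall>x\<in>X. \<forall>y\<in>X. \<forall>g\<in>U y. conj_map X X g ` U x = U (g x))"

definition moufang_iso ::
  "'x set \<Rightarrow> ('x \<Rightarrow> ('x \<Rightarrow> 'x) set) \<Rightarrow> 'y set \<Rightarrow> ('y \<Rightarrow> ('y \<Rightarrow> 'y) set) \<Rightarrow> ('x \<Rightarrow> 'y) \<Rightarrow> bool" where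
  "moufang_iso X U X' U' b \<longleftrightarrow>
     bij_betw b X X' \<and> (\<forall>x\<in>X. conj_map X X' b ` U x = U' (b x))"


section \<open>The construction of a Moufang set from a group and a permutation\<close>

text \<open>
  The group \<open>(U, +)\<close> is a \<open>HOL-Algebra\<close> group \<open>G\<close>, hence written multiplicatively.
  The point \<open>\<infinity>\<close> is \<open>None\<close>.
\<close>

definition points :: "('a, 'm) monoid_scheme \<Rightarrow> 'a option set" where
  "points G = insert None (Some ` carrier G)"

definition nonzero :: "('a, 'm) monoid_scheme \<Rightarrow> 'a set" where
  "nonzero G = carrier G - {\<one>\<^bsub>G\<^esub>}"

definition swaps_zero_infinity :: "('a, 'm) monoid_scheme \<Rightarrow> ('a option \<Rightarrow> 'a option) \<Rightarrow> bool" where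
  "swaps_zero_infinity G \<tau> \<longleftrightarrow>
     \<tau> \<in> carrier (BijGroup (points G)) \<and> \<tau> (Some \<one>\<^bsub>G\<^esub>) = None \<and> \<tau> None = Some \<one>\<^bsub>G\<^esub>"

definition alpha :: "('a, 'm) monoid_scheme \<Rightarrow> 'a \<Rightarrow> 'a option \<Rightarrow> 'a option" where
  "alpha G a = (\<lambda>x\<in>points G. map_option (\<lambda>u. u \<otimes>\<^bsub>G\<^esub> a) x)"

definition root_infinity :: "('a, 'm) monoid_scheme \<Rightarrow> ('a option \<Rightarrow> 'a option) set" where
  "root_infinity G = alpha G ` carrier G"

definition root_zero ::
  "('a, 'm) monoid_scheme \<Rightarrow> ('a option \<Rightarrow> 'a option) \<Rightarrow> ('a option \<Rightarrow> 'a option) set" where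
  "root_zero G \<tau> = conj_map (points G) (points G) \<tau> ` root_infinity G"

definition root_group ::
  "('a, 'm) monoid_scheme \<Rightarrow> ('a option \<Rightarrow> 'a option) \<Rightarrow> 'a option \<Rightarrow> ('a option \<Rightarrow> 'a option) set" where
  "root_group G \<tau> x =
     (case x of
        None \<Rightarrow> root_infinity G
      | Some a \<Rightarrow> conj_map (points G) (points G) (alpha G a) ` root_zero G \<tau>)"

text \<open>
  \<open>val f a\<close> is the value \<open>a f\<close> read as an element of the group; it is only used where that
  value differs from \<open>\<infinity>\<close>.
\<close>

definition val :: "('a option \<Rightarrow> 'a option) \<Rightarrow> 'a \<Rightarrow> 'a" where
  "val f a = the (f (Some a))"

definition mu ::
  "('a, 'm) monoid_scheme \<Rightarrow> ('a option \<Rightarrow> 'a option) \<Rightarrow> 'a \<Rightarrow> 'a option \<Rightarrow> 'a option" where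
  "mu G \<tau> a =
     (let X = points G; b = inv\<^bsub>G\<^esub> (val (inv_into X \<tau>) a)
      in rcomp X (rcomp X (alpha G a) (conj_map X X \<tau> (alpha G b))) (alpha G (inv\<^bsub>G\<^esub> (val \<tau> b))))"

text \<open>The Hua map \<open>h\<^sub>a = \<tau> \<mu>\<^sub>a\<close>, restricted to the group, with the convention that \<open>h\<^sub>0\<close> is zero.\<close>

definition hua ::
  "('a, 'm) monoid_scheme \<Rightarrow> ('a option \<Rightarrow> 'a option) \<Rightarrow> 'a \<Rightarrow> 'a \<Rightarrow> 'a" where
  "hua G \<tau> a =
     (\<lambda>u\<in>carrier G. if a = \<one>\<^bsub>G\<^esub> then \<one>\<^bsub>G\<^esub> else val (rcomp (points G) \<tau> (mu G \<tau> a)) u)"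

definition hua_subgroup ::
  "('a, 'm) monoid_scheme \<Rightarrow> ('a option \<Rightarrow> 'a option) \<Rightarrow> ('a option \<Rightarrow> 'a option) set" where
  "hua_subgroup G \<tau> =
     generate (BijGroup (points G))
       {rcomp (points G) (mu G \<tau> a) (mu G \<tau> b) | a b. a \<in> nonzero G \<and> b \<in> nonzero G}"

definition special :: "('a, 'm) monoid_scheme \<Rightarrow> ('a option \<Rightarrow> 'a option) \<Rightarrow> bool" where
  "special G \<tau> \<longleftrightarrow> (\<forall>a\<in>nonzero G. val \<tau> (inv\<^bsub>G\<^esub> a) = inv\<^bsub>G\<^esub> (val \<tau> a))"

definition torsion_free :: "('a, 'm) monoid_scheme \<Rightarrow> bool" where
  "torsion_free G \<longleftrightarrow> (\<forall>a\<in>nonzero G. \<forall>n::nat. n > 0 \<longrightarrow> a [^]\<^bsub>G\<^esub> n \<noteq> \<one>\<^bsub>G\<^esub>)"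


section \<open>The centroid\<close>

definition end_hua ::
  "('a, 'm) monoid_scheme \<Rightarrow> ('a option \<Rightarrow> 'a option) \<Rightarrow> ('a \<Rightarrow> 'a) ring" where
  "end_hua G \<tau> =
     \<lparr>carrier = {T \<in> hom G G \<inter> extensional (carrier G).
                   \<forall>h\<in>hua_subgroup G \<tau>. \<forall>u\<in>carrier G. T (val h u) = val h (T u)},
      mult = rcomp (carrier G),
      one = (\<lambda>u\<in>carrier G. u),
      zero = (\<lambda>u\<in>carrier G. \<one>\<^bsub>G\<^esub>),
      add = (\<lambda>S T. \<lambda>u\<in>carrier G. S u \<otimes>\<^bsub>G\<^esub> T u)\<rparr>"

definition centroid ::
  "('a, 'm) monoid_scheme \<Rightarrow> ('a option \<Rightarrow> 'a option) \<Rightarrow> ('a \<Rightarrow> 'a) set" where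
  "centroid G \<tau> =
     {T \<in> carrier (end_hua G \<tau>).
        \<forall>a\<in>carrier G. hua G \<tau> (T a) = rcomp (carrier G) (rcomp (carrier G) T T) (hua G \<tau> a)}"

text \<open>
  An abelian group as a module over a ring of endomorphisms acting by evaluation. The
  multiplicative fields of the record play no role for modules.
\<close>

definition eval_module :: "('a, 'm) monoid_scheme \<Rightarrow> ('a \<Rightarrow> 'a, 'a) module" where
  "eval_module G =
     \<lparr>carrier = carrier G, mult = undefined, one = undefined,
      zero = \<one>\<^bsub>G\<^esub>, add = mult G, smult = (\<lambda>T u. T u)\<rparr>"


section \<open>Quadratic Jordan division algebras\<close>

definition jordan_polar ::
  "('k, 'j) module \<Rightarrow> ('j \<Rightarrow> 'j \<Rightarrow> 'j) \<Rightarrow> 'j \<Rightarrow> 'j \<Rightarrow> 'j \<Rightarrow> 'j" where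
  "jordan_polar J Q a b c = Q (a \<oplus>\<^bsub>J\<^esub> b) c \<ominus>\<^bsub>J\<^esub> Q a c \<ominus>\<^bsub>J\<^esub> Q b c"

definition jordan_V ::
  "('k, 'j) module \<Rightarrow> ('j \<Rightarrow> 'j \<Rightarrow> 'j) \<Rightarrow> 'j \<Rightarrow> 'j \<Rightarrow> 'j \<Rightarrow> 'j" where
  "jordan_V J Q a b c = jordan_polar J Q a c b"

text \<open>
  Equalities between endomorphisms of \<open>J\<close> are stated pointwise on the carrier. In particular
  bilinearity of \<open>(a, b) \<mapsto> Q\<^sub>a\<^sub>,\<^sub>b\<close> is linearity of \<open>Q\<^sub>a\<^sub>,\<^sub>b\<close> in \<open>a\<close> and in \<open>b\<close> after evaluation at
  every \<open>c\<close>.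
\<close>

locale quadratic_jordan_division_algebra = vectorspace K J
  for K :: "'k ring" and J :: "('k, 'j) module" +
  fixes Q :: "'j \<Rightarrow> 'j \<Rightarrow> 'j" and e :: 'j
  assumes e_closed: "e \<in> carrier J"
    and e_nonzero: "e \<noteq> \<zero>\<^bsub>J\<^esub>"
    and Q_end: "a \<in> carrier J \<Longrightarrow> Q a \<in> module_hom K J J"
    and Q_smult:
      "\<lbrakk>r \<in> carrier K; a \<in> carrier J; c \<in> carrier J\<rbrakk>
       \<Longrightarrow> Q (r \<odot>\<^bsub>J\<^esub> a) c = (r [^]\<^bsub>K\<^esub> (2::nat)) \<odot>\<^bsub>J\<^esub> Q a c"
    and Q_polar_linear_left:
      "\<lbrakk>b \<in> carrier J; c \<in> carrier J\<rbrakk> \<Longrightarrow> (\<lambda>a. jordan_polar J Q a b c) \<in> module_hom K J J"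
    and Q_polar_linear_right:
      "\<lbrakk>a \<in> carrier J; c \<in> carrier J\<rbrakk> \<Longrightarrow> (\<lambda>b. jordan_polar J Q a b c) \<in> module_hom K J J"
    and Q_invertible:
      "\<lbrakk>a \<in> carrier J; a \<noteq> \<zero>\<^bsub>J\<^esub>\<rbrakk> \<Longrightarrow> bij_betw (Q a) (carrier J) (carrier J)"
    and Q_e: "c \<in> carrier J \<Longrightarrow> Q e c = c"
    and Q_V:
      "\<lbrakk>a \<in> carrier J; b \<in> carrier J; c \<in> carrier J\<rbrakk>
       \<Longrightarrow> jordan_V J Q a b (Q a c) = Q a (jordan_V J Q b a c)"
    and Q_Q:
      "\<lbrakk>a \<in> carrier J; b \<in> carrier J; c \<in> carrier J\<rbrakk>
       \<Longrightarrow> Q (Q b a) c = Q b (Q a (Q b c))"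

definition jordan_inverse :: "('k, 'j) module \<Rightarrow> ('j \<Rightarrow> 'j \<Rightarrow> 'j) \<Rightarrow> 'j \<Rightarrow> 'j" where
  "jordan_inverse J Q a = inv_into (carrier J) (Q a) a"

definition jordan_tau ::
  "('k, 'j) module \<Rightarrow> ('j \<Rightarrow> 'j \<Rightarrow> 'j) \<Rightarrow> 'j option \<Rightarrow> 'j option" where
  "jordan_tau J Q =
     (\<lambda>x\<in>points (add_monoid J).
        case x of
          None \<Rightarrow> Some \<zero>\<^bsub>J\<^esub>
        | Some a \<Rightarrow> if a = \<zero>\<^bsub>J\<^esub> then None else Some (\<ominus>\<^bsub>J\<^esub> jordan_inverse J Q a))"

end

theory Submission
  imports Defs
begin

text \<open>
  Write \<open>a\<^sup>-\<^sup>1 = - a\<tau>\<close>. Since \<open>- 1\<close> lies in the centroid, \<open>h\<^sub>-\<^sub>a = h\<^sub>a\<close>, so the \<open>\<mu>\<close>-maps are involutions,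
  and the Hua maps satisfy \<open>(a + y)\<^sup>-\<^sup>1 = a\<^sup>-\<^sup>1 - (a + y\<^sup>-\<^sup>1 h\<^sub>a)\<^sup>-\<^sup>1\<close> and
  \<open>h\<^sub>a\<^sub>+\<^sub>b = h\<^sub>a h\<^sub>s h\<^sub>b\<close> with \<open>s = a\<^sup>-\<^sup>1 + b\<^sup>-\<^sup>1\<close>. It remains to see that \<open>h\<close> is quadratic with \<open>k\<close>-bilinear
  polarization. The first identity gives
  \<open>a\<^sup>-\<^sup>1 h\<^sub>z = 2z - a + a\<^sup>-\<^sup>1 h\<^sub>z\<^sub>-\<^sub>a\<close>. Replace \<open>a\<close> and \<open>z\<close> by \<open>a + tc\<close> and \<open>z + tc\<close> and
  differentiate at \<open>t = 0\<close>: as the derivative of \<open>h\<^sub>z\<^sub>+\<^sub>t\<^sub>c\<close> is additive and commutes with \<open>k\<close>, the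
  remaining terms depend \<open>k\<close>-linearly on \<open>a\<^sup>-\<^sup>1\<close>, and by the second identity this is linearity of the polarization.
  Finite dimension makes the derivative meaningful: iterating the first identity expands \<open>(a + tc)\<^sup>-\<^sup>1\<close>
  formally in powers of \<open>t\<close>, and a linear dependency of the coefficients makes it a rational function
  of \<open>t\<close> that is regular at \<open>0\<close>. Then \<open>h\<^sub>z\<^sub>+\<^sub>t\<^sub>c\<close> maps curves which span at \<open>t = 0\<close> to regular curves, and
  hence is continuous at \<open>0\<close>. The parameter \<open>t\<close> only runs through the natural numbers.
\<close>

section \<open>Polynomial functions with values in an abelian group\<close>

text \<open>The obstacle is a circle: how \<open>U (z + t c)\<close> depends on \<open>t\<close>
  would be clear if \<open>U\<close> were quadratic, but that is the claim. So nothing is assumed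
  about this dependence. What can be expanded is the inverse, and with it the value of
  \<open>U\<close> at inverses: the shift formula leaves on its right side only
  \<open>U (z - a)\<close>, which does not change when \<open>z\<close> and \<open>a\<close> move by
  the same vector. Inverses of suitable points span, so these known values determine how
  \<open>U (z + t c)\<close> behaves at 0. No limit is taken. A polynomial function on the natural
  numbers with values in a torsion-free group is determined by its values at large arguments; hence
  identities that hold for large \<open>t\<close>, where all inverses exist and a factor
  \<open>t\<close> can be cancelled, may be read at \<open>t = 0\<close>. Denominators are harmless
  because they are scalars and so commute with every \<open>U a\<close>. A derivative appears as the
  first remainder of an expansion, multiplied by its denominator and read at 0.\<close>

primrec nmul :: "nat \<Rightarrow> 'b::ab_group_add \<Rightarrow> 'b" (infixr "\<cdot>" 75) where
  "0 \<cdot> x = 0"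
| "Suc n \<cdot> x = x + n \<cdot> x"

lemma nmul_1 [simp]: "Suc 0 \<cdot> x = x"
  by simp

lemma nmul_zero [simp]: "n \<cdot> 0 = 0"
  by (induction n) auto

lemma nmul_add_left: "(m + n) \<cdot> x = m \<cdot> x + n \<cdot> x"
  by (induction m) (auto simp: algebra_simps)

lemma nmul_add: "n \<cdot> (x + y) = n \<cdot> x + n \<cdot> y"
  by (induction n) (auto simp: algebra_simps)

lemma nmul_minus: "n \<cdot> (- x) = - (n \<cdot> x)"
  by (induction n) (auto simp: algebra_simps)

lemma nmul_diff: "n \<cdot> (x - y) = n \<cdot> x - n \<cdot> y"
  using nmul_add[of n x "- y"] by (simp add: nmul_minus)

lemma nmul_mult: "(m * n) \<cdot> x = m \<cdot> n \<cdot> x"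
  by (induction m) (auto simp: nmul_add_left)

lemma nmul_commute: "m \<cdot> n \<cdot> x = n \<cdot> m \<cdot> x"
  by (metis mult.commute nmul_mult)

lemma nmul_diff_left: "n \<le> m \<Longrightarrow> (m - n) \<cdot> x = m \<cdot> x - n \<cdot> x"
  using nmul_add_left[of "m - n" n x] by simp

lemma nmul_sum: "n \<cdot> (\<Sum>i\<in>I. f i) = (\<Sum>i\<in>I. n \<cdot> f i)"
  by (induction I rule: infinite_finite_induct) (auto simp: nmul_add)

lemma sum_lessThan_add: "(\<Sum>j<m + n. f j) = (\<Sum>j<m. f j) + (\<Sum>j<n. f (m + j))"
  for f :: "nat \<Rightarrow> 'b::comm_monoid_add" and m n :: nat
  by (induction n) (auto simp: add.assoc)

text \<open>A subset of a type, because it will be the image of a carrier set under an embedding;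
  the ambient group may have torsion.\<close>

locale torsion_free_subgroup =
  fixes V :: "'b::ab_group_add set"
  assumes V_zero [simp]: "0 \<in> V"
    and V_add [simp]: "\<lbrakk>x \<in> V; y \<in> V\<rbrakk> \<Longrightarrow> x + y \<in> V"
    and V_uminus [simp]: "x \<in> V \<Longrightarrow> - x \<in> V"
    and V_torsion_free: "\<lbrakk>x \<in> V; n \<cdot> x = 0; n > 0\<rbrakk> \<Longrightarrow> x = 0"
begin

lemma V_diff [simp]: "\<lbrakk>x \<in> V; y \<in> V\<rbrakk> \<Longrightarrow> x - y \<in> V"
  using V_add[of x "- y"] by simp

lemma V_nmul [simp]: "x \<in> V \<Longrightarrow> n \<cdot> x \<in> V"
  by (induction n) auto

lemma V_sum [simp]: "(\<And>i. i \<in> I \<Longrightarrow> f i \<in> V) \<Longrightarrow> (\<Sum>i\<in>I. f i) \<in> V"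
  by (induction I rule: infinite_finite_induct) auto

lemma nmul_cancel: "\<lbrakk>x \<in> V; y \<in> V; n > 0; n \<cdot> x = n \<cdot> y\<rbrakk> \<Longrightarrow> x = y"
  using V_torsion_free[of "x - y" n] by (simp add: nmul_diff)

definition endo :: "('b \<Rightarrow> 'b) \<Rightarrow> bool" where
  "endo f \<longleftrightarrow> (\<forall>x\<in>V. f x \<in> V) \<and> (\<forall>x\<in>V. \<forall>y\<in>V. f (x + y) = f x + f y)"

lemma endo_closed: "endo f \<Longrightarrow> x \<in> V \<Longrightarrow> f x \<in> V"
  and endo_add: "endo f \<Longrightarrow> x \<in> V \<Longrightarrow> y \<in> V \<Longrightarrow> f (x + y) = f x + f y"
  by (auto simp: endo_def)

lemma endo_zero: "endo f \<Longrightarrow> f 0 = 0"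
  using endo_add[of f 0 0] by simp

lemma endo_minus: "endo f \<Longrightarrow> x \<in> V \<Longrightarrow> f (- x) = - f x"
  using endo_add[of f x "- x"] endo_zero[of f] by (simp add: eq_neg_iff_add_eq_0 add.commute)

lemma endo_diff: "endo f \<Longrightarrow> x \<in> V \<Longrightarrow> y \<in> V \<Longrightarrow> f (x - y) = f x - f y"
  using endo_add[of f x "- y"] endo_minus[of f y] by simp

lemma endo_nmul: "endo f \<Longrightarrow> x \<in> V \<Longrightarrow> f (n \<cdot> x) = n \<cdot> f x"
  by (induction n) (auto simp: endo_zero endo_add)

lemma endo_sum: "endo f \<Longrightarrow> (\<And>i. i \<in> I \<Longrightarrow> g i \<in> V) \<Longrightarrow> f (\<Sum>i\<in>I. g i) = (\<Sum>i\<in>I. f (g i))"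
  by (induction I rule: infinite_finite_induct) (auto simp: endo_zero endo_add)

section \<open>Polynomial functions of a natural parameter, with a strict degree bound\<close>

definition polyf :: "nat \<Rightarrow> (nat \<Rightarrow> 'b) \<Rightarrow> bool" where
  "polyf D f \<longleftrightarrow> (\<exists>c. (\<forall>m. c m \<in> V) \<and> (\<forall>t. f t = (\<Sum>m<D. t ^ m \<cdot> c m)))"

lemma polyf_closed: "polyf D f \<Longrightarrow> f t \<in> V"
  by (auto simp: polyf_def)

lemma polyf_mono: assumes "polyf D f" "D \<le> E" shows "polyf E f"
proof -
  from assms(1) obtain c where c: "\<forall>m. c m \<in> V" "\<forall>t. f t = (\<Sum>m<D. t ^ m \<cdot> c m)"
    unfolding polyf_def by auto
  have "(\<Sum>m<E. t ^ m \<cdot> (if m < D then c m else 0)) = (\<Sum>m<D. t ^ m \<cdot> c m)" for t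
    by (rule sum.mono_neutral_cong_right) (use assms(2) in auto)
  then show ?thesis unfolding polyf_def using c
    by (intro exI[of _ "\<lambda>m. if m < D then c m else 0"]) auto
qed

lemma polyf_zero: "polyf D (\<lambda>t. 0)"
  unfolding polyf_def by (intro exI[of _ "\<lambda>m. 0"]) auto

lemma polyf_const: assumes "x \<in> V" "D > 0" shows "polyf D (\<lambda>t. x)"
proof -
  have "polyf 1 (\<lambda>t. x)"
    unfolding polyf_def using assms by (intro exI[of _ "\<lambda>m. x"]) auto
  then show ?thesis using assms polyf_mono by force
qed

lemma polyf_add: assumes "polyf D f" "polyf D g" shows "polyf D (\<lambda>t. f t + g t)"
proof -
  from assms obtain c d where "\<forall>m. c m \<in> V" "\<forall>t. f t = (\<Sum>m<D. t ^ m \<cdot> c m)"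
    "\<forall>m. d m \<in> V" "\<forall>t. g t = (\<Sum>m<D. t ^ m \<cdot> d m)"
    unfolding polyf_def by auto
  then show ?thesis unfolding polyf_def
    by (intro exI[of _ "\<lambda>m. c m + d m"]) (auto simp: nmul_add sum.distrib)
qed

lemma polyf_endo: assumes "polyf D f" "endo h" shows "polyf D (\<lambda>t. h (f t))"
proof -
  from assms obtain c where "\<forall>m. c m \<in> V" "\<forall>t. f t = (\<Sum>m<D. t ^ m \<cdot> c m)"
    unfolding polyf_def by auto
  then show ?thesis unfolding polyf_def using assms(2)
    by (intro exI[of _ "\<lambda>m. h (c m)"]) (auto simp: endo_sum endo_nmul endo_closed)
qed

lemma polyf_minus: "polyf D f \<Longrightarrow> polyf D (\<lambda>t. - f t)"
  using polyf_endo[of D f uminus] by (simp add: endo_def)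

lemma polyf_diff: "polyf D f \<Longrightarrow> polyf D g \<Longrightarrow> polyf D (\<lambda>t. f t - g t)"
  using polyf_add[of D f "\<lambda>t. - g t"] polyf_minus[of D g] by simp

lemma polyf_sum: "(\<And>i. i \<in> I \<Longrightarrow> polyf D (f i)) \<Longrightarrow> polyf D (\<lambda>t. \<Sum>i\<in>I. f i t)"
  by (induction I rule: infinite_finite_induct) (auto intro: polyf_zero polyf_add)

lemma polyf_nmul: assumes "polyf D f" shows "polyf (D + k) (\<lambda>t. t ^ k \<cdot> f t)"
proof -
  from assms obtain c where c: "\<forall>m. c m \<in> V" "\<forall>t. f t = (\<Sum>m<D. t ^ m \<cdot> c m)"
    unfolding polyf_def by auto
  have "(\<Sum>m<D + k. t ^ m \<cdot> (if m < k then 0 else c (m - k))) = t ^ k \<cdot> f t" for t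
  proof -
    have "(\<Sum>m<D + k. t ^ m \<cdot> (if m < k then 0 else c (m - k)))
        = (\<Sum>m\<in>{0+k..<D + k}. t ^ m \<cdot> c (m - k))"
      by (rule sum.mono_neutral_cong_right) auto
    also have "\<dots> = (\<Sum>m<D. t ^ (m + k) \<cdot> c m)"
      by (subst sum.shift_bounds_nat_ivl) (simp add: atLeast0LessThan)
    also have "\<dots> = t ^ k \<cdot> f t"
      by (simp add: c nmul_sum flip: nmul_mult) (simp add: power_add mult.commute)
    finally show ?thesis .
  qed
  then show ?thesis unfolding polyf_def using c
    by (intro exI[of _ "\<lambda>m. if m < k then 0 else c (m - k)"]) auto
qed

text \<open>Passing from \<open>f t\<close> to \<open>2 ^ D \<cdot> f t - f (2 * t)\<close> removes
  the coefficient of degree \<open>D\<close> and multiplies that of degree \<open>m < D\<close> by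
  the positive number \<open>2 ^ D - 2 ^ m\<close>. So the degree drops without any division, and
  torsion-freeness recovers the lower coefficients.\<close>

lemma polyf_coeff_zero:
  assumes "\<And>m. c m \<in> V" "\<And>t. t \<ge> N \<Longrightarrow> (\<Sum>m<D. t ^ m \<cdot> c m) = 0" "m < D"
  shows "c m = 0"
  using assms
proof (induction D arbitrary: c m)
  case (Suc D)
  have low: "c m = 0" if "m < D" for m
  proof -
    let ?d = "\<lambda>m. 2 ^ D \<cdot> c m - 2 ^ m \<cdot> c m"
    have *: "(\<Sum>m<D. t ^ m \<cdot> ?d m) = 0" if "t \<ge> N" for t
    proof -
      have "0 = 2 ^ D \<cdot> (\<Sum>m<Suc D. t ^ m \<cdot> c m) - (\<Sum>m<Suc D. (2 * t) ^ m \<cdot> c m)"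
        using Suc.prems(2)[of t] Suc.prems(2)[of "2 * t"] that by simp
      also have "\<dots> = (\<Sum>m<Suc D. t ^ m \<cdot> ?d m)"
        by (simp only: nmul_sum flip: sum_subtractf)
          (intro sum.cong refl, simp add: nmul_diff power_mult_distrib flip: nmul_mult, simp add: mult.commute)
      also have "\<dots> = (\<Sum>m<D. t ^ m \<cdot> ?d m)" by simp
      finally show ?thesis by simp
    qed
    have "?d m = 0"
      using Suc.IH[of ?d, OF _ * that] Suc.prems(1) by simp
    then have "(2 ^ D - 2 ^ m) \<cdot> c m = 0"
      using that by (subst nmul_diff_left) auto
    moreover have "(2::nat) ^ D - 2 ^ m > 0" using that by simp
    ultimately show ?thesis using V_torsion_free Suc.prems(1) by blast
  qed
  have "(N + 1) ^ D \<cdot> c D = 0"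
    using Suc.prems(2)[of "N + 1"] low by simp
  then have "c D = 0" using V_torsion_free[of "c D" "(N+1)^D"] Suc.prems(1) by simp
  then show ?case using low Suc.prems(3) less_Suc_eq by blast
qed simp

lemma polyf_vanish:
  assumes "polyf D f" "\<And>t. t \<ge> N \<Longrightarrow> f t = 0" shows "f 0 = 0"
proof -
  from assms obtain c where c: "\<And>m. c m \<in> V" "\<And>t. f t = (\<Sum>m<D. t ^ m \<cdot> c m)"
    unfolding polyf_def by auto
  have "c m = 0" if "m < D" for m
    by (rule polyf_coeff_zero[where c = c and N = N and D = D]) (use assms(2) c that in auto)
  then show ?thesis using c(2)[of 0] by simp
qed

text \<open>The substitute for a limit at 0: the identities to come hold only for large
  \<open>t\<close>, but are needed at \<open>t = 0\<close>.\<close>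

lemma polyf_eq_at_0:
  assumes "polyf D f" "polyf E g" "\<And>t. t \<ge> N \<Longrightarrow> f t = g t" shows "f 0 = g 0"
proof -
  have "polyf (max D E) (\<lambda>t. f t - g t)"
    by (intro polyf_diff polyf_mono[OF assms(1)] polyf_mono[OF assms(2)]) auto
  from polyf_vanish[OF this, of N] assms(3) show ?thesis by simp
qed

end

section \<open>Finite dimension over a field of endomorphisms\<close>

text \<open>The closure properties speak of functions on the whole type, whereas commutativity and
  inverses are required on \<open>V\<close> only; \<open>K\<close> may contain many functions with
  the same restriction to \<open>V\<close>. The set \<open>B\<close> spans but need not be a
  basis.\<close>

locale finite_dim_over_field = torsion_free_subgroup V for V :: "'b::ab_group_add set" +
  fixes K :: "('b \<Rightarrow> 'b) set" and B :: "'b set"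
  assumes K_endo: "T \<in> K \<Longrightarrow> endo T"
    and K_id: "(\<lambda>x. x) \<in> K"
    and K_minus: "T \<in> K \<Longrightarrow> (\<lambda>x. - T x) \<in> K"
    and K_plus: "\<lbrakk>S \<in> K; T \<in> K\<rbrakk> \<Longrightarrow> (\<lambda>x. S x + T x) \<in> K"
    and K_comp: "\<lbrakk>S \<in> K; T \<in> K\<rbrakk> \<Longrightarrow> (\<lambda>x. S (T x)) \<in> K"
    and K_commute: "\<lbrakk>S \<in> K; T \<in> K; x \<in> V\<rbrakk> \<Longrightarrow> S (T x) = T (S x)"
    and K_inverse: "T \<in> K \<Longrightarrow> (\<forall>x\<in>V. T x = 0) \<or> (\<exists>S\<in>K. \<forall>x\<in>V. S (T x) = x)"
    and B_finite: "finite B" and B_subset: "B \<subseteq> V"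
    and B_span: "x \<in> V \<Longrightarrow> \<exists>l. (\<forall>b\<in>B. l b \<in> K) \<and> x = (\<Sum>b\<in>B. l b b)"
begin

lemma K_closed: "T \<in> K \<Longrightarrow> x \<in> V \<Longrightarrow> T x \<in> V"
  using K_endo endo_closed by blast

lemma K_add: "T \<in> K \<Longrightarrow> x \<in> V \<Longrightarrow> y \<in> V \<Longrightarrow> T (x + y) = T x + T y"
  using K_endo endo_add by blast

lemma K_zero: "(\<lambda>x. 0) \<in> K"
  using K_plus[OF K_id K_minus[OF K_id]] by simp

lemma K_sum: "(\<And>i. i \<in> I \<Longrightarrow> T i \<in> K) \<Longrightarrow> (\<lambda>x. \<Sum>i\<in>I. T i x) \<in> K"
  by (induction I rule: infinite_finite_induct) (auto intro: K_zero K_plus)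

text \<open>Gaussian elimination for a matrix with finitely many rows \<open>e\<close> and
  infinitely many columns: some column is a combination of earlier ones. For a new row that is not
  zero, a pivot column \<open>k\<close> clears this row in all later columns, to which the induction
  hypothesis applies.\<close>

lemma scalar_dependency:
  assumes "finite E" "\<And>e i. e \<in> E \<Longrightarrow> M e i \<in> K"
  shows "\<exists>(n::nat) T. (\<forall>j<n. T j \<in> K) \<and> (\<forall>e\<in>E. \<forall>x\<in>V. M e n x = (\<Sum>j<n. T j (M e j x)))"
  using assms
proof (induction E arbitrary: M rule: finite_induct)
  case empty
  show ?case by (intro exI[of _ 0]) simp
next
  case (insert e E)
  show ?case
  proof (cases "\<forall>i. \<forall>x\<in>V. M e i x = 0")
    case True
    obtain n T where T: "\<forall>j<n. T j \<in> K" "\<forall>e\<in>E. \<forall>x\<in>V. M e n x = (\<Sum>j<n. T j (M e j x))"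
      using insert.IH[of M] insert.prems by auto
    have "\<forall>x\<in>V. M e n x = (\<Sum>j<n. T j (M e j x))"
      using True T(1) by (simp add: endo_zero K_endo)
    then show ?thesis using T by blast
  next
    case False
    then obtain k where k: "\<not> (\<forall>x\<in>V. M e k x = 0)" by blast
    then obtain S where S: "S \<in> K" "\<forall>x\<in>V. S (M e k x) = x"
      using K_inverse[of "M e k"] insert.prems by blast
    have MK: "M e' i \<in> K" if "e' \<in> insert e E" for e' i using insert.prems that by blast
    \<comment> \<open>Column \<open>Suc k + i\<close> minus the multiple of the pivot column that
      makes its entry in row \<open>e\<close> vanish.\<close>
    define M' where "M' e' i = (\<lambda>x. M e' (Suc k + i) x - M e (Suc k + i) (S (M e' k x)))" for e' i
    have "M' e' i \<in> K" if "e' \<in> E" for e' i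
      using K_plus[OF MK[of e' "Suc k + i"] K_minus[OF K_comp[OF MK[of e "Suc k + i"] K_comp[OF S(1) MK[of e' k]]]]]
      unfolding M'_def using that by simp
    then obtain n T where T: "\<forall>j<n. T j \<in> K"
      "\<forall>e'\<in>E. \<forall>x\<in>V. M' e' n x = (\<Sum>j<n. T j (M' e' j x))"
      using insert.IH[of M'] by auto
    \<comment> \<open>\<open>R\<close> gathers the multiples of the pivot column that were
      subtracted; columns before the pivot get coefficient 0.\<close>
    define R where "R = (\<lambda>x. M e (Suc k + n) (S x) - (\<Sum>j<n. T j (M e (Suc k + j) (S x))))"
    have RK: "R \<in> K"
    proof -
      have *: "(\<lambda>x. M e i (S x)) \<in> K" for i using K_comp[OF MK[of e i] S(1)] by simp
      have "(\<lambda>x. \<Sum>j<n. T j (M e (Suc k + j) (S x))) \<in> K"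
        by (rule K_sum, rule K_comp[OF _ *]) (use T(1) in auto)
      then show ?thesis unfolding R_def diff_conv_add_uminus by (rule K_plus[OF * K_minus])
    qed
    define T' where "T' j = (if j < k then (\<lambda>x. 0) else if j = k then R else T (j - Suc k))" for j
    have TK: "\<forall>j<Suc k + n. T' j \<in> K" unfolding T'_def using RK T(1) K_zero by auto
    have sum: "(\<Sum>j<Suc k + n. T' j (y j)) = R (y k) + (\<Sum>j<n. T j (y (Suc k + j)))" for y
    proof -
      have "(\<Sum>j<Suc k + n. T' j (y j)) = (\<Sum>j<Suc k. T' j (y j)) + (\<Sum>j<n. T' (Suc k + j) (y (Suc k + j)))"
        by (rule sum_lessThan_add)
      moreover have "(\<Sum>j<Suc k. T' j (y j)) = R (y k)" unfolding T'_def by simp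
      moreover have "T' (Suc k + j) = T j" for j unfolding T'_def by simp
      ultimately show ?thesis by simp
    qed
    have main: "M e' (Suc k + n) x = (\<Sum>j<Suc k + n. T' j (M e' j x))" if e': "e' \<in> insert e E" and x: "x \<in> V" for e' x
    proof -
      have eq: "M' e' n x = (\<Sum>j<n. T j (M' e' j x))"
      proof (cases "e' = e")
        case True
        have "M' e i x = 0" for i
          unfolding M'_def using S x by simp
        then show ?thesis using True T(1) by (simp add: endo_zero K_endo)
      next
        case False
        then show ?thesis using T(2) e' x by auto
      qed
      have "(\<Sum>j<n. T j (M' e' j x)) =
          (\<Sum>j<n. T j (M e' (Suc k + j) x)) - (\<Sum>j<n. T j (M e (Suc k + j) (S (M e' k x))))"
        unfolding M'_def sum_subtractf[symmetric]
      proof (intro sum.cong refl)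
        fix j assume "j \<in> {..<n}"
        then have "endo (T j)" using T(1) K_endo by blast
        moreover have "M e' (Suc k + j) x \<in> V" by (rule K_closed[OF MK[OF e'] x])
        moreover have "M e (Suc k + j) (S (M e' k x)) \<in> V"
          by (intro K_closed[OF MK[OF insertI1]] K_closed[OF S(1)] K_closed[OF MK[OF e']] x)
        ultimately show "T j (M e' (Suc k + j) x - M e (Suc k + j) (S (M e' k x))) =
            T j (M e' (Suc k + j) x) - T j (M e (Suc k + j) (S (M e' k x)))"
          by (rule endo_diff)
      qed
      with eq have "M e' (Suc k + n) x = M e (Suc k + n) (S (M e' k x)) +
         ((\<Sum>j<n. T j (M e' (Suc k + j) x)) - (\<Sum>j<n. T j (M e (Suc k + j) (S (M e' k x)))))"
        unfolding M'_def by (simp add: algebra_simps)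
      also have "\<dots> = R (M e' k x) + (\<Sum>j<n. T j (M e' (Suc k + j) x))"
        unfolding R_def by simp
      finally show ?thesis using sum[of "\<lambda>j. M e' j x"] by simp
    qed
    then show ?thesis using TK by blast
  qed
qed

text \<open>Several sequences of vectors obey one relation with common coefficients: the rows of the
  matrix are the pairs of a sequence and a coordinate with respect to \<open>B\<close>.\<close>

lemma dependency:
  assumes "finite A" "\<And>a i. a \<in> A \<Longrightarrow> x i a \<in> V"
  obtains n :: nat and T where "\<And>j. j < n \<Longrightarrow> T j \<in> K" "\<And>a. a \<in> A \<Longrightarrow> x n a = (\<Sum>j<n. T j (x j a))"
proof -
  have "\<forall>i. \<forall>a\<in>A. \<exists>l. (\<forall>b\<in>B. l b \<in> K) \<and> x i a = (\<Sum>b\<in>B. l b b)"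
    using assms(2) B_span by blast
  then obtain l where l: "\<And>i a b. a \<in> A \<Longrightarrow> b \<in> B \<Longrightarrow> l i a b \<in> K"
      "\<And>i a. a \<in> A \<Longrightarrow> x i a = (\<Sum>b\<in>B. l i a b b)"
    by metis
  obtain n T where T: "\<And>j. j < n \<Longrightarrow> T j \<in> K"
     "\<And>e x. e \<in> A \<times> B \<Longrightarrow> x \<in> V \<Longrightarrow> l n (fst e) (snd e) x = (\<Sum>j<n. T j (l j (fst e) (snd e) x))"
  proof -
    have "\<exists>(n::nat) T. (\<forall>j<n. T j \<in> K) \<and> (\<forall>e\<in>A \<times> B. \<forall>x\<in>V. l n (fst e) (snd e) x =
        (\<Sum>j<n. T j (l j (fst e) (snd e) x)))"
      by (rule scalar_dependency[of "A \<times> B" "\<lambda>e i. l i (fst e) (snd e)"]) (use assms(1) B_finite l(1) in auto)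
    then show thesis using that by blast
  qed
  have "x n a = (\<Sum>j<n. T j (x j a))" if "a \<in> A" for a
  proof -
    have "x n a = (\<Sum>b\<in>B. \<Sum>j<n. T j (l j a b b))"
      unfolding l(2)[OF that] using T(2)[of "(a, _)"] that B_subset by (intro sum.cong refl) auto
    also have "\<dots> = (\<Sum>j<n. \<Sum>b\<in>B. T j (l j a b b))" by (rule sum.swap)
    also have "\<dots> = (\<Sum>j<n. T j (x j a))"
    proof (intro sum.cong refl)
      fix j assume "j \<in> {..<n}"
      then have "endo (T j)" using T(1) K_endo by blast
      moreover have "l j a b b \<in> V" if "b \<in> B" for b
        by (rule K_closed[OF l(1)]) (use that \<open>a \<in> A\<close> B_subset in auto)
      ultimately show "(\<Sum>b\<in>B. T j (l j a b b)) = T j (x j a)"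
        unfolding l(2)[OF \<open>a \<in> A\<close>] by (rule endo_sum[symmetric])
    qed
    finally show ?thesis .
  qed
  then show thesis using that T(1) by blast
qed

text \<open>Inverses of the spanning vectors will be taken, so 0 has to be discarded.\<close>

lemma B_nonzero_span:
  assumes "x \<in> V"
  shows "\<exists>l. (\<forall>b\<in>B - {0}. l b \<in> K) \<and> x = (\<Sum>b\<in>B - {0}. l b b)"
proof -
  obtain l where l: "\<forall>b\<in>B. l b \<in> K" "x = (\<Sum>b\<in>B. l b b)" using B_span assms by blast
  have "(\<Sum>b\<in>B. l b b) = (\<Sum>b\<in>B - {0}. l b b)"
    using B_finite l(1) endo_zero K_endo by (intro sum.mono_neutral_right) auto
  then show ?thesis using l by auto
qed

text \<open>
  If \<open>r 0\<close> and \<open>F 0 (p 0)\<close> differ, then subtracting a combination of the curves \<open>P b\<close> and dividing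
  by \<open>t\<close> yields curves of bounded degree whose images have poles at \<open>0\<close> of strictly increasing
  orders, and such curves cannot be linearly dependent.
\<close>

lemma continuity_at_0:
  assumes F: "\<And>t. endo (F t)" "\<And>t T x. T \<in> K \<Longrightarrow> x \<in> V \<Longrightarrow> F t (T x) = T (F t x)"
    and C: "finite C" "\<And>x. x \<in> V \<Longrightarrow> \<exists>l. (\<forall>b\<in>C. l b \<in> K) \<and> x = (\<Sum>b\<in>C. l b b)"
    and P: "\<And>b. b \<in> C \<Longrightarrow> polyf D (P b)" "\<And>b. b \<in> C \<Longrightarrow> polyf D' (R b)"
      "\<And>b. b \<in> C \<Longrightarrow> P b 0 = b" "\<And>b. b \<in> C \<Longrightarrow> R b 0 = F 0 b"
      "\<And>b t. b \<in> C \<Longrightarrow> t \<ge> N \<Longrightarrow> F t (P b t) = R b t"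
    and p: "polyf D'' p" "polyf E r" "\<And>t. t \<ge> N \<Longrightarrow> F t (p t) = r t"
  shows "r 0 = F 0 (p 0)"
proof -
  define M where "M = Suc (max D D'')"
  have "\<forall>b\<in>C. \<exists>c. (\<forall>m. c m \<in> V) \<and> (\<forall>t. P b t = (\<Sum>m<M. t ^ m \<cdot> c m))"
    using polyf_mono[OF P(1), of _ M] unfolding M_def polyf_def by auto
  from bchoice[OF this] obtain Pc where Pc: "\<And>b m. b \<in> C \<Longrightarrow> Pc b m \<in> V"
     "\<And>b t. b \<in> C \<Longrightarrow> P b t = (\<Sum>m<M. t ^ m \<cdot> Pc b m)"
    by blast
  obtain pc where pc: "\<And>m. pc m \<in> V" "\<And>t. p t = (\<Sum>m<M. t ^ m \<cdot> pc m)"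
  proof -
    have "polyf M p" using polyf_mono[OF p(1), of M] by (simp add: M_def)
    then show thesis using that unfolding polyf_def by auto
  qed
  have at_0: "(\<Sum>m<M. 0 ^ m \<cdot> c m) = c 0" for c :: "nat \<Rightarrow> 'b"
    unfolding M_def by (simp only: sum.lessThan_Suc_shift) simp
  have "\<forall>x\<in>V. \<exists>l. (\<forall>b\<in>C. l b \<in> K) \<and> x = (\<Sum>b\<in>C. l b b)" using C(2) by blast
  from bchoice[OF this] obtain l where l: "\<And>x b. x \<in> V \<Longrightarrow> b \<in> C \<Longrightarrow> l x b \<in> K"
     "\<And>x. x \<in> V \<Longrightarrow> x = (\<Sum>b\<in>C. l x b b)"
    by blast
  \<comment> \<open>The coefficients of a curve after subtracting the combination of the
    \<open>P b\<close> with the same value at 0 and dividing by \<open>t\<close>. As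
    \<open>P b 0 = b\<close>, the constant coefficient cancels and the division is an index
    shift.\<close>
  define step where "step q m = (if Suc m < M then q (Suc m) - (\<Sum>b\<in>C. l (q 0) b (Pc b (Suc m))) else 0)"
    for q :: "nat \<Rightarrow> 'b" and m
  define q where "q i = (step ^^ i) pc" for i
  define ev where "ev x t = (\<Sum>m<M. t ^ m \<cdot> x m)" for x :: "nat \<Rightarrow> 'b" and t
  \<comment> \<open>\<open>rr i\<close> is the polynomial that agrees with the image under
    \<open>F t\<close> of \<open>t ^ i\<close> times the \<open>i\<close>-th curve for large
    \<open>t\<close>.\<close>
  define rr where "rr = rec_nat r (\<lambda>i f t. f t - t ^ i \<cdot> (\<Sum>b\<in>C. l (q i 0) b (R b t)))"
  have q_Suc: "q (Suc i) = step (q i)" for i unfolding q_def by simp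
  have rr_Suc: "rr (Suc i) t = rr i t - t ^ i \<cdot> (\<Sum>b\<in>C. l (q i 0) b (R b t))" for i t
    unfolding rr_def by simp
  have qV: "q i m \<in> V" for i m
  proof (induction i arbitrary: m)
    case (Suc i)
    have "l (q i 0) b (Pc b (Suc m)) \<in> V" if "b \<in> C" for b
      by (rule K_closed[OF l(1)[OF Suc that] Pc(1)[OF that]])
    then show ?case unfolding q_Suc step_def using Suc by auto
  qed (simp add: q_def pc)
  have evV: "ev (q i) t \<in> V" for i t unfolding ev_def using qV by simp
  have RV: "R b t \<in> V" if "b \<in> C" for b t using P(2) polyf_closed that by blast
  have ev_step: "ev (q i) t = (\<Sum>b\<in>C. l (q i 0) b (P b t)) + t \<cdot> ev (q (Suc i)) t" for i t
  proof -
    let ?L = "l (q i 0)"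
    have LK: "?L b \<in> K" if "b \<in> C" for b using l(1) qV that by blast
    let ?d = "\<lambda>m. q i m - (\<Sum>b\<in>C. ?L b (Pc b m))"
    have "Pc b 0 = b" if "b \<in> C" for b
      using P(3)[OF that] Pc(2)[OF that, of 0] at_0[of "Pc b"] by simp
    then have d0: "?d 0 = 0" using l(2)[OF qV, of i 0] by simp
    have "(\<Sum>b\<in>C. ?L b (P b t)) = (\<Sum>b\<in>C. \<Sum>m<M. t ^ m \<cdot> ?L b (Pc b m))"
      using Pc LK by (intro sum.cong refl) (simp add: endo_sum endo_nmul K_endo)
    also have "\<dots> = (\<Sum>m<M. t ^ m \<cdot> (\<Sum>b\<in>C. ?L b (Pc b m)))"
      by (subst sum.swap) (simp add: nmul_sum)
    finally have "ev (q i) t - (\<Sum>b\<in>C. ?L b (P b t)) = (\<Sum>m<M. t ^ m \<cdot> ?d m)"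
      unfolding ev_def by (simp add: nmul_diff sum_subtractf)
    also have "\<dots> = (\<Sum>m<max D D''. t ^ Suc m \<cdot> ?d (Suc m))"
      unfolding M_def by (subst sum.lessThan_Suc_shift) (simp only: d0 nmul_zero add_0)
    also have "\<dots> = (\<Sum>m<max D D''. t \<cdot> t ^ m \<cdot> q (Suc i) m)"
      unfolding q_Suc step_def M_def by (intro sum.cong refl) (auto simp: nmul_mult)
    also have "\<dots> = t \<cdot> ev (q (Suc i)) t"
      unfolding ev_def M_def by (simp add: nmul_sum q_Suc step_def M_def)
    finally show ?thesis by (simp add: algebra_simps)
  qed
  have Frr: "F t (t ^ i \<cdot> ev (q i) t) = rr i t" if t: "t \<ge> N" for i t
  proof (induction i)
    case 0
    have "ev (q 0) t = p t" unfolding ev_def q_def pc(2) by simp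
    then show ?case unfolding rr_def using p(3) t by simp
  next
    case (Suc i)
    let ?L = "l (q i 0)"
    have LK: "?L b \<in> K" if "b \<in> C" for b using l(1) qV that by blast
    have PV: "P b t \<in> V" if "b \<in> C" for b using P(1) polyf_closed that by blast
    have sV: "(\<Sum>b\<in>C. ?L b (P b t)) \<in> V" using LK PV K_closed by simp
    have "t ^ Suc i \<cdot> ev (q (Suc i)) t = t ^ i \<cdot> ev (q i) t - t ^ i \<cdot> (\<Sum>b\<in>C. ?L b (P b t))"
      unfolding ev_step[of i t] nmul_add by (simp add: nmul_mult nmul_commute)
    then have "F t (t ^ Suc i \<cdot> ev (q (Suc i)) t) = rr i t - t ^ i \<cdot> F t (\<Sum>b\<in>C. ?L b (P b t))"
      using Suc F(1) sV evV by (simp add: endo_diff endo_nmul)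
    also have "F t (\<Sum>b\<in>C. ?L b (P b t)) = (\<Sum>b\<in>C. ?L b (R b t))"
      using F LK PV P(5) t by (simp add: endo_sum K_closed)
    finally show ?case by (simp add: rr_Suc)
  qed
  have rrp: "\<exists>d. polyf d (rr i)" for i
  proof (induction i)
    case (Suc i)
    then obtain d where d: "polyf d (rr i)" by blast
    have LR: "polyf D' (\<lambda>t. \<Sum>b\<in>C. l (q i 0) b (R b t))"
      by (rule polyf_sum, rule polyf_endo[OF P(2) K_endo[OF l(1)[OF qV]]])
    have "polyf (max d (D' + i)) (\<lambda>t. rr i t - t ^ i \<cdot> (\<Sum>b\<in>C. l (q i 0) b (R b t)))"
      by (rule polyf_diff[OF polyf_mono[OF d] polyf_mono[OF polyf_nmul[OF LR, of i]]]) auto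
    moreover have "rr (Suc i) = (\<lambda>t. rr i t - t ^ i \<cdot> (\<Sum>b\<in>C. l (q i 0) b (R b t)))"
      using rr_Suc by blast
    ultimately show ?case by metis
  next
    case 0
    have "rr 0 = r" by (simp add: rr_def)
    then show ?case using p(2) by metis
  qed
  \<comment> \<open>All corrections after the first carry a positive power of \<open>t\<close>, so
    the value at 0 no longer changes. If it is nonzero, the image of curve \<open>Suc i\<close> has
    a pole of order exactly \<open>Suc i\<close>.\<close>
  have rr_0: "rr (Suc i) 0 = r 0 - F 0 (p 0)" for i
  proof (induction i)
    case 0
    have p0: "p 0 = pc 0" using pc(2) at_0 by simp
    have "(\<Sum>b\<in>C. l (pc 0) b (R b 0)) = (\<Sum>b\<in>C. F 0 (l (pc 0) b b))"
    proof (rule sum.cong[OF refl])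
      fix b assume b: "b \<in> C"
      then have "b \<in> V" using P(1,3) polyf_closed by metis
      then show "l (pc 0) b (R b 0) = F 0 (l (pc 0) b b)"
        using b P(4) F(2) l(1)[OF pc(1)] by simp
    qed
    also have "\<dots> = F 0 (\<Sum>b\<in>C. l (pc 0) b b)"
    proof (rule endo_sum[OF F(1), symmetric])
      fix b assume b: "b \<in> C"
      then have "b \<in> V" using P(1,3) polyf_closed by metis
      then show "l (pc 0) b b \<in> V" using b l(1)[OF pc(1)] K_closed by simp
    qed
    also have "\<dots> = F 0 (p 0)" using l(2)[OF pc(1)] p0 by metis
    finally show ?case unfolding rr_Suc by (simp add: rr_def q_def)
  qed (subst rr_Suc, simp)
  obtain n T where T: "\<And>j. j < n \<Longrightarrow> T j \<in> K"
      "\<And>m. m < M \<Longrightarrow> q (Suc n) m = (\<Sum>j<n. T j (q (Suc j) m))"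
    using dependency[of "{..<M}" "\<lambda>i m. q (Suc i) m"] qV by auto
  have dep: "rr (Suc n) t = (\<Sum>j<n. T j (t ^ (n - j) \<cdot> rr (Suc j) t))" if t: "t \<ge> N" for t
  proof -
    have "ev (q (Suc n)) t = (\<Sum>m<M. \<Sum>j<n. T j (t ^ m \<cdot> q (Suc j) m))"
      unfolding ev_def using T qV by (intro sum.cong refl) (simp add: nmul_sum endo_nmul K_endo)
    also have "\<dots> = (\<Sum>j<n. T j (ev (q (Suc j)) t))"
      unfolding ev_def by (subst sum.swap) (use T(1) qV in \<open>simp add: endo_sum K_endo\<close>)
    finally have "t ^ Suc n \<cdot> ev (q (Suc n)) t = (\<Sum>j<n. t ^ Suc n \<cdot> T j (ev (q (Suc j)) t))"
      by (simp only: nmul_sum)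
    also have "\<dots> = (\<Sum>j<n. T j (t ^ (n - j) \<cdot> t ^ Suc j \<cdot> ev (q (Suc j)) t))"
    proof (intro sum.cong refl)
      fix j assume j: "j \<in> {..<n}"
      have "t ^ Suc n = t ^ (n - j) * t ^ Suc j"
        using j by (simp flip: power_add power_Suc)
      moreover have "endo (T j)" using j T(1) K_endo by blast
      ultimately show "t ^ Suc n \<cdot> T j (ev (q (Suc j)) t) = T j (t ^ (n - j) \<cdot> t ^ Suc j \<cdot> ev (q (Suc j)) t)"
        using endo_nmul[OF _ evV] by (simp only: nmul_mult[symmetric])
    qed
    finally have "rr (Suc n) t = F t (\<Sum>j<n. T j (t ^ (n - j) \<cdot> t ^ Suc j \<cdot> ev (q (Suc j)) t))"
      using Frr[OF t, of "Suc n"] by simp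
    also have "\<dots> = (\<Sum>j<n. F t (T j (t ^ (n - j) \<cdot> t ^ Suc j \<cdot> ev (q (Suc j)) t)))"
      by (rule endo_sum[OF F(1)]) (use T(1) evV K_closed in simp)
    also have "\<dots> = (\<Sum>j<n. T j (t ^ (n - j) \<cdot> rr (Suc j) t))"
    proof (intro sum.cong refl)
      fix j assume j: "j \<in> {..<n}"
      have "F t (T j (t ^ (n - j) \<cdot> t ^ Suc j \<cdot> ev (q (Suc j)) t))
        = T j (F t (t ^ (n - j) \<cdot> t ^ Suc j \<cdot> ev (q (Suc j)) t))"
        by (rule F(2)[OF T(1)]) (use j evV in auto)
      also have "F t (t ^ (n - j) \<cdot> t ^ Suc j \<cdot> ev (q (Suc j)) t) = t ^ (n - j) \<cdot> rr (Suc j) t"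
        unfolding Frr[OF t, symmetric] by (rule endo_nmul[OF F(1) V_nmul[OF evV]])
      finally show "F t (T j (t ^ (n - j) \<cdot> t ^ Suc j \<cdot> ev (q (Suc j)) t)) = T j (t ^ (n - j) \<cdot> rr (Suc j) t)" .
    qed
    finally show ?thesis .
  qed
  obtain d where d: "\<And>i. polyf (d i) (rr i)" using rrp by metis
  define d' where "d' = Max ((\<lambda>j. d (Suc j) + (n - j)) ` {..<n})"
  have "polyf d' (\<lambda>t. \<Sum>j<n. T j (t ^ (n - j) \<cdot> rr (Suc j) t))"
  proof (rule polyf_sum)
    fix j assume j: "j \<in> {..<n}"
    have "d (Suc j) + (n - j) \<le> d'" unfolding d'_def using j by (intro Max_ge) auto
    then have "polyf d' (\<lambda>t. t ^ (n - j) \<cdot> rr (Suc j) t)"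
      by (rule polyf_mono[OF polyf_nmul[OF d[of "Suc j"], of "n - j"]])
    then show "polyf d' (\<lambda>t. T j (t ^ (n - j) \<cdot> rr (Suc j) t))"
      by (rule polyf_endo) (use j T(1) K_endo in auto)
  qed
  \<comment> \<open>Every exponent \<open>n - j\<close> is positive, so the right side vanishes,
    while the left side is the difference in question.\<close>
  from polyf_eq_at_0[OF d this dep] have "rr (Suc n) 0 = (\<Sum>j<n. T j (0 ^ (n - j) \<cdot> rr (Suc j) 0))" .
  also have "\<dots> = 0"
    using T(1) by (intro sum.neutral) (auto simp: endo_zero K_endo zero_power)
  finally show ?thesis using rr_0[of n] by simp
qed

end

section \<open>Inversions satisfying the Hua identity\<close>

text \<open>
  \<open>i a\<close> plays the role of \<open>a\<^sup>-\<^sup>1 = - a\<tau>\<close> and \<open>U a\<close> that of the Hua map \<open>h\<^sub>a\<close>.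
\<close>

locale hua_inversion = finite_dim_over_field V K B
  for V :: "'b::ab_group_add set" and K :: "('b \<Rightarrow> 'b) set" and B :: "'b set" +
  fixes U :: "'b \<Rightarrow> 'b \<Rightarrow> 'b" and i :: "'b \<Rightarrow> 'b"
  assumes i_closed: "\<lbrakk>a \<in> V; a \<noteq> 0\<rbrakk> \<Longrightarrow> i a \<in> V"
    and i_nonzero: "\<lbrakk>a \<in> V; a \<noteq> 0\<rbrakk> \<Longrightarrow> i a \<noteq> 0"
    and i_i: "\<lbrakk>a \<in> V; a \<noteq> 0\<rbrakk> \<Longrightarrow> i (i a) = a"
    and i_minus: "\<lbrakk>a \<in> V; a \<noteq> 0\<rbrakk> \<Longrightarrow> i (- a) = - i a"
    and i_nmul: "\<lbrakk>a \<in> V; a \<noteq> 0; n > 0\<rbrakk> \<Longrightarrow> n \<cdot> i (n \<cdot> a) = i a"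
    and U_endo: "a \<in> V \<Longrightarrow> endo (U a)"
    and U_zero: "x \<in> V \<Longrightarrow> U 0 x = 0"
    and U_minus: "\<lbrakk>a \<in> V; x \<in> V\<rbrakk> \<Longrightarrow> U (- a) x = U a x"
    and U_nmul: "\<lbrakk>a \<in> V; x \<in> V\<rbrakk> \<Longrightarrow> U (n \<cdot> a) x = n \<cdot> n \<cdot> U a x"
    and U_K: "\<lbrakk>a \<in> V; T \<in> K; x \<in> V\<rbrakk> \<Longrightarrow> U a (T x) = T (U a x)"
    and U_i: "\<lbrakk>a \<in> V; a \<noteq> 0\<rbrakk> \<Longrightarrow> U a (i a) = a"
    and U_inverse: "\<lbrakk>a \<in> V; a \<noteq> 0; x \<in> V\<rbrakk> \<Longrightarrow> U (i a) (U a x) = x"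
    and i_U: "\<lbrakk>a \<in> V; a \<noteq> 0; x \<in> V; x \<noteq> 0\<rbrakk> \<Longrightarrow> i (U a x) = U (i a) (i x)"
    and U_U: "\<lbrakk>a \<in> V; b \<in> V; x \<in> V\<rbrakk> \<Longrightarrow> U (U a b) x = U a (U b (U a x))"
    and hua: "\<lbrakk>a \<in> V; a \<noteq> 0; y \<in> V; y \<noteq> 0; a + y \<noteq> 0\<rbrakk> \<Longrightarrow> i (a + y) = i a - i (a + U a (i y))"
    and U_plus: "\<lbrakk>a \<in> V; a \<noteq> 0; b \<in> V; b \<noteq> 0; x \<in> V\<rbrakk> \<Longrightarrow> U (a + b) x = U a (U (i a + i b) (U b x))"
begin

section \<open>The shift formula and the scaled Hua identity\<close>

lemma U_closed [simp]: "a \<in> V \<Longrightarrow> x \<in> V \<Longrightarrow> U a x \<in> V"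
  using U_endo endo_closed by blast

lemma U_add: "\<lbrakk>a \<in> V; x \<in> V; y \<in> V\<rbrakk> \<Longrightarrow> U a (x + y) = U a x + U a y"
  using U_endo endo_add by blast

lemma U_diff: "\<lbrakk>a \<in> V; x \<in> V; y \<in> V\<rbrakk> \<Longrightarrow> U a (x - y) = U a x - U a y"
  using U_endo endo_diff by blast

lemma U_uminus: "\<lbrakk>a \<in> V; x \<in> V\<rbrakk> \<Longrightarrow> U a (- x) = - U a x"
  using U_endo endo_minus by blast

lemma U_nmul_right: "\<lbrakk>a \<in> V; x \<in> V\<rbrakk> \<Longrightarrow> U a (n \<cdot> x) = n \<cdot> U a x"
  using U_endo endo_nmul by blast

lemma U_sum: "\<lbrakk>a \<in> V; \<And>j. j \<in> J \<Longrightarrow> f j \<in> V\<rbrakk> \<Longrightarrow> U a (\<Sum>j\<in>J. f j) = (\<Sum>j\<in>J. U a (f j))"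
  using U_endo endo_sum by blast

lemma U_inverse': "\<lbrakk>a \<in> V; a \<noteq> 0; x \<in> V\<rbrakk> \<Longrightarrow> U a (U (i a) x) = x"
  using U_inverse[of "i a" x] by (simp add: i_closed i_nonzero i_i)

lemma U_inj: "\<lbrakk>a \<in> V; a \<noteq> 0; x \<in> V; y \<in> V; U a x = U a y\<rbrakk> \<Longrightarrow> x = y"
  using U_inverse by metis

lemma U_nonzero: "\<lbrakk>a \<in> V; a \<noteq> 0; x \<in> V; x \<noteq> 0\<rbrakk> \<Longrightarrow> U a x \<noteq> 0"
  using U_inj[of a x 0] endo_zero[OF U_endo] by auto

text \<open>Expanding \<open>i (z - a)\<close> as the inverse of \<open>z + (- a)\<close> and
  \<open>i z\<close> as that of \<open>(z - a) + a\<close> by \<open>hua\<close> shows that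
  \<open>z - U z (i a)\<close> and \<open>- (z - a + U (z - a) (i a))\<close> have the same inverse.
  Both are nonzero, so \<open>i\<close> can be undone.\<close>

lemma U_shift:
  assumes "a \<in> V" "a \<noteq> 0" "z \<in> V"
  shows "U z (i a) = z + z - a + U (z - a) (i a)"
proof -
  consider "z = 0" | "z = a" | "z \<noteq> 0" "z \<noteq> a" by blast
  then show ?thesis
  proof cases
    case 1
    then show ?thesis using assms by (simp add: U_zero U_minus U_i i_closed)
  next
    case 2
    then show ?thesis using assms by (simp add: U_zero U_i i_closed)
  next
    case 3
    let ?d = "z - a"
    have d: "?d \<in> V" "?d \<noteq> 0" using assms 3 by auto
    have h1: "i ?d = i z - i (z - U z (i a))"
      using hua[of z "- a"] assms 3 d by (simp add: i_minus i_closed U_uminus)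
    have h2: "i z = i ?d - i (?d + U ?d (i a))"
      using hua[of ?d a] assms 3 d by simp
    have e: "U z (i a) \<noteq> z"
    proof
      assume "U z (i a) = z"
      then have "U z (i a) = U z (i z)" using 3 assms U_i by metis
      then have "i a = i z" using 3 assms U_inj i_closed by metis
      then show False using 3 assms i_i by metis
    qed
    have e': "?d + U ?d (i a) \<noteq> 0"
    proof
      assume "?d + U ?d (i a) = 0"
      then have "U ?d (i a) = U ?d (i (- ?d))"
        using d by (simp add: add_eq_0_iff i_minus U_uminus U_i i_closed del: minus_diff_eq)
      moreover have "i (- ?d) \<in> V" using d i_closed V_uminus neg_equal_0_iff_equal by metis
      ultimately have "i a = i (- ?d)" using assms d U_inj i_closed by metis
      then have "a = - ?d" using assms d i_i by (metis V_uminus neg_equal_0_iff_equal)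
      then show False using 3 by simp
    qed
    have w: "?d + U ?d (i a) \<in> V" using assms d by (simp add: i_closed)
    have "i (z - U z (i a)) = i z - i ?d" by (simp only: h1) simp
    also have "\<dots> = - i (?d + U ?d (i a))" by (simp only: h2) simp
    also have "\<dots> = i (- (?d + U ?d (i a)))" by (rule i_minus[OF w e', symmetric])
    finally have "i (z - U z (i a)) = i (- (?d + U ?d (i a)))" .
    moreover have "z - U z (i a) \<in> V" using assms by (simp add: i_closed)
    moreover have "z - U z (i a) \<noteq> 0" using e by auto
    moreover have "- (?d + U ?d (i a)) \<noteq> 0" using e' neg_equal_0_iff_equal by blast
    moreover have "- (?d + U ?d (i a)) \<in> V" by (rule V_uminus[OF w])
    ultimately have "z - U z (i a) = - (?d + U ?d (i a))" using i_i by metis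
    then show ?thesis by (simp add: algebra_simps)
  qed
qed

text \<open>By \<open>i_nmul\<close>, \<open>i (t \<cdot> c)\<close> is \<open>i c\<close> divided
  by \<open>t\<close>. Clearing this denominator inside the outer \<open>i\<close> produces the
  factor \<open>t\<close> in front of it, so the identity needs no division.\<close>

lemma hua_nmul:
  assumes "a \<in> V" "a \<noteq> 0" "c \<in> V" "c \<noteq> 0" "t > 0" "a + t \<cdot> c \<noteq> 0"
  shows "i (a + t \<cdot> c) = i a - t \<cdot> i (t \<cdot> a + U a (i c))"
proof -
  have tc: "t \<cdot> c \<noteq> 0" using assms V_torsion_free by blast
  let ?y = "U a (i (t \<cdot> c))"
  have y: "?y \<in> V" using tc assms by (simp add: i_closed)
  have ty: "t \<cdot> ?y = U a (i c)"
    using assms tc i_nmul[of c t] by (simp add: i_closed flip: U_nmul_right)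
  have h: "i (a + t \<cdot> c) = i a - i (a + ?y)"
    using hua[of a "t \<cdot> c"] assms tc by simp
  have "a + ?y \<noteq> 0"
  proof
    assume "a + ?y = 0"
    then have "U a (i (t \<cdot> c)) = - a" by (simp add: add_eq_0_iff)
    moreover have "U a (i (- a)) = - a"
      using assms by (simp add: i_minus U_uminus U_i i_closed)
    moreover have "i (t \<cdot> c) \<in> V" "i (- a) \<in> V"
      using assms tc i_closed by simp_all
    ultimately have "i (t \<cdot> c) = i (- a)"
      by - (rule U_inj[OF assms(1,2)], simp_all)
    then have "t \<cdot> c = - a"
      using i_i[of "t \<cdot> c"] i_i[of "- a"] tc assms(1-3) by (metis V_nmul V_uminus neg_equal_0_iff_equal)
    then show False using assms by simp
  qed
  then have "t \<cdot> i (t \<cdot> (a + ?y)) = i (a + ?y)"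
    using i_nmul assms y by simp
  then show ?thesis using h ty by (simp add: nmul_add)
qed

text \<open>
  \<open>vseq a c\<close> lists the coefficients of the expansion of \<open>i (a + t c)\<close> at \<open>t = 0\<close>, and
  \<open>gseq a c t\<close> its remainders: \<open>gseq a c t j = vseq a c j + t gseq a c t (j + 1)\<close>.
\<close>

fun vseq :: "'b \<Rightarrow> 'b \<Rightarrow> nat \<Rightarrow> 'b" where
  "vseq a c 0 = i a"
| "vseq a c (Suc 0) = - U (i a) c"
| "vseq a c (Suc (Suc j)) = U (i a) (U c (vseq a c j))"

fun gseq :: "'b \<Rightarrow> 'b \<Rightarrow> nat \<Rightarrow> nat \<Rightarrow> 'b" where
  "gseq a c t 0 = i (a + t \<cdot> c)"
| "gseq a c t (Suc 0) = - i (t \<cdot> a + U a (i c))"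
| "gseq a c t (Suc (Suc j)) = U (i a) (U c (gseq a c t j))"

lemma vseq_closed [simp]: "\<lbrakk>a \<in> V; a \<noteq> 0; c \<in> V\<rbrakk> \<Longrightarrow> vseq a c j \<in> V"
  by (induction a c j rule: vseq.induct) (auto simp: i_closed)

context
  fixes a c :: 'b and t :: nat
  assumes a: "a \<in> V" "a \<noteq> 0" and c: "c \<in> V" "c \<noteq> 0" and t: "t > 0" "a + t \<cdot> c \<noteq> 0"
begin

text \<open>The third part is the step from remainder 1 to remainder 2. A second use of
  \<open>hua_nmul\<close>, now with \<open>U a (i c)\<close> and \<open>a\<close> in place of
  \<open>a\<close> and \<open>c\<close>, leads back to \<open>i (a + t \<cdot> c)\<close>, because
  by \<open>S\<close> the new argument is \<open>U a (U (i c) (a + t \<cdot> c))\<close>. This is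
  why the recursions advance by two.\<close>

lemma gseq_1_arg:
  "t \<cdot> a + U a (i c) \<in> V" "t \<cdot> a + U a (i c) \<noteq> 0"
  "i (t \<cdot> a + U a (i c)) = U (i a) c - t \<cdot> U (i a) (U c (i (a + t \<cdot> c)))"
proof -
  let ?y = "U a (i c)"
  have V: "i a \<in> V" "i c \<in> V" "?y \<in> V" "a + t \<cdot> c \<in> V" "i a \<noteq> 0" "i c \<noteq> 0"
    using a c by (auto simp: i_closed i_nonzero)
  have y0: "?y \<noteq> 0" using U_nonzero a V by simp
  have Uy: "U ?y x = U a (U (i c) (U a x))" if "x \<in> V" for x
    using U_U a V that by simp
  have yc: "?y = U a (U (i c) c)" using U_i[of "i c"] i_i c V by simp
  have S: "t \<cdot> ?y + U ?y (i a) = U a (U (i c) (a + t \<cdot> c))"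
  proof -
    have "U ?y (i a) = U a (U (i c) a)" using Uy[OF V(1)] U_i a by simp
    then show ?thesis using a c V by (subst yc) (simp add: U_add U_nmul_right add.commute)
  qed
  show 1: "t \<cdot> a + ?y \<in> V" using a V by simp
  have y1: "i ?y = U (i a) c" using i_U[of a "i c"] i_i a c V by simp
  show 2: "t \<cdot> a + ?y \<noteq> 0"
  proof
    assume "t \<cdot> a + ?y = 0"
    then have "- ?y = t \<cdot> a" by (metis add_eq_0_iff minus_minus)
    then have "t \<cdot> i (- ?y) = i a" using i_nmul[OF a, of t] t by simp
    then have "U a (i a) = U a (t \<cdot> (- U (i a) c))"
      using y0 V y1 by (simp add: i_minus)
    also have "\<dots> = - (t \<cdot> c)"
      using a c V by (simp add: U_nmul_right U_uminus U_inverse' nmul_minus)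
    finally show False using t a U_i by simp
  qed
  have "i (?y + t \<cdot> a) = i ?y - t \<cdot> i (t \<cdot> ?y + U ?y (i a))"
    using hua_nmul[of ?y a t] 2 y0 V a t by (simp add: add.commute)
  also have "i (t \<cdot> ?y + U ?y (i a)) = U (i a) (i (U (i c) (a + t \<cdot> c)))"
    unfolding S using U_nonzero[of "i c" "a + t \<cdot> c"] a V t by - (rule i_U, auto)
  also have "i (U (i c) (a + t \<cdot> c)) = U c (i (a + t \<cdot> c))"
    using i_U[of "i c" "a + t \<cdot> c"] V t i_i c by simp
  finally show "i (t \<cdot> a + ?y) = U (i a) c - t \<cdot> U (i a) (U c (i (a + t \<cdot> c)))"
    using y1 by (simp add: add.commute)
qed

lemma gseq_closed [simp]: "gseq a c t j \<in> V"
proof (induction j rule: induct_nat_012)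
  case 0
  then show ?case using a c t by (simp add: i_closed)
next
  case 1
  then show ?case using gseq_1_arg(1,2) by (simp add: i_closed)
next
  case (ge2 n)
  then show ?case using a c by (simp add: i_closed)
qed

lemma gseq_step: "gseq a c t j = vseq a c j + t \<cdot> gseq a c t (Suc j)"
proof (induction j rule: induct_nat_012)
  case 0
  then show ?case using hua_nmul a c t by (simp add: nmul_minus)
next
  case 1
  then show ?case using gseq_1_arg(3) by simp
next
  case (ge2 n)
  have "gseq a c t (Suc (Suc n)) = U (i a) (U c (vseq a c n + t \<cdot> gseq a c t (Suc n)))"
    using ge2(1) by simp
  then show ?case using a c by (simp add: U_add U_nmul_right i_closed)
qed

text \<open>Although remainders involve inverses, \<open>U (a + t \<cdot> c)\<close> makes them
  affine in \<open>t\<close>. In an associative model, with \<open>U a x = a x a\<close>, remainder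
  \<open>j\<close> is \<open>(- a^-1 c)^j (a + t c)^-1\<close>, and both sides are
  \<open>(a + t c) (- a^-1 c)^j\<close>.\<close>

lemma U_gseq: "U (a + t \<cdot> c) (gseq a c t j) = U a (vseq a c j) - t \<cdot> U a (vseq a c (Suc j))"
proof (induction j rule: induct_nat_012)
  case 0
  then show ?case using a c t by (simp add: U_i U_uminus U_inverse' i_closed nmul_minus)
next
  case 1
  let ?A = "a + t \<cdot> c"
  have A: "?A \<in> V" using a c by simp
  have "?A = U ?A (gseq a c t 0)" using A t U_i by simp
  also have "\<dots> = U ?A (i a) + t \<cdot> U ?A (gseq a c t 1)"
    using gseq_step[of 0] a c A by (simp add: U_add U_nmul_right i_closed del: gseq.simps)
  also have "U ?A (i a) = ?A + ?A - a + t \<cdot> t \<cdot> U c (i a)"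
    using U_shift[of a ?A] a c A by (simp add: U_nmul i_closed)
  finally have "t \<cdot> U ?A (gseq a c t 1) = ?A - (?A + ?A - a + t \<cdot> t \<cdot> U c (i a))"
    by (metis add_diff_cancel_left')
  also have "\<dots> = t \<cdot> (- c - t \<cdot> U c (i a))"
    by (simp add: nmul_diff nmul_minus)
  finally have "t \<cdot> U ?A (gseq a c t 1) = t \<cdot> (- c - t \<cdot> U c (i a))" .
  then have "U ?A (gseq a c t 1) = - c - t \<cdot> U c (i a)"
    using a c A t by - (rule nmul_cancel[of _ _ t], auto simp: i_closed simp del: gseq.simps)
  then show ?case using a c by (simp add: U_uminus U_inverse' i_closed)
next
  case (ge2 n)
  let ?A = "a + t \<cdot> c"
  have A: "?A \<in> V" using a c by simp
  have tc: "t \<cdot> c \<noteq> 0" using c t V_torsion_free by blast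
  have V: "i a \<in> V" "i (t \<cdot> c) \<in> V" using a c tc i_closed by auto
  \<comment> \<open>\<open>U_plus\<close> with the summands \<open>a\<close> and
    \<open>t \<cdot> c\<close> in both orders shows that the two factors driving the recursion pass
    \<open>U ?A\<close> in reversed order.\<close>
  have comm: "U ?A (U (i a) (U c x)) = U c (U (i a) (U ?A x))" if x: "x \<in> V" for x
  proof -
    let ?s = "i a + i (t \<cdot> c)"
    have s: "?s \<in> V" using V by simp
    have "U ?A (U (i a) (U c x)) = U (t \<cdot> c) (U ?s (U a (U (i a) (U c x))))"
      using U_plus[of "t \<cdot> c" a] a c tc x V by (simp add: add.commute)
    also have "\<dots> = t \<cdot> t \<cdot> U c (U ?s (U c x))"
      using a c x s by (simp add: U_inverse' U_nmul)
    also have "\<dots> = U c (U (i a) (U a (U ?s (U (t \<cdot> c) x))))"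
      using a c x s V by (simp add: U_inverse U_nmul U_nmul_right)
    also have "\<dots> = U c (U (i a) (U ?A x))"
      using U_plus[of a "t \<cdot> c"] a c tc x by simp
    finally show ?thesis .
  qed
  have "U ?A (gseq a c t (Suc (Suc n))) = U c (U (i a) (U a (vseq a c n) - t \<cdot> U a (vseq a c (Suc n))))"
    using ge2(1) comm[OF gseq_closed] by simp
  then show ?case
    using a c V by (simp add: U_diff U_nmul_right U_inverse U_inverse' del: vseq.simps(1,2))
qed

text \<open>Two consecutive relations suffice since the recursion advances by two. They carry over
  from coefficients to remainders because \<open>U_gseq\<close> expresses the images of the
  remainders by coefficients and \<open>U (a + t \<cdot> c)\<close> is injective.\<close>

lemma gseq_dependency:
  assumes S: "\<And>j. j < n \<Longrightarrow> S j \<in> K"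
    and v: "vseq a c n = (\<Sum>j<n. S j (vseq a c j))" "vseq a c (Suc n) = (\<Sum>j<n. S j (vseq a c (Suc j)))"
  shows "gseq a c t (n + m) = (\<Sum>j<n. S j (gseq a c t (j + m)))"
proof -
  have vm: "vseq a c (n + m) = (\<Sum>j<n. S j (vseq a c (j + m)))" for m
  proof (induction m rule: induct_nat_012)
    case 0 then show ?case using v by simp
  next
    case 1 then show ?case using v by (simp del: vseq.simps)
  next
    case (ge2 m)
    have "vseq a c (n + Suc (Suc m)) = U (i a) (U c (\<Sum>j<n. S j (vseq a c (j + m))))"
      using ge2(1) by simp
    also have "\<dots> = (\<Sum>j<n. U (i a) (U c (S j (vseq a c (j + m)))))"
    proof -
      have "S j (vseq a c (j + m)) \<in> V" if "j \<in> {..<n}" for j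
        using that a c S K_closed by simp
      then show ?thesis
        using U_sum[OF c(1), of "{..<n}"] U_sum[OF i_closed[OF a], of "{..<n}"] c(1) U_closed by simp
    qed
    also have "\<dots> = (\<Sum>j<n. S j (vseq a c (j + Suc (Suc m))))"
      using a c S by (intro sum.cong refl) (simp add: U_K[OF c(1) S] U_K[OF i_closed[OF a] S])
    finally show ?case .
  qed
  let ?A = "a + t \<cdot> c"
  have A: "?A \<in> V" "?A \<noteq> 0" using a c t by auto
  have SV: "S j (gseq a c t l) \<in> V" "S j (vseq a c l) \<in> V" if "j < n" for j l
    using K_closed[OF S[OF that]] a c by simp_all
  have "U ?A (\<Sum>j<n. S j (gseq a c t (j + m))) = (\<Sum>j<n. S j (U ?A (gseq a c t (j + m))))"
    using U_sum[OF A(1), of "{..<n}" "\<lambda>j. S j (gseq a c t (j + m))"] SV U_K[OF A(1) S] gseq_closed by simp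
  also have "\<dots> = (\<Sum>j<n. U a (S j (vseq a c (j + m))) - t \<cdot> U a (S j (vseq a c (j + Suc m))))"
    using a c S by (intro sum.cong refl) (simp add: U_gseq U_K[OF a(1) S] endo_diff endo_nmul K_endo del: vseq.simps)
  also have "\<dots> = U a (vseq a c (n + m)) - t \<cdot> U a (vseq a c (n + Suc m))"
    unfolding vm sum_subtractf nmul_sum
    using U_sum[OF a(1), of "{..<n}" "\<lambda>j. S j (vseq a c (j + m))"] U_sum[OF a(1), of "{..<n}" "\<lambda>j. S j (vseq a c (j + Suc m))"] SV
    by (simp add: nmul_sum del: vseq.simps)
  also have "\<dots> = U ?A (gseq a c t (n + m))" by (simp add: U_gseq del: vseq.simps)
  finally show ?thesis
    by (rule U_inj[OF A, symmetric, rotated 2]) (rule V_sum, rule SV, simp, rule gseq_closed)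
qed

end

text \<open>
  The denominator of \<open>i (a + t c)\<close>; it is normalized to be the identity at \<open>t = 0\<close>.
\<close>

definition denom :: "nat \<Rightarrow> (nat \<Rightarrow> 'b \<Rightarrow> 'b) \<Rightarrow> nat \<Rightarrow> 'b \<Rightarrow> 'b" where
  "denom n S t x = x - (\<Sum>j<n. S j (t ^ (n - j) \<cdot> x))"

definition numer :: "nat \<Rightarrow> (nat \<Rightarrow> 'b \<Rightarrow> 'b) \<Rightarrow> (nat \<Rightarrow> 'b) \<Rightarrow> nat \<Rightarrow> 'b" where
  "numer n S w t = (\<Sum>l<n. t ^ l \<cdot> w l) - (\<Sum>j<n. S j (t ^ (n - j) \<cdot> (\<Sum>l<j. t ^ l \<cdot> w l)))"

lemma denom_K:
  assumes "\<And>j. j < n \<Longrightarrow> S j \<in> K" shows "denom n S t \<in> K"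
proof -
  have nK: "(\<lambda>x. m \<cdot> x) \<in> K" for m
    by (induction m) (auto intro: K_zero K_plus K_id)
  have "(\<lambda>x. \<Sum>j<n. S j (t ^ (n - j) \<cdot> x)) \<in> K"
    by (rule K_sum, rule K_comp[OF _ nK]) (use assms in auto)
  from K_plus[OF K_id K_minus[OF this]] show ?thesis by (simp add: denom_def[abs_def])
qed

lemma denom_0: "(\<And>j. j < n \<Longrightarrow> S j \<in> K) \<Longrightarrow> denom n S 0 x = x"
  unfolding denom_def by (simp add: endo_zero K_endo zero_power)

lemma numer_0: "(\<And>j. j < n \<Longrightarrow> S j \<in> K) \<Longrightarrow> n > 0 \<Longrightarrow> numer n S w 0 = w 0"
  unfolding numer_def
  by (cases n) (simp_all only: sum.lessThan_Suc_shift, simp_all add: endo_zero K_endo zero_power)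

lemma polyf_power_nmul: "x \<in> V \<Longrightarrow> polyf (Suc l) (\<lambda>t. t ^ l \<cdot> x)"
  using polyf_nmul[OF polyf_const[of x 1], of l] by simp

lemma polyf_denom:
  assumes "\<And>j. j < n \<Longrightarrow> S j \<in> K" "polyf D f"
  shows "polyf (D + n) (\<lambda>t. denom n S t (f t))"
proof -
  have "polyf (D + n) (\<lambda>t. S j (t ^ (n - j) \<cdot> f t))" if "j \<in> {..<n}" for j
  proof (rule polyf_endo[where h = "S j"])
    show "endo (S j)" using assms(1) K_endo that by simp
    show "polyf (D + n) (\<lambda>t. t ^ (n - j) \<cdot> f t)"
      by (rule polyf_mono[OF polyf_nmul[OF assms(2)]]) simp
  qed
  then show ?thesis unfolding denom_def
    by (intro polyf_diff[OF polyf_mono[OF assms(2)] polyf_sum]) auto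
qed

lemma polyf_numer:
  assumes S: "\<And>j. j < n \<Longrightarrow> S j \<in> K" and w: "\<And>l. w l \<in> V"
  shows "polyf n (numer n S w)"
proof -
  have initial: "polyf j (\<lambda>t. \<Sum>l<j. t ^ l \<cdot> w l)" for j
    by (rule polyf_sum, rule polyf_mono[OF polyf_power_nmul[OF w]]) auto
  have "polyf n (\<lambda>t. S j (t ^ (n - j) \<cdot> (\<Sum>l<j. t ^ l \<cdot> w l)))" if "j \<in> {..<n}" for j
  proof (rule polyf_endo[where h = "S j"])
    show "endo (S j)" using S K_endo that by simp
    show "polyf n (\<lambda>t. t ^ (n - j) \<cdot> (\<Sum>l<j. t ^ l \<cdot> w l))"
      by (rule polyf_mono[OF polyf_nmul[OF initial]]) (use that in auto)
  qed
  then show ?thesis unfolding numer_def[abs_def]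
    by (rule polyf_diff[OF initial polyf_sum])
qed

text \<open>Multiply the dependency by \<open>t ^ n\<close> and replace each
  \<open>t ^ j \<cdot> h j\<close> by \<open>h 0\<close> minus an initial sum; the terms with
  \<open>h 0\<close> form the denominator.\<close>

lemma denom_eq_numer:
  assumes S: "\<And>j. j < n \<Longrightarrow> S j \<in> K" and V: "\<And>l. h l \<in> V" "\<And>l. w l \<in> V"
    and step: "\<And>j. h j = w j + t \<cdot> h (Suc j)" and dep: "h n = (\<Sum>j<n. S j (h j))"
  shows "denom n S t (h 0) = numer n S w t"
proof -
  have h0: "h 0 = (\<Sum>l<j. t ^ l \<cdot> w l) + t ^ j \<cdot> h j" for j
  proof (induction j)
    case (Suc j)
    then show ?case using step[of j] by (simp add: nmul_add nmul_mult nmul_commute add.assoc)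
  qed simp
  have "t ^ n \<cdot> h n = (\<Sum>j<n. S j (t ^ (n - j) \<cdot> t ^ j \<cdot> h j))"
    unfolding dep nmul_sum
    by (intro sum.cong refl) (use S V in \<open>simp add: endo_nmul K_endo flip: nmul_mult power_add\<close>)
  also have "\<dots> = (\<Sum>j<n. S j (t ^ (n - j) \<cdot> h 0) - S j (t ^ (n - j) \<cdot> (\<Sum>l<j. t ^ l \<cdot> w l)))"
  proof (intro sum.cong refl)
    fix j assume j: "j \<in> {..<n}"
    have "t ^ j \<cdot> h j = h 0 - (\<Sum>l<j. t ^ l \<cdot> w l)" using h0[of j] by simp
    then show "S j (t ^ (n - j) \<cdot> t ^ j \<cdot> h j) =
        S j (t ^ (n - j) \<cdot> h 0) - S j (t ^ (n - j) \<cdot> (\<Sum>l<j. t ^ l \<cdot> w l))"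
      using j S V by (simp add: nmul_diff endo_diff K_endo)
  qed
  finally show ?thesis unfolding denom_def numer_def sum_subtractf
    using h0[of n] by (simp add: algebra_simps)
qed

text \<open>One dependency is chosen for all \<open>a\<close> in \<open>A\<close> and for the shifts
  0 and 1 at once, so a single denominator serves both the inverses and their difference quotients.
  For each \<open>a\<close>, at most one \<open>t\<close> makes \<open>a + t \<cdot> c\<close>
  vanish. Only an empty \<open>A\<close> allows \<open>n = 0\<close>.\<close>

lemma common_denominator:
  assumes A: "finite A" "A \<subseteq> V - {0}" and c: "c \<in> V" "c \<noteq> 0"
  obtains n :: nat and S N where
    "\<And>j. j < n \<Longrightarrow> S j \<in> K" "\<And>a. a \<in> A \<Longrightarrow> n > 0"
    "\<And>a t. a \<in> A \<Longrightarrow> t \<ge> N \<Longrightarrow> t > 0 \<and> a + t \<cdot> c \<noteq> 0"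
    "\<And>a t. a \<in> A \<Longrightarrow> t \<ge> N \<Longrightarrow> denom n S t (gseq a c t 0) = numer n S (vseq a c) t"
    "\<And>a t. a \<in> A \<Longrightarrow> t \<ge> N \<Longrightarrow> denom n S t (gseq a c t 1) = numer n S (\<lambda>j. vseq a c (Suc j)) t"
proof -
  have AV: "a \<in> V \<and> a \<noteq> 0" if "a \<in> A" for a using A that by auto
  obtain n S where S: "\<And>j. j < n \<Longrightarrow> S j \<in> K"
    "\<And>e. e \<in> A \<times> {0,1} \<Longrightarrow> vseq (fst e) c (n + snd e) = (\<Sum>j<n. S j (vseq (fst e) c (j + snd e)))"
  proof -
    have "vseq (fst e) c (j + snd e) \<in> V" if "e \<in> A \<times> {0,1}" for e j
      using that c AV by auto
    then show thesis
    proof (rule dependency[where A = "A \<times> {0,1}" and x = "\<lambda>j e. vseq (fst e) c (j + snd e)", rotated])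
      show "finite (A \<times> {0::nat, 1})" using A(1) by simp
    qed (assumption, rule that)
  qed
  have v: "vseq a c n = (\<Sum>j<n. S j (vseq a c j))" "vseq a c (Suc n) = (\<Sum>j<n. S j (vseq a c (Suc j)))"
    if "a \<in> A" for a
    using S(2)[of "(a, 0)"] S(2)[of "(a, 1)"] that by auto
  have npos: "n > 0" if "a \<in> A" for a
  proof (rule ccontr)
    assume "\<not> n > 0"
    then have "i a = 0" using v(1)[OF that] by simp
    then show False using i_nonzero AV[OF that] by blast
  qed
  have "\<exists>N>0. \<forall>t\<ge>N. a + t \<cdot> c \<noteq> 0" for a
  proof (rule ccontr)
    assume *: "\<not> (\<exists>N>0. \<forall>t\<ge>N. a + t \<cdot> c \<noteq> 0)"
    then have zero: "\<exists>t\<ge>N. a + t \<cdot> c = 0" if "N > 0" for N using that by blast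
    obtain t where t: "a + t \<cdot> c = 0" using zero[of 1] by auto
    obtain t' where t': "t' \<ge> Suc t" "a + t' \<cdot> c = 0" using zero[of "Suc t"] by auto
    have "(t' - t) \<cdot> c = 0" using t t' by (simp add: nmul_diff_left add_eq_0_iff)
    then show False using V_torsion_free[of c "t' - t"] c t' by simp
  qed
  then obtain N where N: "\<And>a. N a > 0" "\<And>a t. t \<ge> N a \<Longrightarrow> a + t \<cdot> c \<noteq> 0" by metis
  have t: "t > 0 \<and> a + t \<cdot> c \<noteq> 0" if "a \<in> A" "t \<ge> Max (N ` A)" for a t
  proof -
    have "t \<ge> N a" using that A by (meson Max_ge finite_imageI imageI le_trans)
    then show ?thesis using N[of a] by auto
  qed
  show thesis
  proof (rule that[OF S(1) npos t])
    fix a t assume a: "a \<in> A" and "t \<ge> Max (N ` A)"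
    then have *: "t > 0" "a + t \<cdot> c \<noteq> 0" using t by auto
    have a': "a \<in> V" "a \<noteq> 0" using AV a by auto
    note facts = gseq_closed[OF a' c *] gseq_step[OF a' c *]
      gseq_dependency[OF a' c * S(1) v[OF a]]
    have vV: "vseq a c l \<in> V" for l using a' c by simp
    show "denom n S t (gseq a c t 0) = numer n S (vseq a c) t"
    proof (rule denom_eq_numer[where h = "gseq a c t"])
      show "gseq a c t n = (\<Sum>j<n. S j (gseq a c t j))"
        using facts(3)[of 0] by (simp del: gseq.simps)
    qed (rule S(1) facts(1,2) vV; assumption?)+
    show "denom n S t (gseq a c t 1) = numer n S (\<lambda>j. vseq a c (Suc j)) t"
    proof -
      have "denom n S t (gseq a c t (Suc 0)) = numer n S (\<lambda>j. vseq a c (Suc j)) t"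
      proof (rule denom_eq_numer[where h = "\<lambda>j. gseq a c t (Suc j)"])
        show "gseq a c t (Suc n) = (\<Sum>j<n. S j (gseq a c t (Suc j)))"
          using facts(3)[of 1] by (simp del: gseq.simps)
      qed (rule S(1) facts(1,2) vV; assumption?)+
      then show ?thesis by (simp del: gseq.simps)
    qed
  qed auto
qed

lemma sum_K_closed: "\<lbrakk>\<And>j. j \<in> I \<Longrightarrow> T j \<in> K; \<And>j. j \<in> I \<Longrightarrow> f j \<in> V\<rbrakk> \<Longrightarrow> (\<Sum>j\<in>I. T j (f j)) \<in> V"
  using K_closed by (intro V_sum) blast

lemma U_sum_K:
  assumes "a \<in> V" "\<And>j. j \<in> I \<Longrightarrow> T j \<in> K" "\<And>j. j \<in> I \<Longrightarrow> f j \<in> V"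
  shows "U a (\<Sum>j\<in>I. T j (f j)) = (\<Sum>j\<in>I. T j (U a (f j)))"
proof -
  have "U a (\<Sum>j\<in>I. T j (f j)) = (\<Sum>j\<in>I. U a (T j (f j)))"
    by (rule U_sum[OF assms(1)]) (use assms K_closed in blast)
  also have "\<dots> = (\<Sum>j\<in>I. T j (U a (f j)))"
    using assms by (intro sum.cong refl) (rule U_K)
  finally show ?thesis .
qed

text \<open>
  The value at \<open>t = 0\<close> of the derivative of \<open>t \<mapsto> U (z + t c) (i (a + t c))\<close>, computed by means
  of \<open>U_shift\<close>, for a combination of elements \<open>a\<close> in which the term \<open>U (z + t c) (i a)\<close> cancels.
\<close>

lemma limit_relation:
  assumes z: "z \<in> V" and c: "c \<in> V" "c \<noteq> 0" and I: "finite I"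
    and a: "\<And>j. j \<in> I \<Longrightarrow> a j \<in> V" "\<And>j. j \<in> I \<Longrightarrow> a j \<noteq> 0"
    and T: "\<And>j. j \<in> I \<Longrightarrow> T j \<in> K" and rel: "(\<Sum>j\<in>I. T j (i (a j))) = 0"
  shows "(\<Sum>j\<in>I. T j c) - (\<Sum>j\<in>I. T j (U (z - a j) (U (i (a j)) c))) = - U z (\<Sum>j\<in>I. T j (U (i (a j)) c))"
proof -
  define C where "C = B - {0}"
  have C: "b \<in> V" "b \<noteq> 0" "i b \<in> V" "i b \<noteq> 0" "i (i b) = b" if "b \<in> C" for b
    using that B_subset i_closed i_nonzero i_i unfolding C_def by auto
  \<comment> \<open>Two kinds of base points: the \<open>a j\<close> under study, and the inverses
    \<open>i b\<close>, whose curves of inverses start at \<open>b\<close> and thus provide the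
    spanning family for \<open>continuity_at_0\<close>.\<close>
  define A where "A = a ` I \<union> i ` C"
  have A: "finite A" "A \<subseteq> V - {0}"
    unfolding A_def using I a B_finite C unfolding C_def by auto
  obtain n :: nat and S N where S: "\<And>j. j < n \<Longrightarrow> S j \<in> K" "\<And>a. a \<in> A \<Longrightarrow> n > 0"
    "\<And>a t. a \<in> A \<Longrightarrow> t \<ge> N \<Longrightarrow> t > 0 \<and> a + t \<cdot> c \<noteq> 0"
    "\<And>a t. a \<in> A \<Longrightarrow> t \<ge> N \<Longrightarrow> denom n S t (gseq a c t 0) = numer n S (vseq a c) t"
    "\<And>a t. a \<in> A \<Longrightarrow> t \<ge> N \<Longrightarrow> denom n S t (gseq a c t 1) = numer n S (\<lambda>j. vseq a c (Suc j)) t"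
    by (rule common_denominator[OF A c]) (rule that)
  define q where "q = denom n S"
  have qK: "q t \<in> K" for t unfolding q_def by (rule denom_K[OF S(1)])
  have q0: "q 0 x = x" for x unfolding q_def by (rule denom_0[OF S(1)])
  have qU: "U x (q t y) = q t (U x y)" if "x \<in> V" "y \<in> V" for x y t
    by (rule U_K[OF that(1) qK that(2)])
  have qadd: "q t (x + y) = q t x + q t y" if "x \<in> V" "y \<in> V" for t x y
    by (rule K_add[OF qK that])
  \<comment> \<open>\<open>?R b\<close> is what \<open>U_shift\<close> gives for the image of
    \<open>?P b\<close>, since \<open>(z + t \<cdot> c) - (i b + t \<cdot> c) = z - i b\<close>. The
    curves \<open>?P1 j\<close> are the difference quotients of the inverse at \<open>a j\<close>,
    multiplied by the common denominator.\<close>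
  let ?P = "\<lambda>b. numer n S (vseq (i b) c)"
  let ?R = "\<lambda>b t. q t (z + z - i b + t \<cdot> c) + U (z - i b) (?P b t)"
  let ?P1 = "\<lambda>j. numer n S (\<lambda>l. vseq (a j) c (Suc l))"
  let ?p = "\<lambda>t. \<Sum>j\<in>I. T j (?P1 j t)"
  let ?r = "\<lambda>t. q t (\<Sum>j\<in>I. T j c) + (\<Sum>j\<in>I. T j (U (z - a j) (?P1 j t)))"
  have P: "polyf n (?P b)" if "b \<in> C" for b
    by (rule polyf_numer[OF S(1)]) (use C[OF that] c in auto)
  have P1: "polyf n (?P1 j)" if "j \<in> I" for j
    by (rule polyf_numer[OF S(1)]) (use a[OF that] c in auto)
  have R: "polyf (n + 2) (?R b)" if "b \<in> C" for b
  proof -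
    have "polyf (1 + 1) (\<lambda>t. t ^ 1 \<cdot> c)" by (rule polyf_nmul, rule polyf_const) (use c in auto)
    then have lin: "polyf 2 (\<lambda>t. z + z - i b + t \<cdot> c)"
      by (intro polyf_add[OF polyf_const]) (use z C[OF that] in \<open>auto simp: numeral_2_eq_2\<close>)
    show ?thesis unfolding q_def
      by (rule polyf_add[OF polyf_mono[OF polyf_denom[OF S(1) lin]]])
        (auto intro!: polyf_mono[OF polyf_endo[OF P[OF that] U_endo]] V_diff z C[OF that])
  qed
  have p: "polyf n ?p"
    by (rule polyf_sum, rule polyf_endo[OF P1 K_endo[OF T]])
  have Tc: "(\<Sum>j\<in>I. T j c) \<in> V" by (rule sum_K_closed[OF T c(1)])
  have r: "polyf (1 + n) ?r"
  proof (rule polyf_add)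
    show "polyf (1 + n) (\<lambda>t. q t (\<Sum>j\<in>I. T j c))"
      unfolding q_def by (rule polyf_denom[OF S(1) polyf_const[OF Tc]]) auto
    show "polyf (1 + n) (\<lambda>t. \<Sum>j\<in>I. T j (U (z - a j) (?P1 j t)))"
      by (rule polyf_sum, rule polyf_endo[OF polyf_mono[OF polyf_endo[OF P1 U_endo]] K_endo[OF T]])
        (use z a in auto)
  qed
  have eq: "?r 0 = U (z + 0 \<cdot> c) (?p 0)"
  proof (rule continuity_at_0[where F = "\<lambda>t. U (z + t \<cdot> c)" and C = C and P = ?P and R = ?R
        and p = ?p and r = ?r and N = N])
    show "endo (U (z + t \<cdot> c))" for t using U_endo z c by simp
    show "U (z + t \<cdot> c) (T x) = T (U (z + t \<cdot> c) x)" if "T \<in> K" "x \<in> V" for t T x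
      by (rule U_K[OF _ that]) (use z c in simp)
    show "finite C" using B_finite by (simp add: C_def)
    show "\<exists>l. (\<forall>b\<in>C. l b \<in> K) \<and> x = (\<Sum>b\<in>C. l b b)" if "x \<in> V" for x
      unfolding C_def by (rule B_nonzero_span[OF that])
    fix b assume b: "b \<in> C"
    then have ibA: "i b \<in> A" by (simp add: A_def)
    show "?P b 0 = b"
      using numer_0[OF S(1) S(2)[OF ibA]] C[OF b] by simp
    then show "?R b 0 = U (z + 0 \<cdot> c) b"
      using U_shift[of "i b" z] C[OF b] z q0 by simp
    fix t assume t: "t \<ge> N"
    let ?a = "i b + t \<cdot> c" and ?Z = "z + t \<cdot> c"
    have aV: "?a \<in> V" "?a \<noteq> 0" "i ?a \<in> V" using S(3)[OF ibA t] C[OF b] c i_closed[of ?a] by auto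
    have "?P b t = q t (i ?a)" using S(4)[OF ibA t] by (simp add: q_def)
    then have "U ?Z (?P b t) = q t (U ?Z (i ?a))" using qU aV z c by simp
    also have "U ?Z (i ?a) = (z + z - i b + t \<cdot> c) + U (z - i b) (i ?a)"
      using U_shift[of ?a ?Z] aV z c by (simp add: algebra_simps)
    also have "q t \<dots> = q t (z + z - i b + t \<cdot> c) + U (z - i b) (q t (i ?a))"
      using qadd qU aV z c C[OF b] by simp
    finally show "U ?Z (?P b t) = ?R b t"
      using \<open>?P b t = q t (i ?a)\<close> by simp
  next
    fix t assume t: "t \<ge> N"
    let ?Z = "z + t \<cdot> c" and ?g0 = "\<lambda>j. gseq (a j) c t 0" and ?g1 = "\<lambda>j. gseq (a j) c t (Suc 0)"
    have Z: "?Z \<in> V" using z c by simp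
    have at: "t > 0" "a j + t \<cdot> c \<noteq> 0" if "j \<in> I" for j
      using S(3)[of "a j" t] t that by (auto simp: A_def)
    have V: "?g0 j \<in> V" "?g1 j \<in> V" "i (a j) \<in> V" "z - a j \<in> V" if "j \<in> I" for j
      using gseq_closed[OF a[OF that] c at[OF that]] i_closed[OF a[OF that]] a[OF that] z
      by (auto simp del: gseq.simps)
    \<comment> \<open>The difference of \<open>U_shift\<close> at \<open>t\<close> and at 0. Its
      right side depends on \<open>j\<close> only through \<open>i (a j)\<close>, additively and
      compatibly with scalars, so \<open>rel\<close> annihilates it after summation.\<close>
    have step: "t \<cdot> (U ?Z (?g1 j) - c - U (z - a j) (?g1 j)) = U z (i (a j)) - U ?Z (i (a j))"
      if "j \<in> I" for j
    proof -
      note Vj = V[OF that] and aj = a[OF that]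
      have g0: "?g0 j = i (a j) + t \<cdot> ?g1 j"
        using gseq_step[OF aj c at[OF that], of 0] by simp
      have "U ?Z (i (a j)) + t \<cdot> U ?Z (?g1 j) = U ?Z (?g0 j)"
        unfolding g0 using Vj Z by (simp add: U_add U_nmul_right del: gseq.simps)
      also have "\<dots> = z + z - a j + t \<cdot> c + U (z - a j) (?g0 j)"
        using U_shift[of "a j + t \<cdot> c" ?Z] aj c z at[OF that] by (simp add: algebra_simps)
      also have "\<dots> = t \<cdot> c + U z (i (a j)) + t \<cdot> U (z - a j) (?g1 j)"
        unfolding g0 using U_shift[of "a j" z] Vj Z aj z
        by (simp add: U_add U_nmul_right del: gseq.simps)
      finally show ?thesis
        by (simp add: nmul_diff nmul_add algebra_simps del: gseq.simps)
    qed
    have main: "(\<Sum>j\<in>I. T j (U ?Z (?g1 j))) = (\<Sum>j\<in>I. T j c) + (\<Sum>j\<in>I. T j (U (z - a j) (?g1 j)))"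
    proof (cases "I = {}")
      case False
      then have t0: "t > 0" using at by auto
      have W: "U ?Z (?g1 j) \<in> V" "U (z - a j) (?g1 j) \<in> V" "U z (i (a j)) \<in> V" "U ?Z (i (a j)) \<in> V"
        if "j \<in> I" for j
        using V[OF that] Z z by (auto simp del: gseq.simps)
      have "t \<cdot> (\<Sum>j\<in>I. T j (U ?Z (?g1 j) - c - U (z - a j) (?g1 j)))
          = (\<Sum>j\<in>I. T j (U z (i (a j)) - U ?Z (i (a j))))"
        unfolding nmul_sum
      proof (intro sum.cong refl)
        fix j assume j: "j \<in> I"
        show "t \<cdot> T j (U ?Z (?g1 j) - c - U (z - a j) (?g1 j)) = T j (U z (i (a j)) - U ?Z (i (a j)))"
          unfolding step[OF j, symmetric]
          by (rule endo_nmul[OF K_endo[OF T[OF j]], symmetric]) (use W[OF j] c in simp)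
      qed
      also have "\<dots> = (\<Sum>j\<in>I. T j (U z (i (a j)))) - (\<Sum>j\<in>I. T j (U ?Z (i (a j))))"
        unfolding sum_subtractf[symmetric]
        by (intro sum.cong refl endo_diff[OF K_endo[OF T]] W)
      also have "\<dots> = U z (\<Sum>j\<in>I. T j (i (a j))) - U ?Z (\<Sum>j\<in>I. T j (i (a j)))"
        by (intro arg_cong2[of _ _ _ _ minus] U_sum_K[OF z T V(3), symmetric] U_sum_K[OF Z T V(3), symmetric])
      also have "\<dots> = t \<cdot> 0"
        unfolding rel using endo_zero[OF U_endo] z Z by simp
      finally have "(\<Sum>j\<in>I. T j (U ?Z (?g1 j) - c - U (z - a j) (?g1 j))) = 0"
        by (rule nmul_cancel[OF _ V_zero t0, rotated]) (rule sum_K_closed[OF T], use W c in auto)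
      moreover have "(\<Sum>j\<in>I. T j (U ?Z (?g1 j) - c - U (z - a j) (?g1 j))) =
          (\<Sum>j\<in>I. T j (U ?Z (?g1 j)) - T j c - T j (U (z - a j) (?g1 j)))"
      proof (intro sum.cong refl)
        fix j assume j: "j \<in> I"
        show "T j (U ?Z (?g1 j) - c - U (z - a j) (?g1 j)) = T j (U ?Z (?g1 j)) - T j c - T j (U (z - a j) (?g1 j))"
          using W[OF j] c endo_diff[OF K_endo[OF T[OF j]]] by (simp del: gseq.simps)
      qed
      ultimately show ?thesis
        by (simp only: sum_subtractf) (simp add: algebra_simps del: gseq.simps)
    qed simp
    have P1q: "?P1 j t = q t (?g1 j)" if "j \<in> I" for j
      using S(5)[of "a j" t] t that by (simp add: q_def A_def del: gseq.simps)
    have qT: "T j (q t x) = q t (T j x)" if "j \<in> I" "x \<in> V" for j x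
      by (rule K_commute[OF T[OF that(1)] qK that(2)])
    have TV: "T j (U ?Z (?g1 j)) \<in> V" "T j (U (z - a j) (?g1 j)) \<in> V" if "j \<in> I" for j
      by (rule K_closed[OF T[OF that]], use V[OF that] Z in \<open>simp del: gseq.simps\<close>)+
    have "U ?Z (?p t) = (\<Sum>j\<in>I. T j (U ?Z (?P1 j t)))"
      by (rule U_sum_K[OF Z T]) (use P1 polyf_closed in auto)
    also have "\<dots> = (\<Sum>j\<in>I. q t (T j (U ?Z (?g1 j))))"
      by (intro sum.cong refl) (use V Z P1q qU qT in \<open>simp del: gseq.simps\<close>)
    also have "\<dots> = q t (\<Sum>j\<in>I. T j (U ?Z (?g1 j)))"
      by (rule endo_sum[OF K_endo[OF qK] TV(1), symmetric])
    also have "\<dots> = q t (\<Sum>j\<in>I. T j c) + q t (\<Sum>j\<in>I. T j (U (z - a j) (?g1 j)))"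
      unfolding main by (rule qadd[OF Tc sum_K_closed[OF T]]) (use V in \<open>auto simp del: gseq.simps\<close>)
    also have "q t (\<Sum>j\<in>I. T j (U (z - a j) (?g1 j))) = (\<Sum>j\<in>I. q t (T j (U (z - a j) (?g1 j))))"
      by (rule endo_sum[OF K_endo[OF qK] TV(2)])
    also have "\<dots> = (\<Sum>j\<in>I. T j (U (z - a j) (?P1 j t)))"
      by (intro sum.cong refl) (use V Z P1q qU qT in \<open>simp del: gseq.simps\<close>)
    finally show "U ?Z (?p t) = ?r t" .
  qed (fact P R p r)+
  \<comment> \<open>At 0 the numerator reduces to its first coefficient, here the derivative of the
    inverse at \<open>a j\<close> in direction \<open>c\<close>.\<close>
  have P10: "?P1 j 0 = - U (i (a j)) c" if "j \<in> I" for j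
  proof -
    have "n > 0" by (rule S(2)[of "a j"]) (use that in \<open>simp add: A_def\<close>)
    from numer_0[where w = "\<lambda>l. vseq (a j) c (Suc l)", OF S(1) this] show ?thesis by simp
  qed
  have V: "U (i (a j)) c \<in> V" if "j \<in> I" for j using i_closed[OF a[OF that]] c by simp
  have "(\<Sum>j\<in>I. T j (U (z - a j) (?P1 j 0))) = (\<Sum>j\<in>I. - T j (U (z - a j) (U (i (a j)) c)))"
    by (intro sum.cong refl)
      (use P10 V z a endo_minus[OF K_endo[OF T]] in \<open>simp add: U_uminus\<close>)
  moreover have "?p 0 = - (\<Sum>j\<in>I. T j (U (i (a j)) c))"
    unfolding sum_negf[symmetric]
    by (intro sum.cong refl) (use P10 V endo_minus[OF K_endo[OF T]] in simp)
  moreover have "(\<Sum>j\<in>I. T j (U (i (a j)) c)) \<in> V"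
    by (rule sum_K_closed[OF T V])
  ultimately show ?thesis
    using eq z by (simp add: q0 U_uminus sum_negf)
qed

section \<open>Linearity of the polarization\<close>

definition pol :: "'b \<Rightarrow> 'b \<Rightarrow> 'b \<Rightarrow> 'b" where
  "pol u w x = U (w + u) x - U w x - U u x"

lemma pol_sym: "pol u w x = pol w u x"
  by (simp add: pol_def add.commute)

lemma pol_closed [simp]: "\<lbrakk>u \<in> V; w \<in> V; x \<in> V\<rbrakk> \<Longrightarrow> pol u w x \<in> V"
  by (simp add: pol_def)

lemma pol_endo: "\<lbrakk>u \<in> V; w \<in> V\<rbrakk> \<Longrightarrow> endo (pol u w)"
  unfolding endo_def by (auto simp: pol_def U_add)

lemma pol_zero: "\<lbrakk>u \<in> V; x \<in> V\<rbrakk> \<Longrightarrow> pol u 0 x = 0" "\<lbrakk>u \<in> V; x \<in> V\<rbrakk> \<Longrightarrow> pol 0 u x = 0"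
  by (simp_all add: pol_def U_zero)

lemma pol_K_right: "\<lbrakk>u \<in> V; w \<in> V; T \<in> K; x \<in> V\<rbrakk> \<Longrightarrow> pol u w (T x) = T (pol u w x)"
  by (simp add: pol_def U_K[of _ T] endo_diff K_endo)

text \<open>\<open>limit_relation\<close> at the base points \<open>i (w j)\<close>, in direction
  \<open>x\<close>, with \<open>z = - i u\<close>. This \<open>z\<close> is chosen so that
  \<open>U_plus\<close> turns \<open>U (z - i (w j)) (U (w j) x)\<close> into
  \<open>U z (U (w j + u) x)\<close> and \<open>x\<close> equals \<open>U z (U u x)\<close>. Then
  \<open>U z\<close> can be cancelled.\<close>

lemma pol_relation_nonzero:
  assumes I: "finite I" and w: "\<And>j. j \<in> I \<Longrightarrow> w j \<in> V" "\<And>j. j \<in> I \<Longrightarrow> w j \<noteq> 0"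
    and T: "\<And>j. j \<in> I \<Longrightarrow> T j \<in> K" and rel: "(\<Sum>j\<in>I. T j (w j)) = 0"
    and u: "u \<in> V" "u \<noteq> 0" and x: "x \<in> V" "x \<noteq> 0"
  shows "(\<Sum>j\<in>I. T j (pol u (w j) x)) = 0"
proof -
  define z where "z = - i u"
  have z: "z \<in> V" "z \<noteq> 0" "i z = - u"
    unfolding z_def using u i_closed i_nonzero i_i i_minus by auto
  have iw: "i (w j) \<in> V" "i (w j) \<noteq> 0" "i (i (w j)) = w j" if "j \<in> I" for j
    using w[OF that] i_closed i_nonzero i_i by auto
  have Uz: "U (z - i (w j)) (U (w j) x) = U z (U (w j + u) x)" if "j \<in> I" for j
  proof -
    note iwj = iw[OF that] and wj = w[OF that]
    have "U (z + - i (w j)) (U (w j) x) = U z (U (i z + i (- i (w j))) (U (- i (w j)) (U (w j) x)))"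
      using z iwj wj x by (intro U_plus) auto
    also have "U (- i (w j)) (U (w j) x) = x"
      using iwj wj x by (simp add: U_minus U_inverse)
    also have "i z + i (- i (w j)) = - (w j + u)"
      using iwj z by (simp add: i_minus)
    also have "U (- (w j + u)) x = U (w j + u) x"
      using wj u x by (intro U_minus) auto
    finally show ?thesis by simp
  qed
  have xz: "U z (U u x) = x"
    using U_inverse'[of z x] z x u by (simp add: U_minus)
  have TV: "T j y \<in> V" if "j \<in> I" "y \<in> V" for j y using K_closed[OF T] that by blast
  have wu: "U (w j + u) x \<in> V" "U (w j) x \<in> V" if "j \<in> I" for j using w(1)[OF that] u x by auto
  have "(\<Sum>j\<in>I. T j x) - (\<Sum>j\<in>I. T j (U (z - i (w j)) (U (i (i (w j))) x)))
      = - U z (\<Sum>j\<in>I. T j (U (i (i (w j))) x))"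
    by (rule limit_relation[OF z(1) x I iw(1,2) T]) (use rel iw(3) in \<open>simp_all cong: sum.cong\<close>)
  then have "(\<Sum>j\<in>I. T j (U z (U u x))) - (\<Sum>j\<in>I. T j (U z (U (w j + u) x)))
      = - U z (\<Sum>j\<in>I. T j (U (w j) x))"
    using iw(3) Uz xz by (simp cong: sum.cong)
  moreover have "(\<Sum>j\<in>I. T j (U z (U u x))) = U z (\<Sum>j\<in>I. T j (U u x))"
    by (rule U_sum_K[OF z(1) T, symmetric]) (use u x in auto)
  moreover have "(\<Sum>j\<in>I. T j (U z (U (w j + u) x))) = U z (\<Sum>j\<in>I. T j (U (w j + u) x))"
    by (rule U_sum_K[OF z(1) T, symmetric]) (use wu in auto)
  ultimately have "U z (\<Sum>j\<in>I. T j (U (w j + u) x)) - U z (\<Sum>j\<in>I. T j (U (w j) x)) - U z (\<Sum>j\<in>I. T j (U u x)) = 0"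
    by (simp add: algebra_simps)
  moreover have "(\<Sum>j\<in>I. T j (U (w j + u) x)) \<in> V" "(\<Sum>j\<in>I. T j (U (w j) x)) \<in> V" "(\<Sum>j\<in>I. T j (U u x)) \<in> V"
    using TV wu u x by (auto intro!: V_sum)
  ultimately have "U z ((\<Sum>j\<in>I. T j (U (w j + u) x)) - (\<Sum>j\<in>I. T j (U (w j) x)) - (\<Sum>j\<in>I. T j (U u x))) = 0"
      "(\<Sum>j\<in>I. T j (U (w j + u) x)) - (\<Sum>j\<in>I. T j (U (w j) x)) - (\<Sum>j\<in>I. T j (U u x)) \<in> V"
    using z by (simp_all add: U_diff)
  then have "(\<Sum>j\<in>I. T j (U (w j + u) x)) - (\<Sum>j\<in>I. T j (U (w j) x)) - (\<Sum>j\<in>I. T j (U u x)) = 0"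
    using U_nonzero z by blast
  moreover have "T j (pol u (w j) x) = T j (U (w j + u) x) - T j (U (w j) x) - T j (U u x)" if "j \<in> I" for j
    unfolding pol_def using endo_diff[OF K_endo[OF T[OF that]]] wu[OF that] u x by simp
  ultimately show ?thesis by (simp add: sum_subtractf)
qed

text \<open>Preserving linear relations covers additivity and scalars in one statement; vanishing
  \<open>w j\<close> are dropped since they have no inverse.\<close>

lemma pol_relation:
  assumes I: "finite I" and w: "\<And>j. j \<in> I \<Longrightarrow> w j \<in> V" and T: "\<And>j. j \<in> I \<Longrightarrow> T j \<in> K"
    and rel: "(\<Sum>j\<in>I. T j (w j)) = 0" and u: "u \<in> V" and x: "x \<in> V"
  shows "(\<Sum>j\<in>I. T j (pol u (w j) x)) = 0"
proof (cases "u = 0 \<or> x = 0")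
  case True
  have "pol u (w j) x = 0" if "j \<in> I" for j
    using True pol_zero w[OF that] endo_zero[OF pol_endo] u x by auto
  then show ?thesis using endo_zero[OF K_endo[OF T]] by simp
next
  case False
  let ?I = "{j\<in>I. w j \<noteq> 0}"
  have "(\<Sum>j\<in>I. T j (pol u (w j) x)) = (\<Sum>j\<in>?I. T j (pol u (w j) x))"
    using I T u x endo_zero[OF K_endo[OF T]] by (intro sum.mono_neutral_right) (auto simp: pol_zero)
  also have "\<dots> = 0"
  proof (rule pol_relation_nonzero)
    have "(\<Sum>j\<in>?I. T j (w j)) = (\<Sum>j\<in>I. T j (w j))"
      using I endo_zero[OF K_endo[OF T]] by (intro sum.mono_neutral_left) auto
    then show "(\<Sum>j\<in>?I. T j (w j)) = 0" using rel by simp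
  qed (use I w T u x False in auto)
  finally show ?thesis .
qed

lemma pol_add:
  assumes "u \<in> V" "v \<in> V" "w \<in> V" "x \<in> V"
  shows "pol u (v + w) x = pol u v x + pol u w x"
proof -
  \<comment> \<open>The coefficients of the relation \<open>v + w - (v + w) = 0\<close>.\<close>
  define T :: "nat \<Rightarrow> 'b \<Rightarrow> 'b" where "T j = (if j = 2 then (\<lambda>x. - x) else (\<lambda>x. x))" for j
  define y where "y j = (if j = 0 then v else if j = 1 then w else v + w)" for j :: nat
  have "(\<Sum>j\<in>{0,1,2}. T j (pol u (y j) x)) = 0"
    by (rule pol_relation) (use assms K_id K_minus[OF K_id] in \<open>auto simp: T_def y_def\<close>)
  then have "pol u v x + (pol u w x - pol u (v + w) x) = 0" by (simp add: T_def y_def)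
  then show ?thesis by (metis add_diff_eq eq_iff_diff_eq_0)
qed

lemma pol_K:
  assumes "u \<in> V" "w \<in> V" "x \<in> V" "T \<in> K"
  shows "pol u (T w) x = T (pol u w x)"
proof -
  define S :: "nat \<Rightarrow> 'b \<Rightarrow> 'b" where "S j = (if j = 0 then T else (\<lambda>x. - x))" for j
  define y where "y j = (if j = 0 then w else T w)" for j :: nat
  have "(\<Sum>j\<in>{0,1}. S j (pol u (y j) x)) = 0"
    by (rule pol_relation) (use assms K_minus[OF K_id] K_closed in \<open>auto simp: S_def y_def\<close>)
  then show ?thesis by (simp add: S_def y_def)
qed

lemma pol_nmul:
  assumes "u \<in> V" "w \<in> V" "x \<in> V"
  shows "pol u (n \<cdot> w) x = n \<cdot> pol u w x"
  by (induction n) (use assms in \<open>auto simp: pol_zero pol_add\<close>)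

section \<open>The Jordan identity between \<open>U\<close> and its polarization\<close>

lemma pol_inverse_self:
  assumes "a \<in> V" "a \<noteq> 0" "b \<in> V"
  shows "pol b a (i a) = b + b"
  using U_shift[of a "a + b"] assms by (simp add: pol_def U_i)

text \<open>The derivative of \<open>pol_inverse_self\<close> in direction \<open>c\<close>: along
  \<open>a + t \<cdot> c\<close> the value
  \<open>pol b (a + t \<cdot> c) (i (a + t \<cdot> c))\<close> stays \<open>b + b\<close>, and the
  derivative of the inverse is \<open>- U (i a) c\<close>.\<close>

lemma pol_U_inverse:
  assumes a: "a \<in> V" "a \<noteq> 0" and b: "b \<in> V" and c: "c \<in> V"
  shows "pol b a (U (i a) c) = pol b c (i a)"
proof (cases "c = 0")
  case True
  then show ?thesis
    using a b i_closed[OF a] endo_zero[OF U_endo] endo_zero[OF pol_endo] by (simp add: pol_zero)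
next
  case False
  have A: "finite {a}" "{a} \<subseteq> V - {0}" using a by auto
  obtain n :: nat and S N where "\<And>j. j < n \<Longrightarrow> S j \<in> K" "\<And>x. x \<in> {a} \<Longrightarrow> n > 0"
    "\<And>x t. x \<in> {a} \<Longrightarrow> t \<ge> N \<Longrightarrow> t > 0 \<and> x + t \<cdot> c \<noteq> 0"
    "\<And>x t. x \<in> {a} \<Longrightarrow> t \<ge> N \<Longrightarrow> denom n S t (gseq x c t 0) = numer n S (vseq x c) t"
    "\<And>x t. x \<in> {a} \<Longrightarrow> t \<ge> N \<Longrightarrow> denom n S t (gseq x c t 1) = numer n S (\<lambda>j. vseq x c (Suc j)) t"
    by (rule common_denominator[OF A c False]) (rule that)
  note S = this(1) this(2,3,5)[OF singletonI]
  let ?v = "i a" and ?P = "numer n S (\<lambda>j. vseq a c (Suc j))"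
  have v: "?v \<in> V" by (rule i_closed[OF a])
  have P: "polyf n ?P" by (rule polyf_numer[OF S(1)]) (use a c in auto)
  have "pol b a (?P 0) + 0 ^ 1 \<cdot> pol b c (?P 0) = - denom n S 0 (pol b c ?v)"
  proof (rule polyf_eq_at_0)
    show "polyf (n + 1) (\<lambda>t. pol b a (?P t) + t ^ 1 \<cdot> pol b c (?P t))"
      by (rule polyf_add[OF polyf_mono[OF polyf_endo[OF P pol_endo]]
            polyf_nmul[OF polyf_endo[OF P pol_endo]]]) (use a b c in auto)
    show "polyf (1 + n) (\<lambda>t. - denom n S t (pol b c ?v))"
      by (rule polyf_minus[OF polyf_denom[OF S(1) polyf_const]]) (use b c v in auto)
    fix t assume t: "t \<ge> N"
    then have t': "t > 0" "a + t \<cdot> c \<noteq> 0" using S(3) by auto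
    let ?A = "a + t \<cdot> c" and ?g = "gseq a c t (Suc 0)"
    have A: "?A \<in> V" using a c by simp
    have g: "?g \<in> V" by (rule gseq_closed[OF a c False t'])
    have g0: "i ?A = ?v + t \<cdot> ?g" using gseq_step[OF a c False t', of 0] by simp
    have lin: "pol b ?A x = pol b a x + t \<cdot> pol b c x" if "x \<in> V" for x
      using that a b c by (simp add: pol_add pol_nmul)
    have "b + b = pol b ?A (i ?A)" using pol_inverse_self A t' b by simp
    also have "\<dots> = pol b ?A ?v + t \<cdot> pol b ?A ?g"
      unfolding g0 using endo_add[OF pol_endo] endo_nmul[OF pol_endo] A b v g by simp
    also have "pol b ?A ?v = b + b + t \<cdot> pol b c ?v"
      using lin[OF v] pol_inverse_self a b by simp
    finally have "t \<cdot> pol b ?A ?g = t \<cdot> (- pol b c ?v)"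
      by (simp add: nmul_minus add_eq_0_iff add.assoc del: gseq.simps)
    then have "pol b ?A ?g = - pol b c ?v"
      by (rule nmul_cancel[rotated 3]) (use A g b c v t' in auto)
    then have "denom n S t (pol b ?A ?g) = - denom n S t (pol b c ?v)"
      using endo_minus[OF K_endo[OF denom_K[OF S(1)]]] b c v by simp
    moreover have "denom n S t (pol b ?A ?g) = pol b ?A (?P t)"
    proof -
      have "denom n S t \<in> K" by (rule denom_K[OF S(1)])
      from pol_K_right[OF b A this g] show ?thesis using S(4)[OF t] by simp
    qed
    ultimately show "pol b a (?P t) + t ^ 1 \<cdot> pol b c (?P t) = - denom n S t (pol b c ?v)"
      using lin[OF polyf_closed[OF P]] by simp
  qed
  then have "pol b a (- U (i a) c) = - pol b c ?v"
    using numer_0[OF S(1,2)] denom_0[OF S(1)] by simp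
  then show ?thesis
    using endo_minus[OF pol_endo] a b c v by simp
qed

text \<open>Expand the middle factor in \<open>U_plus\<close>: its terms \<open>U (i a)\<close> and
  \<open>U (i b)\<close> contribute \<open>U b x\<close> and \<open>U a x\<close>.\<close>

lemma pol_inverses:
  assumes "a \<in> V" "a \<noteq> 0" "b \<in> V" "b \<noteq> 0" "x \<in> V"
  shows "pol b a x = U a (pol (i b) (i a) (U b x))"
  using assms U_plus[of a b x]
  by (simp add: pol_def i_closed U_diff U_inverse U_inverse' add.commute)

text \<open>This is the axiom \<open>Q_a V_{a,b} = V_{b,a} Q_a\<close>. \<open>pol_U_inverse\<close>
  is used at \<open>i a\<close> and at \<open>i b\<close>, and \<open>pol_inverses\<close> joins the
  two.\<close>

lemma pol_U:
  assumes a: "a \<in> V" and b: "b \<in> V" and c: "c \<in> V"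
  shows "pol a (U a c) b = U a (pol b c a)"
proof -
  consider "a = 0" | "b = 0" | "a \<noteq> 0" "b \<noteq> 0" by blast
  then show ?thesis
  proof cases
    case 1
    then show ?thesis using b c by (simp add: U_zero pol_zero)
  next
    case 2
    then show ?thesis
      using a c endo_zero[OF pol_endo] endo_zero[OF U_endo] by (simp add: pol_zero)
  next
    case 3
    have ia: "i a \<in> V" "i a \<noteq> 0" "i (i a) = a" and ib: "i b \<in> V" "i b \<noteq> 0" "i (i b) = b"
      using i_closed i_nonzero i_i a b 3 by auto
    have "U a (pol b c a) = U a (pol b (i a) (U a c))"
      using pol_U_inverse[OF ia(1,2) b c] ia(3) by simp
    also have "\<dots> = pol (i b) a (U b (U a c))"
      using pol_inverses[of a "i b" "U b (U a c)"] a b c ib 3 by (simp add: U_inverse)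
    also have "\<dots> = pol a (U a c) b"
      using pol_U_inverse[of "i b" a "U a c"] a c ib by (simp add: pol_sym[of "i b"])
    finally show ?thesis by simp
  qed
qed

end

section \<open>Special Moufang sets with abelian root groups\<close>

locale special_moufang = comm_group G for G :: "('a, 'm) monoid_scheme" (structure) +
  fixes \<tau> :: "'a option \<Rightarrow> 'a option" and e :: 'a
  assumes swaps: "swaps_zero_infinity G \<tau>"
    and moufang: "moufang_set (points G) (root_group G \<tau>)"
    and e_nonzero: "e \<in> nonzero G"
    and tau_mu: "\<tau> = mu G \<tau> e"
    and special: "special G \<tau>"
begin

abbreviation X :: "'a option set" where "X \<equiv> points G"
abbreviation R :: "'a option \<Rightarrow> ('a option \<Rightarrow> 'a option) set" where "R \<equiv> root_group G \<tau>"
abbreviation A :: "'a \<Rightarrow> 'a option \<Rightarrow> 'a option" where "A \<equiv> alpha G"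
abbreviation M :: "'a \<Rightarrow> 'a option \<Rightarrow> 'a option" where "M \<equiv> mu G \<tau>"
abbreviation ti :: "'a option \<Rightarrow> 'a option" where "ti \<equiv> inv_into X \<tau>"

section \<open>Translations, \<open>\<tau>\<close> and the \<open>\<mu>\<close>-maps\<close>

lemma points_cases: "x \<in> X \<Longrightarrow> (x = None \<Longrightarrow> P) \<Longrightarrow> (\<And>u. u \<in> carrier G \<Longrightarrow> x = Some u \<Longrightarrow> P) \<Longrightarrow> P"
  by (auto simp: points_def)

lemma in_points [simp]: "None \<in> X" "Some u \<in> X \<longleftrightarrow> u \<in> carrier G"
  by (auto simp: points_def)

lemma mult_inv_eq_one: assumes "u \<in> carrier G" "v \<in> carrier G" "u \<otimes> inv v = \<one>" shows "u = v"
proof -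
  have "u = (u \<otimes> inv v) \<otimes> v" using assms(1,2) by (simp add: m_assoc)
  also have "\<dots> = v" using assms(2) unfolding assms(3) by simp
  finally show ?thesis .
qed

lemma points_the: "x \<in> X \<Longrightarrow> x \<noteq> None \<Longrightarrow> the x \<in> carrier G \<and> x = Some (the x)"
  by (auto simp: points_def)

lemma alpha_None [simp]: "A a None = None"
  by (simp add: alpha_def)

lemma alpha_Some [simp]: "u \<in> carrier G \<Longrightarrow> A a (Some u) = Some (u \<otimes> a)"
  by (simp add: alpha_def)

lemma alpha_closed [simp]: "a \<in> carrier G \<Longrightarrow> x \<in> X \<Longrightarrow> A a x \<in> X"
  by (erule points_cases) auto

lemma alpha_alpha: "a \<in> carrier G \<Longrightarrow> b \<in> carrier G \<Longrightarrow> x \<in> X \<Longrightarrow> A a (A b x) = A (b \<otimes> a) x"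
  by (erule points_cases) (auto simp: m_assoc)

lemma alpha_one [simp]: "x \<in> X \<Longrightarrow> A \<one> x = x"
  by (erule points_cases) auto

lemma alpha_inv [simp]:
  "a \<in> carrier G \<Longrightarrow> x \<in> X \<Longrightarrow> A (inv a) (A a x) = x"
  "a \<in> carrier G \<Longrightarrow> x \<in> X \<Longrightarrow> A a (A (inv a) x) = x"
  by (simp_all add: alpha_alpha)

lemma bij_alpha: "a \<in> carrier G \<Longrightarrow> bij_betw (A a) X X"
  by (rule bij_betwI[where g = "A (inv a)"]) auto

lemma bij_tau: "bij_betw \<tau> X X"
  using swaps by (simp add: swaps_zero_infinity_def BijGroup_def Bij_def)

lemma tau_None [simp]: "\<tau> None = Some \<one>" and tau_one [simp]: "\<tau> (Some \<one>) = None"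
  using swaps by (simp_all add: swaps_zero_infinity_def)

lemma tau_closed [simp]: "x \<in> X \<Longrightarrow> \<tau> x \<in> X"
  using bij_tau bij_betwE by blast

lemma ti_closed [simp]: "x \<in> X \<Longrightarrow> ti x \<in> X"
  using bij_tau bij_betw_inv_into bij_betwE by blast

lemma ti_tau [simp]: "x \<in> X \<Longrightarrow> ti (\<tau> x) = x"
  using bij_tau bij_betw_inv_into_left by metis

lemma tau_ti [simp]: "x \<in> X \<Longrightarrow> \<tau> (ti x) = x"
  using bij_tau bij_betw_inv_into_right by metis

lemma ti_None [simp]: "ti None = Some \<one>" and ti_one [simp]: "ti (Some \<one>) = None"
  using ti_tau[of "Some \<one>"] ti_tau[of None] by auto

lemma nonzero_iff: "a \<in> nonzero G \<longleftrightarrow> a \<in> carrier G \<and> a \<noteq> \<one>"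
  by (auto simp: nonzero_def)

lemma nonzeroI: "a \<in> carrier G \<Longrightarrow> a \<noteq> \<one> \<Longrightarrow> a \<in> nonzero G"
  by (simp add: nonzero_iff)

lemma nonzero_inv: "a \<in> nonzero G \<Longrightarrow> inv a \<in> nonzero G"
  by (simp add: nonzero_iff inv_eq_1_iff)

lemma tau_Some: assumes "a \<in> nonzero G" shows "\<tau> (Some a) = Some (val \<tau> a)" "val \<tau> a \<in> nonzero G"
proof -
  have a: "Some a \<in> X" "a \<noteq> \<one>" using assms by (auto simp: nonzero_iff)
  have "\<tau> (Some a) \<noteq> None" "\<tau> (Some a) \<noteq> Some \<one>"
    using ti_tau[OF a(1)] ti_None ti_one a(2) by (metis option.inject, metis option.distinct(1))
  moreover have "\<tau> (Some a) \<in> X" using a by simp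
  ultimately show "\<tau> (Some a) = Some (val \<tau> a)" "val \<tau> a \<in> nonzero G"
    unfolding val_def nonzero_iff by (auto simp: points_def)
qed

lemma ti_Some: assumes "a \<in> nonzero G" shows "ti (Some a) = Some (val ti a)" "val ti a \<in> nonzero G"
proof -
  have a: "Some a \<in> X" "a \<noteq> \<one>" using assms by (auto simp: nonzero_iff)
  have "ti (Some a) \<noteq> None" "ti (Some a) \<noteq> Some \<one>"
    using tau_ti[OF a(1)] tau_None tau_one a(2) by (metis option.inject, metis option.distinct(1))
  moreover have "ti (Some a) \<in> X" using a by simp
  ultimately show "ti (Some a) = Some (val ti a)" "val ti a \<in> nonzero G"
    unfolding val_def nonzero_iff by (auto simp: points_def)
qed

lemma val_tau_ti: "a \<in> nonzero G \<Longrightarrow> val \<tau> (val ti a) = a"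
  using ti_Some[of a] tau_ti[of "Some a"] by (simp add: val_def nonzero_iff)

lemma val_ti_tau: "a \<in> nonzero G \<Longrightarrow> val ti (val \<tau> a) = a"
  using tau_Some[of a] ti_tau[of "Some a"] by (simp add: val_def nonzero_iff)

lemma val_tau_inv: "a \<in> nonzero G \<Longrightarrow> val \<tau> (inv a) = inv (val \<tau> a)"
  using special by (simp add: special_def)

lemma val_ti_inv: assumes "a \<in> nonzero G" shows "val ti (inv a) = inv (val ti a)"
proof -
  have "val \<tau> (inv (val ti a)) = inv a"
    using val_tau_inv val_tau_ti ti_Some assms by simp
  then show ?thesis
    using val_ti_tau[of "inv (val ti a)"] nonzero_inv ti_Some assms by simp
qed

text \<open>
  By speciality the last factor of \<open>\<mu>\<^sub>a\<close> is \<open>\<alpha>\<^sub>a\<close>.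
\<close>

lemma mu_apply:
  assumes "a \<in> nonzero G" "x \<in> X"
  shows "M a x = A a (\<tau> (A (inv (val ti a)) (ti (A a x))))"
proof -
  have "inv (val \<tau> (inv (val ti a))) = a"
    using assms val_tau_inv val_tau_ti ti_Some by (simp add: nonzero_iff)
  then show ?thesis
    using assms by (simp add: mu_def Let_def rcomp_def compose_def conj_map_def nonzero_iff)
qed

lemma mu_closed [simp]: "a \<in> nonzero G \<Longrightarrow> x \<in> X \<Longrightarrow> M a x \<in> X"
  using ti_Some[of a] by (simp add: mu_apply nonzero_iff)

text \<open>The factors of \<open>M a\<close> form a palindrome, and by speciality replacing
  \<open>a\<close> by its inverse inverts each of them.\<close>

lemma mu_inv_mu: assumes "a \<in> nonzero G" "x \<in> X" shows "M (inv a) (M a x) = x"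
  using assms nonzero_inv[OF assms(1)] ti_Some[OF assms(1)]
  by (simp add: mu_apply val_ti_inv nonzero_iff)

lemma mu_one [simp]: assumes "a \<in> nonzero G" shows "M a (Some \<one>) = None"
  using assms ti_Some[OF assms] by (simp add: mu_apply nonzero_iff)

lemma mu_None [simp]: assumes "a \<in> nonzero G" shows "M a None = Some \<one>"
proof -
  have b: "inv (val ti a) \<in> nonzero G" using ti_Some nonzero_inv assms by blast
  have "\<tau> (Some (inv (val ti a))) = Some (inv a)"
    using tau_Some[OF b] val_tau_inv val_tau_ti ti_Some assms by simp
  then show ?thesis
    using assms b by (simp add: mu_apply nonzero_iff)
qed

text \<open>Conjugation by \<open>g\<close> maps root groups into root groups. The intertwining
  form, read on \<open>X\<close> only, passes to composites written as plain functions, which are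
  not extensional.\<close>

definition good :: "('a option \<Rightarrow> 'a option) \<Rightarrow> bool" where
  "good g \<longleftrightarrow> bij_betw g X X \<and> (\<forall>x\<in>X. \<forall>u\<in>R x. \<exists>v\<in>R (g x). \<forall>y\<in>X. g (u y) = v (g y))"

lemma goodD: "good g \<Longrightarrow> x \<in> X \<Longrightarrow> u \<in> R x \<Longrightarrow> \<exists>v\<in>R (g x). \<forall>y\<in>X. g (u y) = v (g y)"
  unfolding good_def by blast

lemma root_group_closed: "x \<in> X \<Longrightarrow> u \<in> R x \<Longrightarrow> y \<in> X \<Longrightarrow> u y \<in> X"
proof -
  assume x: "x \<in> X" "u \<in> R x" "y \<in> X"
  have "subgroup (R x) (BijGroup X)" using moufang x by (simp add: moufang_set_def)
  then have "u \<in> Bij X" using subgroup.mem_carrier x by (fastforce simp: BijGroup_def)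
  then show ?thesis using x by (auto simp: Bij_def dest: bij_betwE)
qed

lemma good_root: assumes "y \<in> X" "g \<in> R y" shows "good g"
proof -
  have "subgroup (R y) (BijGroup X)" using moufang assms by (simp add: moufang_set_def)
  then have "g \<in> Bij X" using subgroup.mem_carrier assms by (fastforce simp: BijGroup_def)
  then have bij: "bij_betw g X X" by (simp add: Bij_def)
  moreover have "\<exists>v\<in>R (g x). \<forall>z\<in>X. g (u z) = v (g z)" if "x \<in> X" "u \<in> R x" for x u
  proof
    show "conj_map X X g u \<in> R (g x)"
      using moufang assms that unfolding moufang_set_def by blast
    show "\<forall>z\<in>X. g (u z) = conj_map X X g u (g z)"
      using bij_betw_inv_into_left[OF bij] bij_betwE[OF bij] by (simp add: conj_map_def)
  qed
  ultimately show ?thesis unfolding good_def by blast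
qed

lemma good_comp: assumes "good f" "good g" shows "good (\<lambda>x. g (f x))"
proof -
  have "bij_betw (\<lambda>x. g (f x)) X X"
    using assms bij_betw_trans unfolding good_def comp_def by blast
  moreover have "\<exists>w\<in>R (g (f x)). \<forall>y\<in>X. g (f (u y)) = w (g (f y))" if x: "x \<in> X" "u \<in> R x" for x u
  proof -
    obtain v where v: "v \<in> R (f x)" "\<forall>y\<in>X. f (u y) = v (f y)" using assms(1) x unfolding good_def by blast
    have fX: "f y \<in> X" if "y \<in> X" for y using assms(1) that bij_betwE unfolding good_def by blast
    then obtain w where w: "w \<in> R (g (f x))" "\<forall>y\<in>X. g (v y) = w (g y)"
      using assms(2) v(1) x unfolding good_def by blast
    then show ?thesis using v fX by auto
  qed
  ultimately show ?thesis unfolding good_def by blast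
qed

lemma good_cong: assumes "\<And>x. x \<in> X \<Longrightarrow> f x = g x" "good g" shows "good f"
proof -
  have "bij_betw f X X" using assms bij_betw_cong[of X f g X] unfolding good_def by blast
  moreover have "\<exists>v\<in>R (f x). \<forall>y\<in>X. f (u y) = v (f y)" if "x \<in> X" "u \<in> R x" for x u
    using assms that root_group_closed[OF that] unfolding good_def by metis
  ultimately show ?thesis unfolding good_def by blast
qed

lemma root_infinity_iff: "u \<in> R None \<longleftrightarrow> (\<exists>a\<in>carrier G. u = A a)"
  by (auto simp: root_group_def root_infinity_def)

lemma root_zero_apply: assumes "u \<in> R (Some \<one>)" shows "\<exists>d\<in>carrier G. \<forall>y\<in>X. u y = \<tau> (A d (ti y))"
proof -
  from assms obtain d where d: "d \<in> carrier G" "u = conj_map X X (A \<one>) (conj_map X X \<tau> (A d))"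
    by (auto simp: root_group_def root_infinity_def root_zero_def)
  have "inv_into X (A \<one>) y = y" if "y \<in> X" for y
    using bij_betw_inv_into_left[OF bij_alpha[OF one_closed] that] that by simp
  then show ?thesis using d by (intro bexI[of _ d]) (auto simp: conj_map_def)
qed

lemma good_tau_alpha: assumes "d \<in> carrier G" shows "good (\<lambda>y. \<tau> (A d (ti y)))"
proof (rule good_cong)
  have "inv_into X (A \<one>) y = y" if "y \<in> X" for y
    using bij_betw_inv_into_left[OF bij_alpha[OF one_closed] that] that by simp
  then show "\<tau> (A d (ti y)) = conj_map X X (A \<one>) (conj_map X X \<tau> (A d)) y" if "y \<in> X" for y
    using that assms by (simp add: conj_map_def)
  show "good (conj_map X X (A \<one>) (conj_map X X \<tau> (A d)))"
    by (rule good_root[of "Some \<one>"]) (auto simp: root_group_def root_infinity_def root_zero_def assms)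
qed

lemma good_alpha: "a \<in> carrier G \<Longrightarrow> good (A a)"
  by (rule good_root[of None]) (auto simp: root_infinity_iff)

lemma good_mu: assumes "a \<in> nonzero G" shows "good (M a)"
proof (rule good_cong)
  have a: "a \<in> carrier G" "inv (val ti a) \<in> carrier G" using assms ti_Some[OF assms] by (auto simp: nonzero_iff)
  show "M a x = A a (\<tau> (A (inv (val ti a)) (ti (A a x))))" if "x \<in> X" for x
    by (rule mu_apply[OF assms that])
  show "good (\<lambda>x. A a (\<tau> (A (inv (val ti a)) (ti (A a x)))))"
    by (rule good_comp[OF good_comp[OF good_alpha[OF a(1)] good_tau_alpha[OF a(2)]] good_alpha[OF a(1)]])
qed

text \<open>Fixing \<open>0\<close> and normalizing the root group of \<open>\<infinity>\<close> means acting as an automorphism of the group.\<close>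

definition automorphic :: "('a option \<Rightarrow> 'a option) \<Rightarrow> bool" where
  "automorphic g \<longleftrightarrow> bij_betw g X X \<and> g None = None \<and>
     (\<forall>u\<in>carrier G. val g u \<in> carrier G \<and> g (Some u) = Some (val g u)) \<and>
     (\<forall>u\<in>carrier G. \<forall>v\<in>carrier G. val g (u \<otimes> v) = val g u \<otimes> val g v)"

lemma automorphic_good:
  assumes "good g" "g None = None" "g (Some \<one>) = Some \<one>"
  shows "automorphic g"
proof -
  have bij: "bij_betw g X X" using assms(1) unfolding good_def by blast
  have gX: "g x \<in> X" if "x \<in> X" for x using bij bij_betwE that by blast
  have fin: "val g u \<in> carrier G \<and> g (Some u) = Some (val g u)" if u: "u \<in> carrier G" for u
  proof -
    have "g (Some u) \<noteq> None"
      using bij_betw_imp_inj_on[OF bij] inj_onD assms(2) u in_points by (metis option.distinct(1))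
    then show ?thesis using gX[of "Some u"] u by (auto simp: val_def points_def)
  qed
  have "val g (u \<otimes> v) = val g u \<otimes> val g v" if u: "u \<in> carrier G" and v: "v \<in> carrier G" for u v
  proof -
    have "A v \<in> R None" using v by (auto simp: root_infinity_iff)
    then obtain w where w: "w \<in> carrier G" "\<forall>y\<in>X. g (A v y) = A w (g y)"
      using assms(1,2) root_infinity_iff unfolding good_def by (metis in_points(1))
    \<comment> \<open>A translation is determined by the image of 0, which \<open>g\<close>
      fixes.\<close>
    have "w = val g v" using w assms(3) v fin[OF v] bspec[OF w(2), of "Some \<one>"] by simp
    then show ?thesis using bspec[OF w(2), of "Some u"] u v fin[OF u] fin[of "u \<otimes> v"] by simp
  qed
  then show ?thesis unfolding automorphic_def using bij assms(2) fin by blast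
qed

lemma automorphic_mu_mu:
  assumes "a \<in> nonzero G" "b \<in> nonzero G" shows "automorphic (rcomp X (M a) (M b))"
proof (rule automorphic_good)
  show "good (rcomp X (M a) (M b))"
    by (rule good_cong[OF _ good_comp[OF good_mu[OF assms(1)] good_mu[OF assms(2)]]])
      (simp add: rcomp_def compose_def)
qed (use assms in \<open>simp_all add: rcomp_def compose_def\<close>)

lemma rcomp_mu_Bij:
  assumes "a \<in> nonzero G" "b \<in> nonzero G" shows "rcomp X (M a) (M b) \<in> Bij X"
  using automorphic_mu_mu[OF assms] unfolding automorphic_def Bij_def rcomp_def by simp

lemma automorphic_comp:
  assumes "automorphic f" "automorphic g" shows "automorphic (compose X g f)"
proof -
  have "bij_betw (compose X g f) X X"
    using assms bij_betw_compose unfolding automorphic_def by blast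
  moreover have "val (compose X g f) u = val g (val f u)" if "u \<in> carrier G" for u
    using that assms by (auto simp: val_def compose_def automorphic_def)
  ultimately show ?thesis using assms unfolding automorphic_def by (auto simp: compose_def)
qed

lemma automorphic_inv:
  assumes "automorphic g" shows "automorphic (restrict (inv_into X g) X)"
proof -
  let ?g' = "restrict (inv_into X g) X"
  have bij: "bij_betw g X X" using assms by (simp add: automorphic_def)
  have bij': "bij_betw ?g' X X"
    using bij_betw_inv_into[OF bij] bij_betw_cong[of X ?g' "inv_into X g" X] by simp
  have left: "?g' (g x) = x" if "x \<in> X" for x
    using bij_betw_inv_into_left[OF bij that] bij_betwE[OF bij] that by simp
  have right: "g (?g' x) = x" if "x \<in> X" for x
    using bij_betw_inv_into_right[OF bij that] that by simp
  have None: "?g' None = None" using left[of None] assms by (simp add: automorphic_def)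
  have fin: "val ?g' u \<in> carrier G \<and> ?g' (Some u) = Some (val ?g' u)" if u: "u \<in> carrier G" for u
  proof -
    have "?g' (Some u) \<noteq> None"
      using right[of "Some u"] u assms unfolding automorphic_def by (metis in_points(2) option.distinct(1))
    moreover have "?g' (Some u) \<in> X" using bij_betwE[OF bij'] u in_points(2) by blast
    ultimately show ?thesis using points_the unfolding val_def by blast
  qed
  have gv: "val g (val ?g' u) = u" if u: "u \<in> carrier G" for u
    using right[of "Some u"] fin[OF u] u by (simp add: val_def)
  have vg: "val ?g' (val g u) = u" if u: "u \<in> carrier G" for u
    using left[of "Some u"] u assms by (simp add: val_def automorphic_def)
  have "val ?g' (u \<otimes> v) = val ?g' u \<otimes> val ?g' v" if u: "u \<in> carrier G" and v: "v \<in> carrier G" for u v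
  proof -
    have "u \<otimes> v = val g (val ?g' u \<otimes> val ?g' v)"
      using assms fin[OF u] fin[OF v] gv u v by (simp add: automorphic_def)
    then show ?thesis using vg[of "val ?g' u \<otimes> val ?g' v"] fin[OF u] fin[OF v] by simp
  qed
  then show ?thesis unfolding automorphic_def using bij' None fin by blast
qed

lemma hua_subgroup_automorphic:
  assumes "g \<in> hua_subgroup G \<tau>" shows "automorphic g \<and> g \<in> Bij X"
  using assms unfolding hua_subgroup_def
proof (induction g rule: generate.induct)
  case one
  have "automorphic (\<lambda>x\<in>X. x)"
    unfolding automorphic_def by (auto simp: val_def intro: bij_betwI[of _ _ _ "\<lambda>x\<in>X. x"])
  moreover have "(\<lambda>x\<in>X. x) \<in> Bij X" by (rule id_Bij)
  moreover have "\<one>\<^bsub>BijGroup X\<^esub> = (\<lambda>x\<in>X. x)" by (simp add: BijGroup_def)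
  ultimately show ?case by metis
next
  case (incl h)
  then show ?case using automorphic_mu_mu rcomp_mu_Bij by blast
next
  case (inv h)
  then have h: "automorphic h" "h \<in> Bij X" using automorphic_mu_mu rcomp_mu_Bij by blast+
  have "inv\<^bsub>BijGroup X\<^esub> h = restrict (inv_into X h) X" by (rule inv_BijGroup[OF h(2)])
  then show ?case using automorphic_inv[OF h(1)] restrict_inv_into_Bij[OF h(2)] by metis
next
  case (eng g h)
  then have "mult (BijGroup X) g h = compose X g h" by (simp add: BijGroup_def)
  then show ?case using automorphic_comp eng compose_Bij by metis
qed

lemma hua_subgroup_hom:
  assumes "g \<in> hua_subgroup G \<tau>" "u \<in> carrier G" "v \<in> carrier G"
  shows "val g u \<in> carrier G" "val g (u \<otimes> v) = val g u \<otimes> val g v"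
  using hua_subgroup_automorphic[OF assms(1)] assms(2,3) by (auto simp: automorphic_def)

text \<open>The normalization \<open>\<tau> = M e\<close> makes every Hua map a generator of the Hua
  subgroup.\<close>

lemma tau_mu_in_hua_subgroup: "a \<in> nonzero G \<Longrightarrow> rcomp X \<tau> (M a) \<in> hua_subgroup G \<tau>"
proof -
  assume "a \<in> nonzero G"
  then have "rcomp X (M e) (M a) \<in> hua_subgroup G \<tau>"
    unfolding hua_subgroup_def using e_nonzero by (intro generate.incl) blast
  then show ?thesis by (simp flip: tau_mu)
qed

section \<open>Hua maps as endomorphisms of the group\<close>

lemma hua_eq_val: "a \<in> nonzero G \<Longrightarrow> u \<in> carrier G \<Longrightarrow> hua G \<tau> a u = val (rcomp X \<tau> (M a)) u"
  by (simp add: hua_def nonzero_iff)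

lemma hua_one: "u \<in> carrier G \<Longrightarrow> hua G \<tau> \<one> u = \<one>"
  by (simp add: hua_def)

lemma Some_hua: "a \<in> nonzero G \<Longrightarrow> u \<in> carrier G \<Longrightarrow> Some (hua G \<tau> a u) = M a (\<tau> (Some u))"
  using hua_subgroup_automorphic[OF tau_mu_in_hua_subgroup, of a]
  by (simp add: automorphic_def hua_eq_val) (metis (no_types) compose_def in_points(2) rcomp_def restrict_apply')

lemma hua_closed: "a \<in> carrier G \<Longrightarrow> u \<in> carrier G \<Longrightarrow> hua G \<tau> a u \<in> carrier G"
  using hua_subgroup_hom(1)[OF tau_mu_in_hua_subgroup, of a u u]
  by (cases "a = \<one>") (simp_all add: hua_one hua_eq_val nonzero_iff)

lemma hua_mult: "a \<in> carrier G \<Longrightarrow> u \<in> carrier G \<Longrightarrow> v \<in> carrier G \<Longrightarrow>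
    hua G \<tau> a (u \<otimes> v) = hua G \<tau> a u \<otimes> hua G \<tau> a v"
  using hua_subgroup_hom(2)[OF tau_mu_in_hua_subgroup, of a u v]
  by (cases "a = \<one>") (simp_all add: hua_one hua_eq_val nonzero_iff)

end

text \<open>
  The Hua maps of \<open>a\<close> and \<open>- a\<close> agree once \<open>- 1\<close> belongs to the centroid; equivalently, the
  \<open>\<mu>\<close>-maps are involutions.
\<close>

locale special_moufang_even = special_moufang +
  assumes hua_even: "\<lbrakk>a \<in> nonzero G; u \<in> carrier G\<rbrakk> \<Longrightarrow> hua G \<tau> (inv a) u = hua G \<tau> a u"
begin

text \<open>As \<open>\<tau> = M e\<close>, the Hua map of \<open>e\<close> is the square of
  \<open>\<tau>\<close>, while that of \<open>inv e\<close> is \<open>M e\<close> followed by its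
  inverse.\<close>

lemma tau_tau [simp]: assumes "x \<in> X" shows "\<tau> (\<tau> x) = x"
  using assms
proof (rule points_cases)
  fix u assume u: "u \<in> carrier G" "x = Some u"
  have "\<tau> (\<tau> x) = Some (hua G \<tau> e u)"
    using Some_hua[OF e_nonzero u(1)] u(2) by (simp flip: tau_mu)
  also have "\<dots> = Some (hua G \<tau> (inv e) u)"
    using hua_even e_nonzero u by simp
  also have "\<dots> = M (inv e) (M e x)"
    using Some_hua[OF nonzero_inv[OF e_nonzero] u(1)] u(2) by (simp flip: tau_mu)
  also have "\<dots> = x" by (rule mu_inv_mu[OF e_nonzero assms])
  finally show ?thesis .
qed simp

lemma ti_eq: "x \<in> X \<Longrightarrow> ti x = \<tau> x"
  using ti_tau[of "\<tau> x"] by simp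

abbreviation t :: "'a \<Rightarrow> 'a" where "t \<equiv> val \<tau>"

lemma t_nonzero: "a \<in> nonzero G \<Longrightarrow> t a \<in> nonzero G"
  by (rule tau_Some(2))

lemma t_closed [simp]: "a \<in> nonzero G \<Longrightarrow> t a \<in> carrier G"
  using t_nonzero nonzero_iff by blast

lemma nonzero_closed [simp]: "a \<in> nonzero G \<Longrightarrow> a \<in> carrier G"
  by (simp add: nonzero_iff)

lemma tau_Some_t: "a \<in> nonzero G \<Longrightarrow> \<tau> (Some a) = Some (t a)"
  by (rule tau_Some(1))

lemma t_t: "a \<in> nonzero G \<Longrightarrow> t (t a) = a"
  using tau_tau[of "Some a"] by (simp add: tau_Some_t t_nonzero)

lemma t_inv: "a \<in> nonzero G \<Longrightarrow> t (inv a) = inv (t a)"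
  by (rule val_tau_inv)

lemma mu_eq: "a \<in> nonzero G \<Longrightarrow> x \<in> X \<Longrightarrow> M a x = A a (\<tau> (A (inv (t a)) (\<tau> (A a x))))"
  using mu_apply[of a x] ti_eq[of "Some a"] by (simp add: ti_eq val_def)

lemma mu_even: assumes "a \<in> nonzero G" "x \<in> X" shows "M (inv a) x = M a x"
proof -
  have "M (inv a) (\<tau> y) = M a (\<tau> y)" if "y \<in> X" for y
    using that
  proof (rule points_cases)
    fix u assume u: "u \<in> carrier G" "y = Some u"
    show ?thesis
      using Some_hua[OF assms(1) u(1)] Some_hua[OF nonzero_inv[OF assms(1)] u(1)] hua_even[OF assms(1) u(1)] u(2) by simp
  qed (use assms nonzero_inv in simp)
  from this[of "\<tau> x"] show ?thesis using assms by simp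
qed

lemma mu_mu [simp]: "a \<in> nonzero G \<Longrightarrow> x \<in> X \<Longrightarrow> M a (M a x) = x"
  using mu_inv_mu[of a x] mu_even[of a "M a x"] by simp

lemma mu_at_inv: "x \<in> nonzero G \<Longrightarrow> M x (Some (inv x)) = Some x"
  by (simp add: mu_eq)

lemma mu_at_self: "x \<in> nonzero G \<Longrightarrow> M x (Some x) = Some (inv x)"
  using mu_mu[of x "Some (inv x)"] by (simp add: mu_at_inv)

lemma hua_mu: "a \<in> nonzero G \<Longrightarrow> u \<in> carrier G \<Longrightarrow> M a (\<tau> (Some u)) = Some (hua G \<tau> a u)"
  by (simp add: Some_hua)

lemma hua_alpha:
  assumes "a \<in> nonzero G" "d \<in> carrier G" "x \<in> X"
  shows "M a (\<tau> (A d x)) = A (hua G \<tau> a d) (M a (\<tau> x))"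
  using assms(3)
proof (rule points_cases)
  fix u assume u: "u \<in> carrier G" "x = Some u"
  then show ?thesis using assms hua_mu hua_mult hua_closed by simp
qed (use assms in simp)

lemma hua_inj:
  assumes "a \<in> nonzero G" "u \<in> carrier G" "v \<in> carrier G" "hua G \<tau> a u = hua G \<tau> a v"
  shows "u = v"
proof -
  have "\<tau> (M a (M a (\<tau> (Some u)))) = \<tau> (M a (M a (\<tau> (Some v))))"
    using assms hua_mu by simp
  then show ?thesis using assms by simp
qed

lemma hua_1: assumes "a \<in> carrier G" shows "hua G \<tau> a \<one> = \<one>"
proof -
  have "hua G \<tau> a \<one> \<otimes> hua G \<tau> a \<one> = hua G \<tau> a \<one>"
    using hua_mult[OF assms one_closed one_closed, symmetric] by (simp only: r_one[OF one_closed])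
  then show ?thesis using l_cancel_one[OF hua_closed hua_closed] assms by blast
qed

lemma hua_inv: assumes "a \<in> carrier G" "u \<in> carrier G" shows "hua G \<tau> a (inv u) = inv (hua G \<tau> a u)"
proof -
  have "hua G \<tau> a (inv u) \<otimes> hua G \<tau> a u = \<one>"
    using hua_mult[of a "inv u" u] hua_1 assms by simp
  then show ?thesis using inv_equality hua_closed assms by simp
qed

lemma hua_nonzero: "a \<in> nonzero G \<Longrightarrow> u \<in> nonzero G \<Longrightarrow> hua G \<tau> a u \<in> nonzero G"
proof -
  assume a: "a \<in> nonzero G" and u: "u \<in> nonzero G"
  have "hua G \<tau> a u \<noteq> \<one>"
  proof
    assume "hua G \<tau> a u = \<one>"
    then have "hua G \<tau> a u = hua G \<tau> a \<one>" using hua_1 a by simp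
    then have "u = \<one>" by (rule hua_inj[OF a nonzero_closed[OF u] one_closed])
    then show False using u by (simp add: nonzero_iff)
  qed
  then show ?thesis using hua_closed a u by (simp add: nonzero_iff)
qed

lemma hua_e: "u \<in> carrier G \<Longrightarrow> hua G \<tau> e u = u"
  using hua_mu[OF e_nonzero, of u] by (simp flip: tau_mu)

section \<open>Inversion and the identities of the Hua maps\<close>

definition jinv :: "'a \<Rightarrow> 'a" where "jinv a = inv (t a)"

lemma jinv_nonzero: "a \<in> nonzero G \<Longrightarrow> jinv a \<in> nonzero G"
  unfolding jinv_def by (rule nonzero_inv[OF t_nonzero])

lemma jinv_jinv: "a \<in> nonzero G \<Longrightarrow> jinv (jinv a) = a"
  by (simp add: jinv_def t_inv t_t t_nonzero)

lemma jinv_inv: "a \<in> nonzero G \<Longrightarrow> jinv (inv a) = inv (jinv a)"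
  by (simp add: jinv_def t_inv)

lemma tau_jinv: "a \<in> nonzero G \<Longrightarrow> \<tau> (Some (jinv a)) = Some (inv a)"
  using jinv_nonzero by (simp add: tau_Some_t jinv_def t_inv t_t t_nonzero)

lemma hua_jinv: assumes "a \<in> nonzero G" shows "hua G \<tau> a (jinv a) = a"
  using hua_mu[OF assms, of "jinv a"] assms jinv_nonzero[OF assms] by (simp add: tau_jinv mu_at_inv)

text \<open>The Hua map of \<open>a\<close> conjugates \<open>M b\<close> to the
  \<open>\<mu>\<close>-map of the image of \<open>b\<close>: it is an automorphism of the group,
  which handles the translations in \<open>M b\<close>, and conjugation by \<open>\<tau>\<close>
  inverts it, which handles the middle factor (\<open>K\<close>).\<close>

lemma mu_hua:
  assumes a: "a \<in> nonzero G" and b: "b \<in> nonzero G" and x: "x \<in> X"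
  shows "M (hua G \<tau> a b) (M a (\<tau> x)) = M a (\<tau> (M b x))"
proof -
  let ?c = "hua G \<tau> a b"
  have c: "?c \<in> nonzero G" using hua_nonzero a b by blast
  have "Some (t ?c) = \<tau> (M a (\<tau> (Some b)))" using tau_Some_t[OF c] hua_mu a b by simp
  then have "M a (\<tau> (Some (t ?c))) = Some (t b)" using a b by (simp add: tau_Some_t)
  then have htc: "hua G \<tau> a (t ?c) = t b" using hua_mu[OF a, of "t ?c"] c by simp
  have K: "A (inv (t ?c)) (\<tau> (M a y)) = \<tau> (M a (A (inv (t b)) y))" if y: "y \<in> X" for y
  proof -
    have "M a (\<tau> (A (inv (t ?c)) (\<tau> (M a y)))) = A (hua G \<tau> a (inv (t ?c))) (M a (\<tau> (\<tau> (M a y))))"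
      using a c y by (intro hua_alpha) auto
    also have "\<dots> = A (inv (t b)) y"
      using a c y htc by (simp add: hua_inv)
    finally have "\<tau> (M a (M a (\<tau> (A (inv (t ?c)) (\<tau> (M a y)))))) = \<tau> (M a (A (inv (t b)) y))"
      by simp
    then show ?thesis using a c y by simp
  qed
  have "M ?c (M a (\<tau> x)) = A ?c (\<tau> (A (inv (t ?c)) (\<tau> (A ?c (M a (\<tau> x))))))"
    using c a x by (simp add: mu_eq)
  also have "A ?c (M a (\<tau> x)) = M a (\<tau> (A b x))" using hua_alpha a b x by simp
  also have "A (inv (t ?c)) (\<tau> (M a (\<tau> (A b x)))) = \<tau> (M a (A (inv (t b)) (\<tau> (A b x))))"
    using K b x by simp
  also have "A ?c (\<tau> (\<tau> (M a (A (inv (t b)) (\<tau> (A b x)))))) = A ?c (M a (\<tau> (\<tau> (A (inv (t b)) (\<tau> (A b x))))))"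
    using a b x by simp
  also have "\<dots> = M a (\<tau> (A b (\<tau> (A (inv (t b)) (\<tau> (A b x))))))"
    using hua_alpha a b x by simp
  also have "\<dots> = M a (\<tau> (M b x))" using b x by (simp add: mu_eq)
  finally show ?thesis .
qed

lemma hua_hua:
  assumes a: "a \<in> carrier G" and b: "b \<in> carrier G" and x: "x \<in> carrier G"
  shows "hua G \<tau> (hua G \<tau> a b) x = hua G \<tau> a (hua G \<tau> b (hua G \<tau> a x))"
proof (cases "a = \<one> \<or> b = \<one>")
  case True
  then show ?thesis using a b x by (auto simp: hua_one hua_1 hua_closed)
next
  case False
  then have a': "a \<in> nonzero G" and b': "b \<in> nonzero G" using a b by (auto simp: nonzero_iff)
  let ?c = "hua G \<tau> a b"
  have c: "?c \<in> nonzero G" using hua_nonzero a' b' by blast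
  have "Some (hua G \<tau> ?c x) = M ?c (\<tau> (Some x))" using hua_mu c x by simp
  also have "\<dots> = M a (\<tau> (M b (\<tau> (M a (\<tau> (Some x))))))"
    using mu_hua[OF a' b', of "\<tau> (M a (\<tau> (Some x)))"] a' x by simp
  also have "\<dots> = Some (hua G \<tau> a (hua G \<tau> b (hua G \<tau> a x)))"
    using a' b' x hua_mu hua_closed by simp
  finally show ?thesis by simp
qed

text \<open>As \<open>jinv a\<close> is sent to \<open>a\<close>, \<open>hua_hua\<close> with
  \<open>b = jinv a\<close> gives \<open>h = h g h\<close> for the Hua maps \<open>h\<close> of
  \<open>a\<close> and \<open>g\<close> of \<open>jinv a\<close>; cancel \<open>h\<close>.\<close>

lemma hua_jinv_hua:
  assumes "a \<in> nonzero G" "x \<in> carrier G"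
  shows "hua G \<tau> (jinv a) (hua G \<tau> a x) = x"
proof -
  have "hua G \<tau> a (hua G \<tau> (jinv a) (hua G \<tau> a x)) = hua G \<tau> a x"
    using hua_hua[of a "jinv a" x] hua_jinv assms jinv_nonzero by simp
  then show ?thesis using assms jinv_nonzero hua_closed by - (rule hua_inj[of a], auto)
qed

lemma jinv_hua:
  assumes a: "a \<in> nonzero G" and x: "x \<in> nonzero G"
  shows "jinv (hua G \<tau> a x) = hua G \<tau> (jinv a) (jinv x)"
proof -
  let ?c = "hua G \<tau> a x"
  have c: "?c \<in> nonzero G" using hua_nonzero a x by blast
  have "Some (t ?c) = \<tau> (M a (\<tau> (Some x)))" using tau_Some_t[OF c] hua_mu a x by simp
  then have "M a (\<tau> (Some (t ?c))) = Some (t x)" using a x by (simp add: tau_Some_t)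
  then have "hua G \<tau> a (t ?c) = t x" using hua_mu[OF a, of "t ?c"] c by simp
  then have "hua G \<tau> a (jinv ?c) = jinv x" using a c by (simp add: jinv_def hua_inv)
  then show ?thesis using hua_jinv_hua[OF a, of "jinv ?c"] jinv_nonzero[OF c] by simp
qed

text \<open>\<open>M a (Some y)\<close> is computed twice: by the Hua map, as \<open>Some y\<close>
  is the image of \<open>Some (jinv (inv y))\<close> under \<open>\<tau>\<close>, and by the product
  formula, in which \<open>a \<otimes> y\<close> appears.\<close>

lemma hua_identity:
  assumes a: "a \<in> nonzero G" and y: "y \<in> nonzero G" and ay: "a \<otimes> y \<in> nonzero G"
  shows "jinv (a \<otimes> y) = jinv a \<otimes> inv (jinv (a \<otimes> hua G \<tau> a (jinv y)))"
proof -
  let ?d = "a \<otimes> y"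
  have C: "a \<in> carrier G" "y \<in> carrier G" "t a \<in> carrier G" "t ?d \<in> carrier G" "a \<noteq> \<one>" "y \<noteq> \<one>"
    using a y ay by (auto simp: nonzero_iff)
  let ?s = "t ?d \<otimes> inv (t a)"
  have "t ?d \<noteq> t a"
  proof
    assume "t ?d = t a"
    then have "?d = a" using t_t[OF a] t_t[OF ay] by simp
    then show False using C by simp
  qed
  then have s: "?s \<in> nonzero G"
    using C mult_inv_eq_one[of "t ?d" "t a"] by (intro nonzeroI) auto
  have "Some (hua G \<tau> a (jinv (inv y))) = M a (\<tau> (Some (jinv (inv y))))"
    using hua_mu a y jinv_nonzero nonzero_inv by simp
  also have "\<dots> = M a (Some y)"
    using tau_jinv[OF nonzero_inv[OF y]] C by simp
  also have "\<dots> = Some (t ?s \<otimes> a)"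
    using a ay s C by (simp add: mu_eq m_comm[of y a] tau_Some_t)
  finally have "inv (hua G \<tau> a (jinv y)) = t ?s \<otimes> a"
    using hua_inv C jinv_inv[OF y] jinv_nonzero[OF y] by simp
  then have "hua G \<tau> a (jinv y) = inv (t ?s \<otimes> a)"
    using hua_closed C jinv_nonzero[OF y] inv_inv by (metis nonzero_closed)
  then have "a \<otimes> hua G \<tau> a (jinv y) = inv (t ?s)"
    using C s by (simp add: inv_mult_group) (simp add: m_assoc[symmetric])
  then have "jinv (a \<otimes> hua G \<tau> a (jinv y)) = ?s"
    using s by (simp add: jinv_def t_inv t_nonzero t_t)
  then show ?thesis
    using C by (simp add: jinv_def inv_mult_group m_ac) (simp add: m_assoc[symmetric])
qed

text \<open>
  \<open>Z d\<close> is the element of the root group of \<open>0\<close> that corresponds to \<open>d\<close>.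
\<close>

definition Z :: "'a \<Rightarrow> 'a option \<Rightarrow> 'a option" where "Z d x = \<tau> (A d (\<tau> x))"

lemma Z_closed [simp]: "d \<in> carrier G \<Longrightarrow> x \<in> X \<Longrightarrow> Z d x \<in> X"
  by (simp add: Z_def)

lemma Z_Z: "c \<in> carrier G \<Longrightarrow> d \<in> carrier G \<Longrightarrow> x \<in> X \<Longrightarrow> Z c (Z d x) = Z (c \<otimes> d) x"
  by (simp add: Z_def alpha_alpha m_comm)

text \<open>Conjugation by \<open>M x\<close> takes the root group of \<open>\<infinity>\<close> to
  that of 0; the image of \<open>\<infinity>\<close> tells which element arises.\<close>

lemma mu_alpha_mu:
  assumes x: "x \<in> nonzero G" and y: "y \<in> X"
  shows "M x (A x (M x y)) = Z (inv (t x)) y"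
proof -
  have "A x \<in> R None" using x by (auto simp: root_infinity_iff)
  then obtain v where v: "v \<in> R (M x None)" "\<forall>y\<in>X. M x (A x y) = v (M x y)"
    using goodD[OF good_mu[OF x] in_points(1)] by blast
  then obtain d where d: "d \<in> carrier G" "\<forall>y\<in>X. v y = \<tau> (A d (ti y))"
  proof -
    have "v \<in> R (Some \<one>)" using v(1) x by simp
    then show thesis using root_zero_apply that by blast
  qed
  have eq: "M x (A x (M x y)) = Z d y" if "y \<in> X" for y
    using bspec[OF v(2), of "M x y"] bspec[OF d(2) that] that x by (simp add: Z_def ti_eq)
  have "\<tau> (Some d) = M x (A x (M x None))" using eq[of None] d by (simp add: Z_def)
  also have "\<dots> = Some (inv x)" using x by (simp add: mu_at_self)
  finally have "Some d = \<tau> (Some (inv x))" using tau_tau[of "Some d"] d by simp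
  then have "d = inv (t x)" using tau_Some_t[OF nonzero_inv[OF x]] t_inv[OF x] by simp
  then show ?thesis using eq y by simp
qed

text \<open>The product formula for \<open>M x\<close>, conjugated by \<open>M x\<close> itself,
  which exchanges the two kinds of factors.\<close>

lemma mu_Z:
  assumes x: "x \<in> nonzero G" and y: "y \<in> X"
  shows "M x y = Z (inv (t x)) (A x (Z (inv (t x)) y))"
proof -
  have A: "M x (Z (inv (t x)) (M x z)) = A x z" if "z \<in> X" for z
  proof -
    have "M x (Z (inv (t x)) (M x z)) = M x (M x (A x (M x (M x z))))"
      using mu_alpha_mu[of x "M x z"] that x by (simp del: mu_mu)
    then show ?thesis using that x by simp
  qed
  have M: "M x z = A x (Z (inv (t x)) (A x z))" if "z \<in> X" for z
    using mu_eq[OF x that] by (simp add: Z_def)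
  have "M x y = M x (M x (M x y))" using x y by simp
  also have "\<dots> = M x (A x (Z (inv (t x)) (A x (M x y))))" using M x y by simp
  also have "\<dots> = M x (A x (M x (M x (Z (inv (t x)) (M x (M x (A x (M x y))))))))" using x y by simp
  also have "\<dots> = Z (inv (t x)) (A x (Z (inv (t x)) y))"
    using A mu_alpha_mu x y by simp
  finally show ?thesis .
qed

lemma mu_Z_mu:
  assumes a: "a \<in> nonzero G" and p: "p \<in> carrier G"
  shows "\<exists>q\<in>carrier G. \<forall>y\<in>X. M a (Z p y) = A q (M a y)"
proof -
  let ?u = "conj_map X X (A \<one>) (conj_map X X \<tau> (A p))"
  have u: "?u \<in> R (Some \<one>)" using p by (auto simp: root_group_def root_infinity_def root_zero_def)
  have "inv_into X (A \<one>) y = y" if "y \<in> X" for y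
    using bij_betw_inv_into_left[OF bij_alpha[OF one_closed] that] that by simp
  then have uZ: "?u y = Z p y" if "y \<in> X" for y
    using that p by (simp add: conj_map_def Z_def ti_eq)
  obtain v where "v \<in> R (M a (Some \<one>))" "\<forall>y\<in>X. M a (?u y) = v (M a y)"
    using goodD[OF good_mu[OF a] _ u] by auto
  moreover from this(1) obtain q where "q \<in> carrier G" "v = A q"
    using a root_infinity_iff by auto
  ultimately show ?thesis using uZ by (intro bexI[of _ q]) auto
qed

text \<open>Conjugation by \<open>\<tau>\<close> exchanges \<open>A d\<close> and
  \<open>Z d\<close>, so it turns the factorization \<open>mu_eq\<close> for \<open>s\<close> into
  \<open>mu_Z\<close> for \<open>inv (t s)\<close>.\<close>

lemma mu_tau:
  assumes s: "s \<in> nonzero G" and x: "x \<in> X"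
  shows "M (t s) x = \<tau> (M s (\<tau> x))"
proof -
  let ?c = "inv (t s)"
  have c: "?c \<in> nonzero G" "inv (t ?c) = s"
    using s nonzero_inv t_nonzero by (auto simp: t_inv t_t)
  have "\<tau> (M s (\<tau> x)) = Z s (A ?c (Z s x))"
    using s x by (simp add: mu_eq Z_def)
  also have "\<dots> = M ?c x" using mu_Z[OF c(1) x] c(2) by simp
  also have "\<dots> = M (t s) x" using mu_even[OF t_nonzero[OF s] x] by simp
  finally show ?thesis by simp
qed

text \<open>
  Substituting \<open>\<alpha>\<^sub>w = \<zeta>\<^sub>w \<mu>\<^sub>w \<zeta>\<^sub>w\<close>, where \<open>\<zeta>\<^sub>w\<close> is \<open>Z (t w)\<close>, into \<open>\<alpha>\<^sub>a\<^sub>-\<^sub>b = \<alpha>\<^sub>a \<alpha>\<^sub>-\<^sub>b\<close> shows that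
  \<open>\<mu>\<^sub>a \<mu>\<^sub>a\<^sub>-\<^sub>b \<mu>\<^sub>b\<close> and \<open>\<mu>\<^sub>c\<close> with \<open>c = t s\<close> lie in the same double coset of the root group of
  \<open>\<infinity>\<close>; both interchange \<open>0\<close> and \<open>\<infinity>\<close>, so they are equal.
\<close>

lemma mu_mu_mu:
  assumes a: "a \<in> nonzero G" and b: "b \<in> nonzero G" and ab: "a \<noteq> b" and x: "x \<in> X"
  defines "s \<equiv> t a \<otimes> inv (t b)"
  shows "M (t s) x = M a (M (a \<otimes> inv b) (M b x))"
proof -
  let ?d = "a \<otimes> inv b"
  have C: "a \<in> carrier G" "b \<in> carrier G" "t a \<in> carrier G" "t b \<in> carrier G" using a b by auto
  note eq1 = mult_inv_eq_one
  have d: "?d \<in> nonzero G" using C ab eq1[of a b] by (intro nonzeroI) auto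
  have "t a \<noteq> t b" using ab t_t a b by metis
  then have s: "s \<in> nonzero G" unfolding s_def using C eq1[of "t a" "t b"] by (intro nonzeroI) auto
  define c where "c = t s"
  have c: "c \<in> nonzero G" "t c = s" unfolding c_def using s t_nonzero t_t by auto
  have AZ: "A w y = Z (t w) (M w (Z (t w) y))" if w: "w \<in> nonzero G" and y: "y \<in> X" for w y
  proof -
    have "Z (t w) (M w (Z (t w) y)) = Z (t w \<otimes> inv (t w)) (A w (Z (inv (t w) \<otimes> t w) y))"
      using w y by (simp add: mu_Z Z_Z)
    then show ?thesis using w y by (simp add: Z_def)
  qed
  have AZ': "A (inv w) y = Z (inv (t w)) (M w (Z (inv (t w)) y))" if w: "w \<in> nonzero G" and y: "y \<in> X" for w y
    using AZ[OF nonzero_inv[OF w] y] w y mu_even[OF w] by (simp add: t_inv)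
  let ?p = "inv (t a) \<otimes> t ?d" and ?q = "t ?d \<otimes> t b"
  have pq: "?p \<in> carrier G" "?q \<in> carrier G" using C d by auto
  have main: "Z s (M b y) = M a (Z ?p (M ?d (Z ?q y)))" if y: "y \<in> X" for y
  proof -
    let ?y = "Z (t b) y"
    have Y: "?y \<in> X" using y C by simp
    have "A ?d ?y = A a (A (inv b) ?y)" using C Y by (simp add: alpha_alpha m_comm)
    also have "\<dots> = Z (t a) (M a (Z (t a) (Z (inv (t b)) (M b (Z (inv (t b)) ?y)))))"
      using AZ[OF a] AZ'[OF b Y] Y C b by simp
    also have "Z (inv (t b)) ?y = y" using C y by (simp add: Z_Z) (simp add: Z_def)
    also have "Z (t a) (Z (inv (t b)) (M b y)) = Z s (M b y)"
      using C b y by (simp add: Z_Z s_def)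
    finally have "Z (t ?d) (M ?d (Z (t ?d) ?y)) = Z (t a) (M a (Z s (M b y)))"
      using AZ[OF d Y] by simp
    then have "M a (Z (inv (t a)) (Z (t ?d) (M ?d (Z (t ?d) ?y)))) = M a (Z (inv (t a)) (Z (t a) (M a (Z s (M b y)))))"
      by simp
    also have "Z (inv (t a)) (Z (t a) (M a (Z s (M b y)))) = M a (Z s (M b y))"
      using C a b s y by (simp add: Z_Z) (simp add: Z_def)
    finally show ?thesis
      using C a b d s y by (simp add: Z_Z)
  qed
  obtain p' where p': "p' \<in> carrier G" "\<forall>y\<in>X. M a (Z ?p y) = A p' (M a y)"
    using mu_Z_mu[OF a pq(1)] by blast
  obtain q' where q': "q' \<in> carrier G" "\<forall>y\<in>X. M b (Z ?q y) = A q' (M b y)"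
    using mu_Z_mu[OF b pq(2)] by blast
  define N where "N y = M a (M ?d (M b y))" for y
  have NX: "N y \<in> X" if "y \<in> X" for y unfolding N_def using a b d that by simp
  have ZN: "Z s y = A p' (N (A q' y))" if y: "y \<in> X" for y
  proof -
    have "Z ?q (M b y) = M b (A q' y)"
      using bspec[OF q'(2), of "M b y"] mu_mu[OF b, of "Z ?q (M b y)"] b y pq by simp
    moreover have "Z s y = M a (Z ?p (M ?d (Z ?q (M b y))))" using main[of "M b y"] b y by simp
    ultimately show ?thesis
      using bspec[OF p'(2), of "M ?d (M b (A q' y))"] b d y q'(1) by (simp add: N_def)
  qed
  \<comment> \<open>As \<open>t c = s\<close>, this is the product formula of
    \<open>M (inv c)\<close> solved for its middle factor, combined with evenness.\<close>
  have Zc: "Z s y = A c (M c (A c y))" if y: "y \<in> X" for y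
  proof -
    have "M c (A c y) = M (inv c) (A c y)" using mu_even c y by simp
    also have "\<dots> = A (inv c) (Z s y)"
      using mu_eq[OF nonzero_inv[OF c(1)], of "A c y"] c y s by (simp add: t_inv Z_def)
    finally show ?thesis using c y s by simp
  qed
  let ?m = "inv p' \<otimes> c" and ?n = "c \<otimes> inv q'"
  have mn: "?m \<in> carrier G" "?n \<in> carrier G" using p' q' c by auto
  have N: "N y = A ?m (M c (A ?n y))" if y: "y \<in> X" for y
  proof -
    have "N y = A (inv p') (A p' (N (A q' (A (inv q') y))))" using p' q' y NX by simp
    also have "\<dots> = A (inv p') (A c (M c (A c (A (inv q') y))))"
      using ZN[of "A (inv q') y"] Zc[of "A (inv q') y"] q' y by simp
    finally show ?thesis using p' q' c y by (simp add: alpha_alpha m_comm)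
  qed
  have m1: "?m = \<one>"
    using N[of None] a b d c mn by (simp add: N_def)
  have "M c (Some ?n) = None"
    using N[of "Some \<one>"] a b d c mn unfolding m1 by (simp add: N_def)
  then have "Some ?n = Some \<one>" using mu_mu[OF c(1), of "Some ?n"] mn c by simp
  then show ?thesis using N[OF x] m1 c x by (simp add: N_def c_def)
qed

text \<open>\<open>mu_mu_mu\<close> in terms of Hua maps: by \<open>mu_tau\<close>,
  \<open>M (t s)\<close> is the conjugate of \<open>M s\<close> by \<open>\<tau>\<close>, and the
  copies of \<open>\<tau>\<close> complete the three Hua maps.\<close>

lemma hua_diff:
  assumes a: "a \<in> nonzero G" and b: "b \<in> nonzero G" and x: "x \<in> carrier G"
  shows "hua G \<tau> (a \<otimes> inv b) x = hua G \<tau> a (hua G \<tau> (t a \<otimes> inv (t b)) (hua G \<tau> b x))"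
proof (cases "a = b")
  case True
  then show ?thesis using a b x by (simp add: hua_one hua_1 hua_closed)
next
  case False
  let ?s = "t a \<otimes> inv (t b)" and ?d = "a \<otimes> inv b"
  note eq1 = mult_inv_eq_one
  have "t a \<noteq> t b" using False t_t a b by metis
  then have s: "?s \<in> nonzero G" and d: "?d \<in> nonzero G"
    using a b False eq1[of a b] eq1[of "t a" "t b"] by (auto intro!: nonzeroI)
  have "Some (hua G \<tau> a (hua G \<tau> ?s (hua G \<tau> b x))) = M a (\<tau> (M ?s (\<tau> (M b (\<tau> (Some x))))))"
    using a b s x hua_mu hua_closed by simp
  also have "\<dots> = M a (M (t ?s) (M b (\<tau> (Some x))))" using mu_tau[OF s] b x by simp
  also have "\<dots> = M ?d (\<tau> (Some x))" using mu_mu_mu[OF a b False] a b d x by simp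
  also have "\<dots> = Some (hua G \<tau> ?d x)" using hua_mu d x by simp
  finally show ?thesis by simp
qed

lemma hua_plus:
  assumes a: "a \<in> nonzero G" and b: "b \<in> nonzero G" and x: "x \<in> carrier G"
  shows "hua G \<tau> (a \<otimes> b) x = hua G \<tau> a (hua G \<tau> (jinv a \<otimes> jinv b) (hua G \<tau> b x))"
proof -
  let ?s = "t a \<otimes> t b"
  have C: "t a \<in> carrier G" "t b \<in> carrier G" using a b by auto
  have "hua G \<tau> (a \<otimes> b) x = hua G \<tau> a (hua G \<tau> ?s (hua G \<tau> (inv b) x))"
    using hua_diff[OF a nonzero_inv[OF b] x] b C by (simp add: t_inv)
  also have "hua G \<tau> (inv b) x = hua G \<tau> b x" by (rule hua_even[OF b x])
  also have "hua G \<tau> ?s (hua G \<tau> b x) = hua G \<tau> (inv ?s) (hua G \<tau> b x)"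
    using hua_even[of ?s] C b x hua_closed by (cases "?s = \<one>") (auto simp: nonzero_iff[of ?s])
  also have "inv ?s = jinv a \<otimes> jinv b" using C by (simp add: jinv_def inv_mult_group m_comm)
  finally show ?thesis .
qed

end

section \<open>Embedding abelian groups into a type of class \<open>ab_group_add\<close>\<close>

text \<open>
  The product of all abelian groups with carrier in \<open>'a\<close> is a type of class \<open>ab_group_add\<close>, and it
  contains each of these groups as a direct factor. This makes type class arithmetic available for
  a group given by a carrier set.
\<close>

typedef 'a cgroup = "{H :: 'a monoid. comm_group H}"
proof -
  have "comm_group \<lparr>carrier = {undefined :: 'a}, mult = (\<lambda>x y. undefined), one = undefined\<rparr>"
    by (rule comm_groupI) auto
  then show ?thesis by blast
qed

typedef 'a cgroup_prod = "{f :: 'a cgroup \<Rightarrow> 'a. \<forall>H. f H \<in> carrier (Rep_cgroup H)}"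
proof -
  have "\<one>\<^bsub>Rep_cgroup H\<^esub> \<in> carrier (Rep_cgroup H)" for H :: "'a cgroup"
    using Rep_cgroup[of H] by (simp add: comm_group_def group_def monoid.one_closed)
  then show ?thesis by (intro exI[of _ "\<lambda>H. \<one>\<^bsub>Rep_cgroup H\<^esub>"]) simp
qed

setup_lifting type_definition_cgroup_prod

lemma comm_group_Rep: "comm_group (Rep_cgroup H)"
  using Rep_cgroup[of H] by simp

lemmas group_Rep = comm_group.axioms(2)[OF comm_group_Rep]
lemmas monoid_Rep = group.axioms(1)[OF group_Rep]
lemmas comm_monoid_Rep = comm_group.axioms(1)[OF comm_group_Rep]

instantiation cgroup_prod :: (type) ab_group_add
begin

lift_definition zero_cgroup_prod :: "'a cgroup_prod" is "\<lambda>H. \<one>\<^bsub>Rep_cgroup H\<^esub>"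
  by (rule monoid.one_closed[OF monoid_Rep])

lift_definition plus_cgroup_prod :: "'a cgroup_prod \<Rightarrow> 'a cgroup_prod \<Rightarrow> 'a cgroup_prod"
  is "\<lambda>f g H. f H \<otimes>\<^bsub>Rep_cgroup H\<^esub> g H"
  by (rule monoid.m_closed[OF monoid_Rep]) auto

lift_definition uminus_cgroup_prod :: "'a cgroup_prod \<Rightarrow> 'a cgroup_prod"
  is "\<lambda>f H. inv\<^bsub>Rep_cgroup H\<^esub> f H"
  by (rule group.inv_closed[OF group_Rep]) auto

definition minus_cgroup_prod :: "'a cgroup_prod \<Rightarrow> 'a cgroup_prod \<Rightarrow> 'a cgroup_prod" where
  "minus_cgroup_prod x y = x + - y"

instance
proof
  fix x y z :: "'a cgroup_prod"
  show "x + y + z = x + (y + z)"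
    by transfer (simp add: monoid.m_assoc[OF monoid_Rep])
  show "x + y = y + x"
    by transfer (simp add: comm_monoid.m_comm[OF comm_monoid_Rep])
  show "0 + x = x"
    by transfer (simp add: monoid.l_one[OF monoid_Rep])
  show "- x + x = 0"
    by transfer (simp add: group.l_inv[OF group_Rep])
  show "x - y = x + - y"
    by (rule minus_cgroup_prod_def)
qed

end

locale comm_group_embedding = comm_group
begin

text \<open>The record is rebuilt to drop its extension fields, as \<open>cgroup\<close> consists of
  plain monoids.\<close>

definition factor :: "'a cgroup" where
  "factor = Abs_cgroup \<lparr>carrier = carrier G, mult = mult G, one = one G\<rparr>"

lemma Rep_factor: "Rep_cgroup factor = \<lparr>carrier = carrier G, mult = mult G, one = one G\<rparr>"
proof -
  have "comm_group \<lparr>carrier = carrier G, mult = mult G, one = one G\<rparr>"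
    by (rule comm_groupI) (auto simp: m_ac intro: l_inv_ex)
  then show ?thesis unfolding factor_def by (simp add: Abs_cgroup_inverse)
qed

lemma Rep_factor_simps [simp]:
  "carrier (Rep_cgroup factor) = carrier G" "mult (Rep_cgroup factor) = mult G"
  "one (Rep_cgroup factor) = \<one>"
  by (simp_all add: Rep_factor)

definition prj :: "'a cgroup_prod \<Rightarrow> 'a" where "prj x = Rep_cgroup_prod x factor"

definition emb :: "'a \<Rightarrow> 'a cgroup_prod" where
  "emb u = Abs_cgroup_prod (\<lambda>H. if H = factor then u else \<one>\<^bsub>Rep_cgroup H\<^esub>)"

lemma prj_closed [simp]: "prj x \<in> carrier G"
  using Rep_cgroup_prod[of x] unfolding prj_def by (metis (mono_tags) Rep_factor_simps(1) mem_Collect_eq)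

lemma Rep_emb: "u \<in> carrier G \<Longrightarrow> Rep_cgroup_prod (emb u) = (\<lambda>H. if H = factor then u else \<one>\<^bsub>Rep_cgroup H\<^esub>)"
  unfolding emb_def by (rule Abs_cgroup_prod_inverse) (auto simp: monoid.one_closed[OF monoid_Rep])

lemma prj_emb [simp]: "u \<in> carrier G \<Longrightarrow> prj (emb u) = u"
  by (simp add: prj_def Rep_emb)

lemma emb_one: "emb \<one> = 0"
  by (auto simp: Rep_cgroup_prod_inject[symmetric] Rep_emb zero_cgroup_prod.rep_eq)

lemma emb_mult: "\<lbrakk>u \<in> carrier G; v \<in> carrier G\<rbrakk> \<Longrightarrow> emb (u \<otimes> v) = emb u + emb v"
  by (auto simp: Rep_cgroup_prod_inject[symmetric] Rep_emb plus_cgroup_prod.rep_eq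
      monoid.l_one[OF monoid_Rep] monoid.one_closed[OF monoid_Rep])

lemma emb_inject: "\<lbrakk>u \<in> carrier G; v \<in> carrier G\<rbrakk> \<Longrightarrow> emb u = emb v \<longleftrightarrow> u = v"
  using prj_emb by metis

lemma emb_eq_0: "u \<in> carrier G \<Longrightarrow> emb u = 0 \<longleftrightarrow> u = \<one>"
  using emb_inject[of u \<one>] by (simp add: emb_one)

lemma emb_inv: "u \<in> carrier G \<Longrightarrow> emb (inv u) = - emb u"
  using emb_mult[of "inv u" u] by (simp add: emb_one eq_neg_iff_add_eq_0)

lemma emb_pow: "u \<in> carrier G \<Longrightarrow> emb (u [^] n) = n \<cdot> emb u" for n :: nat
  by (induction n) (simp_all add: emb_one emb_mult add.commute)

end

section \<open>The ring of endomorphisms commuting with the Hua subgroup\<close>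

context special_moufang
begin

abbreviation E :: "('a \<Rightarrow> 'a) ring" where "E \<equiv> end_hua G \<tau>"

lemma E_iff: "T \<in> carrier E \<longleftrightarrow> T \<in> extensional (carrier G) \<and>
    (\<forall>u\<in>carrier G. T u \<in> carrier G) \<and>
    (\<forall>u\<in>carrier G. \<forall>v\<in>carrier G. T (u \<otimes> v) = T u \<otimes> T v) \<and>
    (\<forall>h\<in>hua_subgroup G \<tau>. \<forall>u\<in>carrier G. T (val h u) = val h (T u))"
  by (auto simp: end_hua_def hom_def)

lemma E_closed: "T \<in> carrier E \<Longrightarrow> u \<in> carrier G \<Longrightarrow> T u \<in> carrier G"
  and E_hom: "T \<in> carrier E \<Longrightarrow> u \<in> carrier G \<Longrightarrow> v \<in> carrier G \<Longrightarrow> T (u \<otimes> v) = T u \<otimes> T v"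
  and E_commute: "T \<in> carrier E \<Longrightarrow> h \<in> hua_subgroup G \<tau> \<Longrightarrow> u \<in> carrier G \<Longrightarrow> T (val h u) = val h (T u)"
  by (simp_all add: E_iff)

lemma E_one: assumes "T \<in> carrier E" shows "T \<one> = \<one>"
proof -
  have "T \<one> \<otimes> T \<one> = T \<one>"
    using E_hom[OF assms one_closed one_closed, symmetric] by (simp only: r_one[OF one_closed])
  then show ?thesis using l_cancel_one E_closed[OF assms one_closed] by blast
qed

lemma E_ext: "\<lbrakk>S \<in> carrier E; T \<in> carrier E; \<And>u. u \<in> carrier G \<Longrightarrow> S u = T u\<rbrakk> \<Longrightarrow> S = T"
  using extensionalityI[of S "carrier G" T] by (simp add: E_iff)

lemma E_ops:
  "u \<in> carrier G \<Longrightarrow> (S \<oplus>\<^bsub>E\<^esub> T) u = S u \<otimes> T u"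
  "u \<in> carrier G \<Longrightarrow> (S \<otimes>\<^bsub>E\<^esub> T) u = T (S u)"
  "u \<in> carrier G \<Longrightarrow> \<zero>\<^bsub>E\<^esub> u = \<one>"
  "u \<in> carrier G \<Longrightarrow> \<one>\<^bsub>E\<^esub> u = u"
  by (simp_all add: end_hua_def rcomp_def compose_def)

lemma hua_subgroup_one: assumes "g \<in> hua_subgroup G \<tau>" shows "val g \<one> = \<one>"
  using hua_subgroup_hom[OF assms one_closed one_closed] l_cancel_one
  by (metis l_one one_closed)

lemma E_zero_closed: "\<zero>\<^bsub>E\<^esub> \<in> carrier E"
  unfolding E_iff using hua_subgroup_one hua_subgroup_hom(1) by (auto simp: E_ops) (simp add: end_hua_def)

lemma E_one_closed: "\<one>\<^bsub>E\<^esub> \<in> carrier E"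
  unfolding E_iff using hua_subgroup_hom(1) by (auto simp: E_ops) (simp add: end_hua_def)

lemma E_add_closed: assumes "S \<in> carrier E" "T \<in> carrier E" shows "S \<oplus>\<^bsub>E\<^esub> T \<in> carrier E"
  unfolding E_iff
proof (intro conjI ballI)
  show "S \<oplus>\<^bsub>E\<^esub> T \<in> extensional (carrier G)" by (simp add: end_hua_def)
next
  fix h u assume "h \<in> hua_subgroup G \<tau>" "u \<in> carrier G"
  then show "(S \<oplus>\<^bsub>E\<^esub> T) (val h u) = val h ((S \<oplus>\<^bsub>E\<^esub> T) u)"
    using assms hua_subgroup_hom E_closed E_commute by (simp add: E_ops)
qed (simp_all add: E_ops E_closed[OF assms(1)] E_closed[OF assms(2)] E_hom[OF assms(1)] E_hom[OF assms(2)] m_ac)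

lemma E_mult_closed: assumes "S \<in> carrier E" "T \<in> carrier E" shows "S \<otimes>\<^bsub>E\<^esub> T \<in> carrier E"
  unfolding E_iff
proof (intro conjI ballI)
  show "S \<otimes>\<^bsub>E\<^esub> T \<in> extensional (carrier G)" by (simp add: end_hua_def rcomp_def compose_def)
next
  fix h u assume "h \<in> hua_subgroup G \<tau>" "u \<in> carrier G"
  then show "(S \<otimes>\<^bsub>E\<^esub> T) (val h u) = val h ((S \<otimes>\<^bsub>E\<^esub> T) u)"
    using assms hua_subgroup_hom(1) E_closed E_commute by (simp add: E_ops)
qed (simp_all add: E_ops E_closed[OF assms(1)] E_closed[OF assms(2)] E_hom[OF assms(1)] E_hom[OF assms(2)])

lemma E_minus: assumes "T \<in> carrier E"
  shows "(\<lambda>u\<in>carrier G. inv (T u)) \<in> carrier E"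
  unfolding E_iff
proof (intro conjI ballI)
  fix h u assume hu: "h \<in> hua_subgroup G \<tau>" "u \<in> carrier G"
  have "val h (inv (T u)) \<otimes> val h (T u) = \<one>"
    using hua_subgroup_hom(2)[OF hu(1), of "inv (T u)" "T u"] hua_subgroup_one[OF hu(1)] E_closed[OF assms hu(2)] by simp
  then have "val h (inv (T u)) = inv (val h (T u))"
    using inv_equality hua_subgroup_hom(1)[OF hu(1)] E_closed[OF assms hu(2)] by simp
  then show "(\<lambda>u\<in>carrier G. inv (T u)) (val h u) = val h ((\<lambda>u\<in>carrier G. inv (T u)) u)"
    using hu assms hua_subgroup_hom(1) E_commute by simp
qed (auto simp: E_closed[OF assms] E_hom[OF assms] inv_mult)

text \<open>Facts about subfields, such as inverses within \<open>k\<close>, presuppose a ring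
  around them.\<close>

lemma ring_E: "ring E"
proof (rule ringI)
  show "abelian_group E"
  proof (rule abelian_groupI)
    fix T assume T: "T \<in> carrier E"
    show "\<exists>S\<in>carrier E. S \<oplus>\<^bsub>E\<^esub> T = \<zero>\<^bsub>E\<^esub>"
      by (rule bexI[OF _ E_minus[OF T]], rule E_ext)
        (use T E_closed E_minus in \<open>auto simp: E_ops E_zero_closed E_add_closed\<close>)
    show "\<zero>\<^bsub>E\<^esub> \<oplus>\<^bsub>E\<^esub> T = T"
      by (rule E_ext) (use T E_closed in \<open>auto simp: E_ops E_zero_closed E_add_closed\<close>)
  next
    fix S T assume "S \<in> carrier E" "T \<in> carrier E"
    then show "S \<oplus>\<^bsub>E\<^esub> T = T \<oplus>\<^bsub>E\<^esub> S"
      by (intro E_ext) (auto simp: E_ops E_add_closed E_closed m_comm)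
  next
    fix S T W assume "S \<in> carrier E" "T \<in> carrier E" "W \<in> carrier E"
    then show "S \<oplus>\<^bsub>E\<^esub> T \<oplus>\<^bsub>E\<^esub> W = S \<oplus>\<^bsub>E\<^esub> (T \<oplus>\<^bsub>E\<^esub> W)"
      by (intro E_ext) (auto simp: E_ops E_add_closed E_closed m_assoc)
  qed (auto simp: E_add_closed E_zero_closed)
  show "monoid E"
  proof (rule monoidI)
    fix S T W assume "S \<in> carrier E" "T \<in> carrier E" "W \<in> carrier E"
    then show "S \<otimes>\<^bsub>E\<^esub> T \<otimes>\<^bsub>E\<^esub> W = S \<otimes>\<^bsub>E\<^esub> (T \<otimes>\<^bsub>E\<^esub> W)"
      by (intro E_ext) (auto simp: E_ops E_mult_closed E_closed)
  next
    fix T assume T: "T \<in> carrier E"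
    show "\<one>\<^bsub>E\<^esub> \<otimes>\<^bsub>E\<^esub> T = T" "T \<otimes>\<^bsub>E\<^esub> \<one>\<^bsub>E\<^esub> = T"
      by (rule E_ext; use T in \<open>auto simp: E_ops E_mult_closed E_closed E_one_closed\<close>)+
  qed (auto simp: E_mult_closed E_one_closed)
next
  fix S T W assume "S \<in> carrier E" "T \<in> carrier E" "W \<in> carrier E"
  then show "(S \<oplus>\<^bsub>E\<^esub> T) \<otimes>\<^bsub>E\<^esub> W = S \<otimes>\<^bsub>E\<^esub> W \<oplus>\<^bsub>E\<^esub> T \<otimes>\<^bsub>E\<^esub> W"
    "W \<otimes>\<^bsub>E\<^esub> (S \<oplus>\<^bsub>E\<^esub> T) = W \<otimes>\<^bsub>E\<^esub> S \<oplus>\<^bsub>E\<^esub> W \<otimes>\<^bsub>E\<^esub> T"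
    by (intro E_ext; auto simp: E_ops E_add_closed E_mult_closed E_closed E_hom)+
qed

lemma E_uminus: assumes "T \<in> carrier E" shows "\<ominus>\<^bsub>E\<^esub> T = (\<lambda>u\<in>carrier G. inv (T u))"
proof -
  interpret E: ring E by (rule ring_E)
  have "(\<lambda>u\<in>carrier G. inv (T u)) \<oplus>\<^bsub>E\<^esub> T = \<zero>\<^bsub>E\<^esub>"
    by (rule E_ext) (use assms E_closed E_minus in \<open>auto simp: E_ops E_zero_closed E_add_closed\<close>)
  then show ?thesis by (rule E.minus_equality[OF _ assms E_minus[OF assms]])
qed

lemma E_hua: "\<lbrakk>T \<in> carrier E; a \<in> carrier G; u \<in> carrier G\<rbrakk> \<Longrightarrow> T (hua G \<tau> a u) = hua G \<tau> a (T u)"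
  using E_commute[OF _ tau_mu_in_hua_subgroup, of T a u] E_closed[of T u] E_one[of T]
  by (cases "a = \<one>") (auto simp: hua_one hua_eq_val nonzero_iff)

lemma centroid_hua:
  assumes "T \<in> centroid G \<tau>" "a \<in> carrier G" "u \<in> carrier G"
  shows "hua G \<tau> (T a) u = hua G \<tau> a (T (T u))"
proof -
  have "hua G \<tau> (T a) = rcomp (carrier G) (rcomp (carrier G) T T) (hua G \<tau> a)"
    using assms by (simp add: centroid_def)
  then show ?thesis using assms(3) by (simp add: rcomp_def compose_def)
qed

end

section \<open>The quadratic Jordan division algebra\<close>

locale moufang_over_subfield = special_moufang +
  fixes k :: "('a \<Rightarrow> 'a) set"
  assumes torsion_free: "torsion_free G"
    and subfield: "subfield k E"
    and centroid: "k \<subseteq> centroid G \<tau>"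
    and fin_dim: "vectorspace.fin_dim (E\<lparr>carrier := k\<rparr>) (eval_module G)"
begin

sublocale comm_group_embedding ..

abbreviation K :: "('a \<Rightarrow> 'a) ring" where "K \<equiv> E\<lparr>carrier := k\<rparr>"
abbreviation J :: "('a \<Rightarrow> 'a, 'a) module" where "J \<equiv> eval_module G"

lemma k_E: "T \<in> k \<Longrightarrow> T \<in> carrier E"
  using subfieldE(3)[OF subfield] by blast

lemmas k_ring = subringE[OF subfieldE(1)[OF subfield]]

lemma k_closed: "T \<in> k \<Longrightarrow> u \<in> carrier G \<Longrightarrow> T u \<in> carrier G"
  using E_closed k_E by blast

lemma k_hom: "T \<in> k \<Longrightarrow> u \<in> carrier G \<Longrightarrow> v \<in> carrier G \<Longrightarrow> T (u \<otimes> v) = T u \<otimes> T v"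
  using E_hom k_E by blast

lemma k_hua: "T \<in> k \<Longrightarrow> a \<in> carrier G \<Longrightarrow> u \<in> carrier G \<Longrightarrow> T (hua G \<tau> a u) = hua G \<tau> a (T u)"
  using E_hua k_E by blast

lemma k_centroid: "T \<in> k \<Longrightarrow> a \<in> carrier G \<Longrightarrow> u \<in> carrier G \<Longrightarrow> hua G \<tau> (T a) u = T (T (hua G \<tau> a u))"
  using centroid_hua[of T a u] centroid k_hua hua_closed k_closed by auto

lemma k_commute: "S \<in> k \<Longrightarrow> T \<in> k \<Longrightarrow> u \<in> carrier G \<Longrightarrow> S (T u) = T (S u)"
  using subfieldE(4)[OF subfield, of S T] E_ops(2)[of u S T] E_ops(2)[of u T S] by simp

lemma k_uminus: "T \<in> k \<Longrightarrow> (\<lambda>u\<in>carrier G. inv (T u)) \<in> k"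
  using k_ring(5)[of T] E_uminus[OF k_E] by simp

lemma k_inverse:
  assumes "T \<in> k" "T \<noteq> \<zero>\<^bsub>E\<^esub>" shows "\<exists>S\<in>k. \<forall>u\<in>carrier G. S (T u) = u"
proof -
  interpret E: ring E by (rule ring_E)
  have "inv\<^bsub>E\<^esub> T \<in> k" "T \<otimes>\<^bsub>E\<^esub> inv\<^bsub>E\<^esub> T = \<one>\<^bsub>E\<^esub>"
    using E.subfield_m_inv[OF subfield] assms by auto
  moreover have "(inv\<^bsub>E\<^esub> T) (T u) = u" if "u \<in> carrier G" for u
    using E_ops(2)[OF that, of T "inv\<^bsub>E\<^esub> T"] E_ops(4)[OF that] calculation(2) by simp
  ultimately show ?thesis by blast
qed

sublocale special_moufang_even
proof
  fix a u assume a: "a \<in> nonzero G" and u: "u \<in> carrier G"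
  let ?m = "\<lambda>u\<in>carrier G. inv (\<one>\<^bsub>E\<^esub> u)"
  have m: "?m \<in> k" by (rule k_uminus[OF k_ring(3)])
  have "hua G \<tau> (?m a) u = ?m (?m (hua G \<tau> a u))"
    using k_centroid[OF m _ u] a by (simp add: nonzero_iff)
  then show "hua G \<tau> (inv a) u = hua G \<tau> a u"
    using a u hua_closed by (simp add: nonzero_iff E_ops)
qed

text \<open>Multiplication by a natural number lies in \<open>k\<close>, hence in the centroid. This
  yields the homogeneity of Hua maps and of inversion under the integer parameter.\<close>

lemma k_pow: "\<exists>T\<in>k. \<forall>u\<in>carrier G. T u = u [^] n" for n :: nat
proof (induction n)
  case 0
  show ?case using k_ring(2) E_ops(3) by (intro bexI[of _ "\<zero>\<^bsub>E\<^esub>"]) auto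
next
  case (Suc n)
  then obtain T where T: "T \<in> k" "\<forall>u\<in>carrier G. T u = u [^] n" by blast
  then show ?case
    using k_ring(7)[OF T(1) k_ring(3)] by (intro bexI[of _ "T \<oplus>\<^bsub>E\<^esub> \<one>\<^bsub>E\<^esub>"]) (auto simp: E_ops)
qed

lemma pow_nonzero: "a \<in> nonzero G \<Longrightarrow> n > 0 \<Longrightarrow> a [^] n \<in> nonzero G" for n :: nat
  using torsion_free by (simp add: torsion_free_def nonzero_iff)

text \<open>Let \<open>T\<close> be multiplication by \<open>n\<close>. The centroid condition for
  \<open>T a\<close>, evaluated at \<open>jinv (T a)\<close>, shows that the Hua map of
  \<open>a\<close> sends \<open>T (jinv (T a))\<close> to \<open>a\<close>, which is also the image
  of \<open>jinv a\<close>.\<close>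

lemma jinv_pow:
  fixes n :: nat
  assumes a: "a \<in> nonzero G" and n: "n > 0" shows "jinv (a [^] n) [^] n = jinv a"
proof -
  obtain T where T: "T \<in> k" "\<And>u. u \<in> carrier G \<Longrightarrow> T u = u [^] n" using k_pow by blast
  let ?b = "a [^] n"
  have b: "?b \<in> nonzero G" "?b = T a" using pow_nonzero a n T by auto
  have "T \<noteq> \<zero>\<^bsub>E\<^esub>" using b E_ops(3)[of a] a by (auto simp: nonzero_iff)
  then obtain S where S: "S \<in> k" "\<And>u. u \<in> carrier G \<Longrightarrow> S (T u) = u" using k_inverse T(1) by blast
  have j: "jinv ?b \<in> carrier G" "jinv a \<in> carrier G" using jinv_nonzero a b by auto
  have h: "hua G \<tau> a (jinv ?b) \<in> carrier G" using hua_closed a j by simp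
  have "T (T (hua G \<tau> a (jinv ?b))) = T a"
    using k_centroid[OF T(1), of a "jinv ?b"] hua_jinv[OF b(1)] b(2) a j by simp
  then have "T (hua G \<tau> a (jinv ?b)) = a"
    using S(2)[of "T (hua G \<tau> a (jinv ?b))"] S(2)[of a] k_closed[OF T(1) h] a by simp
  then have "hua G \<tau> a (T (jinv ?b)) = hua G \<tau> a (jinv a)"
    using k_hua[OF T(1), of a "jinv ?b"] a j hua_jinv[OF a] by simp
  then have "T (jinv ?b) = jinv a"
    by (rule hua_inj[OF a k_closed[OF T(1) j(1)] j(2)])
  then show ?thesis using T(2) j by simp
qed

lemma hua_pow:
  fixes n :: nat
  assumes "a \<in> carrier G" "u \<in> carrier G"
  shows "hua G \<tau> (a [^] n) u = (hua G \<tau> a u [^] n) [^] n"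
proof -
  obtain T where T: "T \<in> k" "\<And>u. u \<in> carrier G \<Longrightarrow> T u = u [^] n" using k_pow by blast
  have "hua G \<tau> (T a) u = T (T (hua G \<tau> a u))" by (rule k_centroid[OF T(1) assms])
  then show ?thesis using T(2) assms hua_closed by simp
qed

lemma field_K: "field K"
  by (rule ring.subfield_iff(2)[OF ring_E subfield])

lemma J_simps [simp]:
  "carrier J = carrier G" "mult (add_monoid J) = mult G" "add J = mult G" "zero J = \<one>" "smult J T u = T u"
  by (simp_all add: eval_module_def)

lemma abelian_group_J: "abelian_group J"
  by (rule abelian_groupI) (auto simp: m_ac intro: l_inv_ex)

lemma module_J: "module K J"
  unfolding module_def module_axioms_def
proof (intro conjI allI impI)
  show "cring K" using field_K by (simp add: field_def domain_def)
  show "abelian_group J" by (rule abelian_group_J)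
\<comment> \<open>Products in \<open>K\<close> compose from left to right, so commutativity of
  \<open>k\<close> is what makes evaluation a left action.\<close>
qed (use k_closed k_hom k_commute in \<open>auto simp: E_ops\<close>)

lemma vectorspace_J: "vectorspace K J"
  unfolding vectorspace_def using module_J field_K by simp

lemma J_uminus [simp]: "\<ominus>\<^bsub>J\<^esub> u = inv u"
  by (simp add: a_inv_def m_inv_def)

lemma J_minus [simp]: "u \<ominus>\<^bsub>J\<^esub> v = u \<otimes> inv v"
  by (simp add: a_minus_def)

text \<open>A fixed choice, so that it can be a parameter of the interpretations that
  follow.\<close>

definition generators :: "'a set" where
  "generators = (SOME C. finite C \<and> C \<subseteq> carrier G \<and> LinearCombinations.module.gen_set K J C)"

lemma generators: "finite generators" "generators \<subseteq> carrier G" "LinearCombinations.module.gen_set K J generators"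
proof -
  have "\<exists>C. finite C \<and> C \<subseteq> carrier G \<and> LinearCombinations.module.gen_set K J C"
    using fin_dim unfolding vectorspace.fin_dim_def[OF vectorspace_J] by simp
  from someI_ex[OF this] show "finite generators" "generators \<subseteq> carrier G" "LinearCombinations.module.gen_set K J generators"
    unfolding generators_def by auto
qed

lemma emb_finsum:
  assumes "finite C" "\<And>v. v \<in> C \<Longrightarrow> f v \<in> carrier G"
  shows "emb (finsum J f C) = (\<Sum>v\<in>C. emb (f v))"
  using assms
proof (induction C rule: finite_induct)
  case empty
  interpret J: abelian_group J by (rule abelian_group_J)
  show ?case by (simp add: emb_one)
next
  case (insert x C)
  interpret J: abelian_group J by (rule abelian_group_J)
  have f: "f \<in> C \<rightarrow> carrier J" "f x \<in> carrier J" using insert.prems by auto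
  have "finsum J f (insert x C) = f x \<otimes> finsum J f C"
    using J.finsum_insert[OF insert.hyps f] by simp
  moreover have "finsum J f C \<in> carrier G" using J.finsum_closed[OF f(1)] by simp
  ultimately show ?case using insert f by (simp add: emb_mult)
qed

section \<open>Transfer to arithmetic in the embedded group\<close>

definition V :: "'a cgroup_prod set" where "V = emb ` carrier G"
text \<open>The values of a scalar outside \<open>V\<close> are arbitrary, so that the identity is one.\<close>

definition scalars :: "('a cgroup_prod \<Rightarrow> 'a cgroup_prod) set" where
  "scalars = {T. \<exists>S\<in>k. \<forall>u\<in>carrier G. T (emb u) = emb (S u)}"

lemma scalars_lift: "S \<in> k \<Longrightarrow> (\<lambda>x. emb (S (prj x))) \<in> scalars"
  by (auto simp: scalars_def)

lemma emb_V [simp]: "u \<in> carrier G \<Longrightarrow> emb u \<in> V"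
  by (simp add: V_def)

lemma V_cases: "x \<in> V \<Longrightarrow> (\<And>u. u \<in> carrier G \<Longrightarrow> x = emb u \<Longrightarrow> P) \<Longrightarrow> P"
  by (auto simp: V_def)

lemma generators_span:
  assumes "x \<in> V" shows "\<exists>l. (\<forall>b\<in>emb ` generators. l b \<in> scalars) \<and> x = (\<Sum>b\<in>emb ` generators. l b b)"
  using assms
proof (rule V_cases)
  fix u assume u: "u \<in> carrier G" "x = emb u"
  interpret M: module K J by (rule module_J)
  have "u \<in> M.span generators" using generators(3) u by simp
  then obtain a where a: "a \<in> generators \<rightarrow> k" "u = M.lincomb a generators"
    using M.finite_span[of generators] generators(1,2) by auto
  have aV: "a v v \<in> carrier G" if "v \<in> generators" for v
    using k_closed[of "a v" v] a(1) generators(2) that by blast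
  let ?l = "\<lambda>b x. emb (a (prj b) (prj x))"
  have "x = (\<Sum>v\<in>generators. emb (a v v))"
    unfolding u(2) a(2) M.lincomb_def using emb_finsum[OF generators(1), of "\<lambda>v. a v v"] aV by simp
  also have "\<dots> = (\<Sum>v\<in>generators. ?l (emb v) (emb v))"
    using generators(2) by (intro sum.cong refl) auto
  also have "\<dots> = (\<Sum>b\<in>emb ` generators. ?l b b)"
    by (subst sum.reindex) (use generators(2) emb_inject in \<open>auto simp: inj_on_def\<close>)
  finally have "x = (\<Sum>b\<in>emb ` generators. ?l b b)" .
  moreover have "\<forall>b\<in>emb ` generators. ?l b \<in> scalars"
  proof
    fix b assume "b \<in> emb ` generators"
    then have "a (prj b) \<in> k" using a(1) generators(2) by (auto simp: subset_iff)
    then show "?l b \<in> scalars" by (rule scalars_lift)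
  qed
  ultimately show ?thesis by (intro exI[of _ ?l]) simp
qed

sublocale V: torsion_free_subgroup V
proof
  show "0 \<in> V" using emb_V[OF one_closed] by (simp add: emb_one)
next
  fix x y assume "x \<in> V" "y \<in> V"
  then show "x + y \<in> V" by (auto elim!: V_cases simp flip: emb_mult)
next
  fix x assume "x \<in> V"
  then show "- x \<in> V" by (auto elim!: V_cases simp flip: emb_inv)
next
  fix x and n :: nat assume "x \<in> V" "n \<cdot> x = 0" "n > 0"
  from \<open>x \<in> V\<close> show "x = 0"
  proof (rule V_cases)
    fix u assume u: "u \<in> carrier G" "x = emb u"
    then have "u [^] n = \<one>" using \<open>n \<cdot> x = 0\<close> by (simp add: emb_eq_0 flip: emb_pow)
    then have "u = \<one>" using pow_nonzero[OF nonzeroI \<open>n > 0\<close>] u by (auto simp: nonzero_def)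
    then show "x = 0" using u by (simp add: emb_one)
  qed
qed

lemma endo_emb:
  assumes "\<And>u. u \<in> carrier G \<Longrightarrow> f (emb u) = emb (g u)" "\<And>u. u \<in> carrier G \<Longrightarrow> g u \<in> carrier G"
    "\<And>u v. u \<in> carrier G \<Longrightarrow> v \<in> carrier G \<Longrightarrow> g (u \<otimes> v) = g u \<otimes> g v"
  shows "V.endo f"
  unfolding V.endo_def by (auto elim!: V_cases simp: assms simp flip: emb_mult)

sublocale V: finite_dim_over_field V scalars "emb ` generators"
proof
  fix T assume "T \<in> scalars"
  then obtain T' where T: "T' \<in> k" "\<forall>u\<in>carrier G. T (emb u) = emb (T' u)" by (auto simp: scalars_def)
  show "V.endo T" by (rule endo_emb[where g = T']) (use T k_closed k_hom in auto)
  have "\<forall>u\<in>carrier G. - T (emb u) = emb ((\<lambda>u\<in>carrier G. inv (T' u)) u)"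
    using T by (simp add: emb_inv k_closed[OF T(1)])
  then show "(\<lambda>x. - T x) \<in> scalars" using k_uminus[OF T(1)] unfolding scalars_def by blast
  show "(\<forall>x\<in>V. T x = 0) \<or> (\<exists>S\<in>scalars. \<forall>x\<in>V. S (T x) = x)"
  proof (cases "T' = \<zero>\<^bsub>E\<^esub>")
    case True
    then show ?thesis using T by (auto elim!: V_cases simp: E_ops emb_one)
  next
    case False
    then obtain S where S: "S \<in> k" "\<forall>u\<in>carrier G. S (T' u) = u" using k_inverse T(1) by blast
    then have "\<forall>x\<in>V. emb (S (prj (T x))) = x" using T by (auto elim!: V_cases simp: k_closed[OF T(1)])
    then show ?thesis by (intro disjI2 bexI[OF _ scalars_lift[OF S(1)]])
  qed
next
  fix S T assume "S \<in> scalars" "T \<in> scalars"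
  then obtain S' T' where S: "S' \<in> k" "\<forall>u\<in>carrier G. S (emb u) = emb (S' u)"
    and T: "T' \<in> k" "\<forall>u\<in>carrier G. T (emb u) = emb (T' u)" by (auto simp: scalars_def)
  have "\<forall>u\<in>carrier G. S (emb u) + T (emb u) = emb ((S' \<oplus>\<^bsub>E\<^esub> T') u)"
    using S T by (simp add: E_ops emb_mult k_closed[OF S(1)] k_closed[OF T(1)])
  then show "(\<lambda>x. S x + T x) \<in> scalars" using k_ring(7)[OF S(1) T(1)] unfolding scalars_def by blast
  have "\<forall>u\<in>carrier G. S (T (emb u)) = emb ((T' \<otimes>\<^bsub>E\<^esub> S') u)"
    using S T by (simp add: E_ops k_closed[OF T(1)])
  then show "(\<lambda>x. S (T x)) \<in> scalars" using k_ring(6)[OF T(1) S(1)] unfolding scalars_def by blast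
  fix x assume "x \<in> V"
  then show "S (T x) = T (S x)"
    using S T by (auto elim!: V_cases simp: k_closed[OF S(1)] k_closed[OF T(1)] k_commute[OF S(1) T(1)])
next
  show "(\<lambda>x. x) \<in> scalars" unfolding scalars_def using k_ring(3) E_ops(4) by (auto intro!: bexI[of _ "\<one>\<^bsub>E\<^esub>"])
  show "finite (emb ` generators)" "emb ` generators \<subseteq> V" using generators by (auto simp: V_def)
qed (fact generators_span)

definition UV :: "'a cgroup_prod \<Rightarrow> 'a cgroup_prod \<Rightarrow> 'a cgroup_prod" where
  "UV a x = emb (hua G \<tau> (prj a) (prj x))"

definition iV :: "'a cgroup_prod \<Rightarrow> 'a cgroup_prod" where "iV a = emb (jinv (prj a))"

lemma UV_emb: "a \<in> carrier G \<Longrightarrow> u \<in> carrier G \<Longrightarrow> UV (emb a) (emb u) = emb (hua G \<tau> a u)"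
  by (simp add: UV_def)

lemma iV_emb: "a \<in> carrier G \<Longrightarrow> iV (emb a) = emb (jinv a)"
  by (simp add: iV_def)

lemma emb_nonzero: "x \<in> V \<Longrightarrow> x \<noteq> 0 \<Longrightarrow> (\<And>u. u \<in> nonzero G \<Longrightarrow> x = emb u \<Longrightarrow> P) \<Longrightarrow> P"
  by (erule V_cases) (metis emb_eq_0 nonzeroI)

lemma jinv_closed: "a \<in> nonzero G \<Longrightarrow> jinv a \<in> carrier G"
  by (rule nonzero_closed[OF jinv_nonzero])

lemma emb_neq_0: "a \<in> nonzero G \<Longrightarrow> emb a \<noteq> 0"
  using emb_eq_0[of a] by (auto simp: nonzero_def)

lemma hua_inv_left: "a \<in> carrier G \<Longrightarrow> u \<in> carrier G \<Longrightarrow> hua G \<tau> (inv a) u = hua G \<tau> a u"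
  using hua_even[OF nonzeroI] by (cases "a = \<one>") auto

sublocale V: hua_inversion V scalars "emb ` generators" UV iV
proof
  fix a assume "a \<in> V" "a \<noteq> 0"
  then obtain a' where a: "a' \<in> nonzero G" "a = emb a'" by (rule emb_nonzero)
  note aC = nonzero_closed[OF a(1)] jinv_closed[OF a(1)]
  show "iV a \<in> V" "iV a \<noteq> 0" "iV (iV a) = a" "iV (- a) = - iV a"
    using a aC emb_neq_0[OF jinv_nonzero[OF a(1)]] jinv_jinv[OF a(1)] jinv_inv[OF a(1)]
    by (simp_all add: iV_emb flip: emb_inv)
  show "n \<cdot> iV (n \<cdot> a) = iV a" if "n > 0" for n
    using a aC jinv_pow[OF a(1) that] jinv_closed[OF pow_nonzero[OF a(1) that]]
    by (simp add: iV_emb flip: emb_pow)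
  show "UV a (iV a) = a" using a aC hua_jinv[OF a(1)] by (simp add: iV_emb UV_emb)
  show "UV (iV a) (UV a x) = x" if "x \<in> V" for x
    using that a aC hua_jinv_hua[OF a(1)] hua_closed by (auto elim!: V_cases simp: iV_emb UV_emb)
  show "iV (UV a x) = UV (iV a) (iV x)" if x: "x \<in> V" "x \<noteq> 0" for x
  proof -
    from x obtain x' where x': "x' \<in> nonzero G" "x = emb x'" by (rule emb_nonzero)
    then show ?thesis
      using a aC jinv_hua[OF a(1) x'(1)] hua_closed jinv_closed by (simp add: iV_emb UV_emb)
  qed
  show "iV (a + y) = iV a - iV (a + UV a (iV y))" if y: "y \<in> V" "y \<noteq> 0" "a + y \<noteq> 0" for y
  proof -
    from y(1,2) obtain y' where y': "y' \<in> nonzero G" "y = emb y'" by (rule emb_nonzero)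
    have ay: "a' \<otimes> y' \<in> nonzero G"
      using y(3) a y' aC by (intro nonzeroI) (auto simp: emb_one simp flip: emb_mult)
    note eq = hua_identity[OF a(1) y'(1) ay]
    let ?z = "a' \<otimes> hua G \<tau> a' (jinv y')"
    have yC: "y' \<in> carrier G" "jinv y' \<in> carrier G" "hua G \<tau> a' (jinv y') \<in> carrier G"
      using y'(1) jinv_closed hua_closed aC by auto
    \<comment> \<open>The properties of \<open>jinv\<close> hold away from \<open>\<one>\<close>
      only. Equality would force \<open>jinv y'\<close> and \<open>jinv (inv a')\<close> to
      coincide, hence \<open>a' \<otimes> y' = \<one>\<close>.\<close>
    have "?z \<noteq> \<one>"
    proof
      assume z: "?z = \<one>"
      then have "hua G \<tau> a' (jinv y') = inv a'"
        using aC yC by (metis inv_equality m_comm)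
      also have "\<dots> = hua G \<tau> a' (jinv (inv a'))"
        using hua_jinv[OF a(1)] aC by (simp add: jinv_inv[OF a(1)] hua_inv)
      finally have "jinv y' = jinv (inv a')"
        by (rule hua_inj[OF a(1) yC(2) jinv_closed[OF nonzero_inv[OF a(1)]]])
      then have "y' = inv a'" using jinv_jinv[OF y'(1)] jinv_jinv[OF nonzero_inv[OF a(1)]] by metis
      then show False using ay aC by (simp add: nonzero_def)
    qed
    then have zC: "jinv ?z \<in> carrier G" using aC yC by (intro jinv_closed nonzeroI) auto
    have "iV (a + y) = emb (jinv (a' \<otimes> y'))"
      using a y' aC yC by (simp add: iV_emb flip: emb_mult)
    also have "\<dots> = emb (jinv a') - emb (jinv ?z)"
      unfolding eq using aC zC by (simp add: emb_mult emb_inv)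
    also have "\<dots> = iV a - iV (a + UV a (iV y))"
      using a y' aC yC by (simp add: iV_emb UV_emb flip: emb_mult)
    finally show ?thesis .
  qed
  show "UV (a + b) x = UV a (UV (iV a + iV b) (UV b x))" if b: "b \<in> V" "b \<noteq> 0" and x: "x \<in> V" for b x
  proof -
    from b obtain b' where b': "b' \<in> nonzero G" "b = emb b'" by (rule emb_nonzero)
    from x obtain x' where x': "x' \<in> carrier G" "x = emb x'" by (rule V_cases)
    then show ?thesis
      using a b' aC jinv_closed hua_plus[OF a(1) b'(1) x'(1)] hua_closed
      by (simp add: iV_emb UV_emb flip: emb_mult)
  qed
next
  fix a assume "a \<in> V"
  then obtain a' where a: "a' \<in> carrier G" "a = emb a'" by (rule V_cases)
  show "V.endo (UV a)"
    by (rule endo_emb[where g = "hua G \<tau> a'"]) (use a hua_closed hua_mult in \<open>auto simp: UV_emb\<close>)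
  show "UV (UV a b) x = UV a (UV b (UV a x))" if "b \<in> V" "x \<in> V" for b x
    using that a hua_closed hua_hua by (auto elim!: V_cases simp: UV_emb)
  show "UV a (T x) = T (UV a x)" if "T \<in> scalars" "x \<in> V" for T x
  proof -
    from that(1) obtain T' where T: "T' \<in> k" "\<forall>u\<in>carrier G. T (emb u) = emb (T' u)" by (auto simp: scalars_def)
    from that(2) obtain x' where x: "x' \<in> carrier G" "x = emb x'" by (rule V_cases)
    then show ?thesis
      using a T k_closed[OF T(1)] k_hua[OF T(1)] hua_closed by (simp add: UV_emb)
  qed
  fix x assume "x \<in> V"
  then obtain x' where x: "x' \<in> carrier G" "x = emb x'" by (rule V_cases)
  show "UV (- a) x = UV a x" using a x hua_inv_left by (simp add: UV_emb flip: emb_inv)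
  show "UV (n \<cdot> a) x = n \<cdot> n \<cdot> UV a x" for n
    using a x hua_pow hua_closed by (simp add: UV_emb flip: emb_pow)
next
  fix x assume "x \<in> V"
  then obtain x' where x: "x' \<in> carrier G" "x = emb x'" by (rule V_cases)
  then show "UV 0 x = 0" using UV_emb[OF one_closed x(1)] by (simp add: emb_one hua_one)
qed

section \<open>The Jordan axioms for the Hua maps\<close>

lemma polar_closed: "\<lbrakk>a \<in> carrier G; b \<in> carrier G; c \<in> carrier G\<rbrakk> \<Longrightarrow> jordan_polar J (hua G \<tau>) a b c \<in> carrier G"
  by (simp add: jordan_polar_def hua_closed)

lemma emb_polar:
  assumes "a \<in> carrier G" "b \<in> carrier G" "c \<in> carrier G"
  shows "emb (jordan_polar J (hua G \<tau>) a b c) = V.pol (emb b) (emb a) (emb c)"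
  using assms
  by (simp add: jordan_polar_def V.pol_def hua_closed emb_mult[of _ "inv _"] emb_inv UV_emb flip: emb_mult[of a b])

lemma polar_mult:
  assumes "a \<in> carrier G" "a' \<in> carrier G" "b \<in> carrier G" "c \<in> carrier G"
  shows "jordan_polar J (hua G \<tau>) (a \<otimes> a') b c = jordan_polar J (hua G \<tau>) a b c \<otimes> jordan_polar J (hua G \<tau>) a' b c"
proof -
  have "emb (jordan_polar J (hua G \<tau>) (a \<otimes> a') b c) =
      emb (jordan_polar J (hua G \<tau>) a b c \<otimes> jordan_polar J (hua G \<tau>) a' b c)"
    using assms V.pol_add by (simp add: emb_polar emb_mult polar_closed)
  then show ?thesis using assms by (simp add: emb_inject polar_closed)
qed

lemma polar_smult:
  assumes "a \<in> carrier G" "b \<in> carrier G" "c \<in> carrier G" and T: "T \<in> k"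
  shows "jordan_polar J (hua G \<tau>) (T a) b c = T (jordan_polar J (hua G \<tau>) a b c)"
proof -
  let ?T = "\<lambda>x. emb (T (prj x))"
  have "V.pol (emb b) (?T (emb a)) (emb c) = ?T (V.pol (emb b) (emb a) (emb c))"
    by (rule V.pol_K) (use assms scalars_lift in auto)
  then have "emb (jordan_polar J (hua G \<tau>) (T a) b c) = emb (T (jordan_polar J (hua G \<tau>) a b c))"
    using assms k_closed[OF T] by (simp add: polar_closed flip: emb_polar)
  then show ?thesis using assms k_closed[OF T] by (simp add: emb_inject polar_closed)
qed

lemma polar_sym:
  assumes "a \<in> carrier G" "b \<in> carrier G" "c \<in> carrier G"
  shows "jordan_polar J (hua G \<tau>) a b c = jordan_polar J (hua G \<tau>) b a c"
  using assms by (simp add: jordan_polar_def m_comm[of a b] m_assoc m_comm[of "inv _" "inv _"] hua_closed)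

lemma polar_hua:
  assumes "a \<in> carrier G" "b \<in> carrier G" "c \<in> carrier G"
  shows "jordan_polar J (hua G \<tau>) a (hua G \<tau> a c) b = hua G \<tau> a (jordan_polar J (hua G \<tau>) b c a)"
proof -
  have "V.pol (emb a) (UV (emb a) (emb c)) (emb b) = UV (emb a) (V.pol (emb b) (emb c) (emb a))"
    by (rule V.pol_U) (use assms in auto)
  then have "emb (jordan_polar J (hua G \<tau>) (hua G \<tau> a c) a b) = emb (hua G \<tau> a (jordan_polar J (hua G \<tau>) c b a))"
    using assms by (simp add: UV_emb hua_closed polar_closed flip: emb_polar)
  then show ?thesis using assms by (simp add: emb_inject polar_closed hua_closed polar_sym)
qed

lemma quadratic_jordan: "quadratic_jordan_division_algebra K J (hua G \<tau>) e"
proof (rule quadratic_jordan_division_algebra.intro[OF vectorspace_J quadratic_jordan_division_algebra_axioms.intro])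
  show "e \<in> carrier J" "e \<noteq> \<zero>\<^bsub>J\<^esub>" using e_nonzero by (auto simp: nonzero_def)
next
  fix a assume "a \<in> carrier J"
  then show "hua G \<tau> a \<in> module_hom K J J"
    unfolding module_hom_def using hua_closed hua_mult k_hua by auto
next
  fix T a c assume "T \<in> carrier K" "a \<in> carrier J" "c \<in> carrier J"
  then have T: "T \<in> k" "a \<in> carrier G" "c \<in> carrier G" by auto
  have "(T [^]\<^bsub>K\<^esub> (2::nat)) u = T (T u)" if "u \<in> carrier G" for u
    using that k_closed[OF T(1)] by (simp add: numeral_2_eq_2 nat_pow_def E_ops)
  then show "hua G \<tau> (T \<odot>\<^bsub>J\<^esub> a) c = (T [^]\<^bsub>K\<^esub> (2::nat)) \<odot>\<^bsub>J\<^esub> hua G \<tau> a c"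
    using T k_centroid hua_closed by simp
next
  fix b c assume "b \<in> carrier J" "c \<in> carrier J"
  then show "(\<lambda>a. jordan_polar J (hua G \<tau>) a b c) \<in> module_hom K J J"
    unfolding module_hom_def using polar_closed polar_mult polar_smult by auto
next
  fix a c assume "a \<in> carrier J" "c \<in> carrier J"
  then show "(\<lambda>b. jordan_polar J (hua G \<tau>) a b c) \<in> module_hom K J J"
    unfolding module_hom_def using polar_closed polar_mult polar_smult polar_sym[of a] k_closed by auto
next
  fix a assume "a \<in> carrier J" "a \<noteq> \<zero>\<^bsub>J\<^esub>"
  then have a: "a \<in> nonzero G" by (simp add: nonzero_def)
  then have ia: "jinv a \<in> nonzero G" "jinv (jinv a) = a" using jinv_nonzero jinv_jinv by auto
  show "bij_betw (hua G \<tau> a) (carrier J) (carrier J)"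
    by (rule bij_betwI[where g = "hua G \<tau> (jinv a)"])
      (use a ia hua_closed hua_jinv_hua[OF a] hua_jinv_hua[OF ia(1)] in auto)
next
  fix a b c assume "a \<in> carrier J" "b \<in> carrier J" "c \<in> carrier J"
  then show "jordan_V J (hua G \<tau>) a b (hua G \<tau> a c) = hua G \<tau> a (jordan_V J (hua G \<tau>) b a c)"
    using polar_hua by (simp add: jordan_V_def)
qed (use hua_e hua_hua in auto)

section \<open>Identification of the two Moufang sets\<close>

lemma jordan_inverse_eq: assumes "a \<in> nonzero G" shows "jordan_inverse J (hua G \<tau>) a = jinv a"
proof -
  have "inj_on (hua G \<tau> a) (carrier J)" using hua_inj[OF assms] by (auto intro: inj_onI)
  then show ?thesis
    unfolding jordan_inverse_def using inv_into_f_f[of "hua G \<tau> a" "carrier J" "jinv a"] hua_jinv[OF assms] jinv_closed[OF assms] by simp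
qed

lemma points_J: "points (add_monoid J) = X"
  by (simp add: points_def)

lemmas points_J' = points_J[simplified J_simps]

text \<open>The two signs cancel: the Jordan inverse of \<open>a\<close> is
  \<open>jinv a = inv (t a)\<close>, and \<open>jordan_tau\<close> inverts it again. Hence the
  identity map will be the isomorphism.\<close>

lemma jordan_tau_eq: "jordan_tau J (hua G \<tau>) = \<tau>"
proof
  fix x
  show "jordan_tau J (hua G \<tau>) x = \<tau> x"
  proof (cases "x \<in> X")
    case False
    have "\<tau> \<in> extensional X" using swaps by (simp add: swaps_zero_infinity_def BijGroup_def Bij_def)
    then show ?thesis using False by (simp add: jordan_tau_def points_J' extensional_def)
  next
    case True
    then show ?thesis
    proof (rule points_cases)
      fix u assume u: "u \<in> carrier G" "x = Some u"
      show ?thesis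
      proof (cases "u = \<one>")
        case False
        then have "u \<in> nonzero G" using u nonzeroI by blast
        then show ?thesis using u False
          by (simp add: jordan_tau_def points_J' jordan_inverse_eq tau_Some_t jinv_def)
      qed (use u in \<open>simp add: jordan_tau_def points_J'\<close>)
    qed (simp add: jordan_tau_def points_J')
  qed
qed

lemma root_group_J: "root_group (add_monoid J) (jordan_tau J (hua G \<tau>)) = R"
proof -
  have "alpha (add_monoid J) a = A a" for a by (simp add: alpha_def points_J')
  then have "root_infinity (add_monoid J) = root_infinity G" "alpha (add_monoid J) = A"
    by (auto simp: root_infinity_def)
  then show ?thesis
    unfolding jordan_tau_eq root_group_def[abs_def] root_zero_def points_J by simp
qed

lemma iso: "moufang_iso X R (points (add_monoid J)) (root_group (add_monoid J) (jordan_tau J (hua G \<tau>))) (\<lambda>x. x)"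
  unfolding points_J root_group_J moufang_iso_def
proof (intro conjI ballI)
  show "bij_betw (\<lambda>x. x) X X" by (simp add: bij_betw_def)
  fix x assume x: "x \<in> X"
  have inv_id: "inv_into X (\<lambda>x. x) y = y" if "y \<in> X" for y
    using inv_into_f_f[of "\<lambda>x. x" X y] that by simp
  have "conj_map X X (\<lambda>x. x) g = g" if "g \<in> R x" for g
  proof -
    have "subgroup (R x) (BijGroup X)" using moufang x by (simp add: moufang_set_def)
    then have "g \<in> Bij X" using subgroup.mem_carrier that by (fastforce simp: BijGroup_def)
    then have "g \<in> extensional X" by (simp add: Bij_def)
    then show ?thesis unfolding conj_map_def using inv_id by (intro ext) (simp add: extensional_def)
  qed
  then show "conj_map X X (\<lambda>x. x) ` R x = R x" by force
qed

end

theorem corollary1p12: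
  fixes G :: "('a, 'm) monoid_scheme"
    and \<tau> :: "'a option \<Rightarrow> 'a option"
    and e :: 'a
    and k :: "('a \<Rightarrow> 'a) set"
  assumes "comm_group G"
    and "carrier G \<noteq> {\<one>\<^bsub>G\<^esub>}"
    and "torsion_free G"
    and "swaps_zero_infinity G \<tau>"
    and "moufang_set (points G) (root_group G \<tau>)"
    and "e \<in> nonzero G" and "\<tau> = mu G \<tau> e"
    and "special G \<tau>"
    and "subfield k (end_hua G \<tau>)" and "k \<subseteq> centroid G \<tau>"
    and "vectorspace.fin_dim (end_hua G \<tau> \<lparr>carrier := k\<rparr>) (eval_module G)"
  shows "\<exists>(K :: ('a \<Rightarrow> 'a) ring) (J :: ('a \<Rightarrow> 'a, 'a) module) Q one_J \<beta>.
           quadratic_jordan_division_algebra K J Q one_J \<and>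
           moufang_iso (points G) (root_group G \<tau>)
             (points (add_monoid J)) (root_group (add_monoid J) (jordan_tau J Q)) \<beta>"
proof -
  interpret comm_group G by (rule assms(1))
  have "special_moufang G \<tau> e"
    by (rule special_moufang.intro[OF assms(1) special_moufang_axioms.intro]) (rule assms)+
  then interpret moufang_over_subfield G \<tau> e k
    by (rule moufang_over_subfield.intro[OF _ moufang_over_subfield_axioms.intro]) (rule assms)+
  show ?thesis using quadratic_jordan iso by blast
qed

end
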